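(* Let $(M,\Omega)$ be an almost $G_2$-manifold, $C$ an oriented smooth four dimensional manifold, and $E$ a Hermitian line bundle (rank one) over $C$. Let $\mathcal{C}=Map(C,M)\times\mathcal{A}(E)$ and let $\Phi_0$ be the one form on $\mathcal{C}$ given by $$\Phi_0(f,D_E)(v,B)=\int_C Tr\left[f^*(\iota_v\Omega)\wedge F_E+f^*\Omega\wedge B\right]$$ for $(f,D_E)\in\mathcal{C}$ and $(v,B)\in T_{(f,D_E)}\mathcal{C}=\Gamma(C,f^*T_M)\times\Omega^1(C,ad(E))$. Then the zeros of $\Phi_0$ are the same as the parametrized $\mathbb{H}$-SLag cycles in $M$; that is, for $(f,D_E)\in\mathcal{C}$, one has $\Phi_0(f,D_E)(v,B)=0$ for all $(v,B)$ if and only if $(f,D_E)$ is a parametrized $\mathbb{H}$-SLag cycle in $M$.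
   Context: A three form on a seven manifold is positive if at each point it is, in suitable linear coordinates, $f^1f^2f^3-f^1(e^1e^0+e^2e^3)-f^2(e^2e^0+e^3e^1)-f^3(e^3e^0+e^1e^2)$ for a basis $e^0,e^1,e^2,e^3,f^1,f^2,f^3$ of covectors (juxtaposition is the wedge product); it determines a unique compatible inner product, for which this basis is orthonormal. An almost $G_2$-manifold is a seven dimensional manifold $M$ equipped with a positive closed three form $\Omega$, and $M$ carries the Riemannian metric determined by $\Omega$. $Map(C,M)$ is the space of maps $f:C\to M$, $\mathcal{A}(E)$ is the space of Hermitian connections $D_E$ on $E$, $F_E$ is the curvature of $D_E$, and $ad(E)$ is the bundle of skew-Hermitian endomorphisms of $E$. The space $\mathcal{C}$ is called the configuration space. Here $f^*(\iota_v\Omega)$ denotes the two form $(a,b)\mapsto\Omega(v,df(a),df(b))$ on $C$. An element $(f,D_E)$ of $\mathcal{C}$ is called a parametrized $\mathbb{H}$-SLag cycle in $M$ if $f^*\Omega=F_E^+=0$, where $F_E^+$ is the self-dual part of $F_E$ and self-duality on $C$ is defined using the pullback metric from $M$.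
   Formalization: The maps f are taken to be immersions (so the pullback metric is nondegenerate), C is assumed to carry the orientation on which *Ω is positive whenever f*Ω=0 (the claim fails for the opposite one), and (v,B) range over compactly supported sections so that the integral exists. *)

theory Defs
  imports "HOL-Analysis.Analysis"
begin

section \<open>Smooth functions on open subsets of Euclidean space\<close>

fun Ck_on :: "nat \<Rightarrow> ('a::euclidean_space \<Rightarrow> 'b::real_normed_vector) \<Rightarrow> 'a set \<Rightarrow> bool" where
  "Ck_on 0 f S \<longleftrightarrow> continuous_on S f"
| "Ck_on (Suc k) f S \<longleftrightarrow> (\<forall>x\<in>S. f differentiable (at x)) \<and>
     (\<forall>v. Ck_on k (\<lambda>x. frechet_derivative f (at x) v) S)"

definition smooth_on :: "('a::euclidean_space \<Rightarrow> 'b::real_normed_vector) \<Rightarrow> 'a set \<Rightarrow> bool" where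
  "smooth_on f S \<longleftrightarrow> (\<forall>k. Ck_on k f S)"


section \<open>Smooth manifolds\<close>

text \<open>A chart is a pair of its domain and its coordinate map. A manifold is a second countable
  Hausdorff space (the whole type) together with a smooth atlas. The atlas need not be maximal.\<close>

type_synonym ('m, 'e) chart = "'m set \<times> ('m \<Rightarrow> 'e)"

definition chart_inv :: "('m, 'e) chart \<Rightarrow> 'e \<Rightarrow> 'm" where
  "chart_inv c = inv_into (fst c) (snd c)"

definition smooth_atlas ::
  "('m::{t2_space, second_countable_topology}, 'e::euclidean_space) chart set \<Rightarrow> bool" where
  "smooth_atlas A \<longleftrightarrow>
     (\<forall>c\<in>A. open (fst c) \<and> open (snd c ` fst c) \<and>
        homeomorphism (fst c) (snd c ` fst c) (snd c) (chart_inv c)) \<and>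
     (\<Union>c\<in>A. fst c) = UNIV \<and>
     (\<forall>c\<in>A. \<forall>d\<in>A. smooth_on (snd d \<circ> chart_inv c) (snd c ` (fst c \<inter> fst d)))"

definition oriented_atlas ::
  "('m::{t2_space, second_countable_topology}, real ^ 'n) chart set \<Rightarrow> bool" where
  "oriented_atlas A \<longleftrightarrow> smooth_atlas A \<and>
     (\<forall>c\<in>A. \<forall>d\<in>A. \<forall>x\<in>fst c \<inter> fst d.
        det (matrix (frechet_derivative (snd d \<circ> chart_inv c) (at (snd c x)))) > 0)"

text \<open>Every point gets a preferred chart, and the tangent space at a point is the model space,
  a tangent vector being given by its components in the preferred chart. All smoothness conditions
  below refer to arbitrary charts. \<open>coord_vec A c x X\<close> is the tangent vector at \<open>x\<close> whose components
  in the chart \<open>c\<close> are \<open>X\<close>; \<open>vec_coord A c x\<close> is the inverse operation.\<close>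

definition chart_at :: "('m, 'e) chart set \<Rightarrow> 'm \<Rightarrow> ('m, 'e) chart" where
  "chart_at A x = (SOME c. c \<in> A \<and> x \<in> fst c)"

definition coord_vec :: "('m, 'e::euclidean_space) chart set \<Rightarrow> ('m, 'e) chart \<Rightarrow> 'm \<Rightarrow> 'e \<Rightarrow> 'e" where
  "coord_vec A c x = frechet_derivative (snd (chart_at A x) \<circ> chart_inv c) (at (snd c x))"

definition vec_coord :: "('m, 'e::euclidean_space) chart set \<Rightarrow> ('m, 'e) chart \<Rightarrow> 'm \<Rightarrow> 'e \<Rightarrow> 'e" where
  "vec_coord A c x = frechet_derivative (snd c \<circ> chart_inv (chart_at A x)) (at (snd (chart_at A x) x))"

definition smooth_fun_on ::
  "('m, 'e::euclidean_space) chart set \<Rightarrow> 'm set \<Rightarrow> ('m \<Rightarrow> 'b::real_normed_vector) \<Rightarrow> bool" where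
  "smooth_fun_on A U h \<longleftrightarrow> (\<forall>c\<in>A. smooth_on (h \<circ> chart_inv c) (snd c ` (fst c \<inter> U)))"

text \<open>The derivative of a vector-valued function at \<open>x\<close> in the direction of a tangent vector.\<close>

definition fun_deriv ::
  "('m, 'e::euclidean_space) chart set \<Rightarrow> ('m \<Rightarrow> 'b::real_normed_vector) \<Rightarrow> 'm \<Rightarrow> 'e \<Rightarrow> 'b" where
  "fun_deriv A h x = frechet_derivative (h \<circ> chart_inv (chart_at A x)) (at (snd (chart_at A x) x))"

definition smooth_map ::
  "('c::topological_space, 'd::euclidean_space) chart set \<Rightarrow>
   ('m::topological_space, 'e::euclidean_space) chart set \<Rightarrow> ('c \<Rightarrow> 'm) \<Rightarrow> bool" where
  "smooth_map A B f \<longleftrightarrow> continuous_on UNIV f \<and>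
     (\<forall>c\<in>A. \<forall>d\<in>B. smooth_on (snd d \<circ> f \<circ> chart_inv c) (snd c ` (fst c \<inter> f -` fst d)))"

definition map_deriv ::
  "('c, 'd::euclidean_space) chart set \<Rightarrow> ('m, 'e::euclidean_space) chart set \<Rightarrow>
   ('c \<Rightarrow> 'm) \<Rightarrow> 'c \<Rightarrow> 'd \<Rightarrow> 'e" where
  "map_deriv A B f x =
     frechet_derivative (snd (chart_at B (f x)) \<circ> f \<circ> chart_inv (chart_at A x))
       (at (snd (chart_at A x) x))"

definition immersion ::
  "('c::topological_space, 'd::euclidean_space) chart set \<Rightarrow>
   ('m::topological_space, 'e::euclidean_space) chart set \<Rightarrow> ('c \<Rightarrow> 'm) \<Rightarrow> bool" where
  "immersion A B f \<longleftrightarrow> smooth_map A B f \<and> (\<forall>x. inj (map_deriv A B f x))"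


section \<open>Differential forms\<close>

text \<open>A \<open>k\<close>-form at a point is a function on lists of \<open>k\<close> tangent vectors; its values on lists of any
  other length are irrelevant.\<close>

definition alternating :: "nat \<Rightarrow> ('e::real_vector list \<Rightarrow> 'b::real_vector) \<Rightarrow> bool" where
  "alternating k \<alpha> \<longleftrightarrow>
     (\<forall>vs i. length vs = k \<and> i < k \<longrightarrow> linear (\<lambda>X. \<alpha> (vs[i := X]))) \<and>
     (\<forall>vs i j. length vs = k \<and> i < j \<and> j < k \<and> vs ! i = vs ! j \<longrightarrow> \<alpha> vs = 0)"

text \<open>The local expression of a form in a chart \<open>c\<close>, at a point \<open>y\<close> of the coordinate domain.\<close>

definition coord_form ::
  "('m, 'e::euclidean_space) chart set \<Rightarrow> ('m \<Rightarrow> 'e list \<Rightarrow> 'b) \<Rightarrow> ('m, 'e) chart \<Rightarrow> 'e \<Rightarrow> 'e list \<Rightarrow> 'b"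
  where
  "coord_form A \<omega> c y Xs = \<omega> (chart_inv c y) (map (coord_vec A c (chart_inv c y)) Xs)"

definition smooth_form ::
  "('m, 'e::euclidean_space) chart set \<Rightarrow> nat \<Rightarrow> ('m \<Rightarrow> 'e list \<Rightarrow> 'b::real_normed_vector) \<Rightarrow> bool" where
  "smooth_form A k \<omega> \<longleftrightarrow> (\<forall>x. alternating k (\<omega> x)) \<and>
     (\<forall>c\<in>A. \<forall>Xs. length Xs = k \<longrightarrow> smooth_on (\<lambda>y. coord_form A \<omega> c y Xs) (snd c ` fst c))"

text \<open>The exterior derivative in coordinates, evaluated on \<open>k + 1\<close> constant vector fields.\<close>

definition ext_deriv ::
  "nat \<Rightarrow> ('e::euclidean_space \<Rightarrow> 'e list \<Rightarrow> 'b::real_normed_vector) \<Rightarrow> 'e \<Rightarrow> 'e list \<Rightarrow> 'b" where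
  "ext_deriv k \<eta> y Xs =
     (\<Sum>i\<le>k. (-1) ^ i *\<^sub>R frechet_derivative (\<lambda>z. \<eta> z (take i Xs @ drop (Suc i) Xs)) (at y) (Xs ! i))"

definition closed_form ::
  "('m, 'e::euclidean_space) chart set \<Rightarrow> nat \<Rightarrow> ('m \<Rightarrow> 'e list \<Rightarrow> 'b::real_normed_vector) \<Rightarrow> bool" where
  "closed_form A k \<omega> \<longleftrightarrow>
     (\<forall>c\<in>A. \<forall>y\<in>snd c ` fst c. \<forall>Xs. length Xs = Suc k \<longrightarrow> ext_deriv k (coord_form A \<omega> c) y Xs = 0)"

text \<open>Normalisation: \<open>(\<alpha> \<and> \<beta>)(u, v) = \<alpha>(u) \<beta>(v) - \<alpha>(v) \<beta>(u)\<close> for one-forms.\<close>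

definition wedge ::
  "nat \<Rightarrow> nat \<Rightarrow> ('e list \<Rightarrow> real) \<Rightarrow> ('e list \<Rightarrow> 'b::real_vector) \<Rightarrow> 'e list \<Rightarrow> 'b" where
  "wedge k l \<alpha> \<beta> vs = (1 / (fact k * fact l)) *\<^sub>R
     (\<Sum>\<sigma> | \<sigma> permutes {..<k + l}.
        (of_int (sign \<sigma>) * \<alpha> (map (\<lambda>i. vs ! \<sigma> i) [0..<k])) *\<^sub>R
        \<beta> (map (\<lambda>i. vs ! \<sigma> i) [k..<k + l]))"

text \<open>The wedge product of the coordinate covectors with indices in the list \<open>I\<close>.\<close>

definition dx :: "'n::finite list \<Rightarrow> (real ^ 'n) list \<Rightarrow> real" where
  "dx I vs = (\<Sum>\<sigma> | \<sigma> permutes {..<length I}.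
     of_int (sign \<sigma>) * (\<Prod>k<length I. (vs ! \<sigma> k) $ (I ! k)))"

definition pullback ::
  "('c, 'd::euclidean_space) chart set \<Rightarrow> ('m, 'e::euclidean_space) chart set \<Rightarrow> ('c \<Rightarrow> 'm) \<Rightarrow>
   ('m \<Rightarrow> 'e list \<Rightarrow> 'b) \<Rightarrow> 'c \<Rightarrow> 'd list \<Rightarrow> 'b" where
  "pullback A B f \<omega> x vs = \<omega> (f x) (map (map_deriv A B f x) vs)"

text \<open>For a section \<open>v\<close> of the pullback of the tangent bundle along \<open>f\<close>.\<close>

definition pullback_contract ::
  "('c, 'd::euclidean_space) chart set \<Rightarrow> ('m, 'e::euclidean_space) chart set \<Rightarrow> ('c \<Rightarrow> 'm) \<Rightarrow>
   ('c \<Rightarrow> 'e) \<Rightarrow> ('m \<Rightarrow> 'e list \<Rightarrow> 'b) \<Rightarrow> 'c \<Rightarrow> 'd list \<Rightarrow> 'b" where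
  "pullback_contract A B f v \<omega> x vs = \<omega> (f x) (v x # map (map_deriv A B f x) vs)"


section \<open>Integration of top degree forms on an oriented four-manifold\<close>

text \<open>The standard orientation of \<open>real ^ 4\<close> is given by the basis with indices 0, 1, 2, 3.\<close>

definition std_basis4 :: "(real ^ 4) list" where
  "std_basis4 = map (\<lambda>i. axis i 1) [0, 1, 2, 3]"

text \<open>The manifold is cut into countably many disjoint Borel pieces, each inside one positively
  oriented chart. For a continuous compactly supported form the sum below converges absolutely and
  does not depend on the pieces or the charts, by the change of variables formula.\<close>

definition chart_partition ::
  "('c::topological_space, 'e) chart set \<Rightarrow> (nat \<Rightarrow> ('c, 'e) chart) \<Rightarrow> (nat \<Rightarrow> 'c set) \<Rightarrow> bool" where
  "chart_partition A c S \<longleftrightarrow> (\<forall>i. c i \<in> A \<and> S i \<in> sets borel \<and> S i \<subseteq> fst (c i)) \<and>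
     disjoint_family S \<and> (\<Union>i. S i) = UNIV"

definition form_integral ::
  "('c::topological_space, real ^ 4) chart set \<Rightarrow> ('c \<Rightarrow> (real ^ 4) list \<Rightarrow> complex) \<Rightarrow> complex" where
  "form_integral A \<omega> = (let (c, S) = (SOME (c, S). chart_partition A c S) in
     (\<Sum>i. LINT y : snd (c i) ` S i | lborel. coord_form A \<omega> (c i) y std_basis4))"


section \<open>Almost \<open>G\<^sub>2\<close>-manifolds\<close>

text \<open>On \<open>real ^ 7\<close> the covectors \<open>e\<^sup>0, e\<^sup>1, e\<^sup>2, e\<^sup>3\<close> are the coordinates 0, 1, 2, 3 and
  \<open>f\<^sup>1, f\<^sup>2, f\<^sup>3\<close> are the coordinates 4, 5, 6.\<close>

definition G2_form :: "(real ^ 7) list \<Rightarrow> real" where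
  "G2_form vs = dx [4, 5, 6] vs
     - (dx [4, 1, 0] vs + dx [4, 2, 3] vs)
     - (dx [5, 2, 0] vs + dx [5, 3, 1] vs)
     - (dx [6, 3, 0] vs + dx [6, 1, 2] vs)"

text \<open>The Hodge dual of \<open>G2_form\<close>. The orientation of \<open>real ^ 7\<close> determined by
  \<open>\<Omega> = G2_form\<close>, for which \<open>\<iota>\<^sub>u\<Omega> \<and> \<iota>\<^sub>u\<Omega> \<and> \<Omega>\<close> is positive for \<open>u \<noteq> 0\<close>, is that of
  \<open>f\<^sup>1 f\<^sup>2 f\<^sup>3 e\<^sup>1 e\<^sup>0 e\<^sup>2 e\<^sup>3\<close>.\<close>

definition G2_dual_form :: "(real ^ 7) list \<Rightarrow> real" where
  "G2_dual_form vs = dx [1, 0, 2, 3] vs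
     - (dx [5, 6, 1, 0] vs + dx [5, 6, 2, 3] vs)
     - (dx [6, 4, 2, 0] vs + dx [6, 4, 3, 1] vs)
     - (dx [4, 5, 3, 0] vs + dx [4, 5, 1, 2] vs)"

definition adapted :: "((real ^ 7) list \<Rightarrow> real) \<Rightarrow> (real ^ 7 \<Rightarrow> real ^ 7) \<Rightarrow> bool" where
  "adapted \<phi> L \<longleftrightarrow> linear L \<and> bij L \<and> (\<forall>vs. length vs = 3 \<longrightarrow> \<phi> vs = G2_form (map L vs))"

definition positive_form :: "((real ^ 7) list \<Rightarrow> real) \<Rightarrow> bool" where
  "positive_form \<phi> \<longleftrightarrow> (\<exists>L. adapted \<phi> L)"

text \<open>The metric and the dual four-form of a positive form do not depend on the adapted coordinates,
  since the stabiliser of \<open>G2_form\<close> preserves the standard inner product and orientation.\<close>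

definition adapted_coords :: "((real ^ 7) list \<Rightarrow> real) \<Rightarrow> real ^ 7 \<Rightarrow> real ^ 7" where
  "adapted_coords \<phi> = (SOME L. adapted \<phi> L)"

definition G2_metric :: "((real ^ 7) list \<Rightarrow> real) \<Rightarrow> real ^ 7 \<Rightarrow> real ^ 7 \<Rightarrow> real" where
  "G2_metric \<phi> u w = adapted_coords \<phi> u \<bullet> adapted_coords \<phi> w"

definition G2_dual :: "((real ^ 7) list \<Rightarrow> real) \<Rightarrow> (real ^ 7) list \<Rightarrow> real" where
  "G2_dual \<phi> vs = G2_dual_form (map (adapted_coords \<phi>) vs)"

definition almost_G2_manifold ::
  "('m::{t2_space, second_countable_topology}, real ^ 7) chart set \<Rightarrow>
   ('m \<Rightarrow> (real ^ 7) list \<Rightarrow> real) \<Rightarrow> bool" where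
  "almost_G2_manifold A \<Omega> \<longleftrightarrow> smooth_atlas A \<and> smooth_form A 3 \<Omega> \<and> closed_form A 3 \<Omega> \<and>
     (\<forall>p. positive_form (\<Omega> p))"


section \<open>Self-duality on an oriented four-dimensional inner product space\<close>

definition oriented_onb :: "(real ^ 4 \<Rightarrow> real ^ 4 \<Rightarrow> real) \<Rightarrow> (real ^ 4) list \<Rightarrow> bool" where
  "oriented_onb h b \<longleftrightarrow> length b = 4 \<and>
     (\<forall>i<4. \<forall>j<4. h (b ! i) (b ! j) = (if i = j then 1 else 0)) \<and> dx [0, 1, 2, 3] b > 0"

text \<open>\<open>dx [0, 1, 2, 3] vs / dx [0, 1, 2, 3] b\<close> is the volume form of \<open>h\<close>, so that
  \<open>b\<^sup>0 \<and> b\<^sup>1\<close> is mapped to \<open>b\<^sup>2 \<and> b\<^sup>3\<close>. The result does not depend on \<open>b\<close>.\<close>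

definition hodge2 ::
  "(real ^ 4 \<Rightarrow> real ^ 4 \<Rightarrow> real) \<Rightarrow> ((real ^ 4) list \<Rightarrow> 'b::real_vector) \<Rightarrow> (real ^ 4) list \<Rightarrow> 'b" where
  "hodge2 h \<beta> us = (let b = (SOME b. oriented_onb h b) in
     (1 / 2) *\<^sub>R (\<Sum>i<4. \<Sum>j<4.
        (dx [0, 1, 2, 3] (b ! i # b ! j # us) / dx [0, 1, 2, 3] b) *\<^sub>R \<beta> [b ! i, b ! j]))"

definition self_dual_part ::
  "(real ^ 4 \<Rightarrow> real ^ 4 \<Rightarrow> real) \<Rightarrow> ((real ^ 4) list \<Rightarrow> 'b::real_vector) \<Rightarrow> (real ^ 4) list \<Rightarrow> 'b" where
  "self_dual_part h \<beta> us = (1 / 2) *\<^sub>R (\<beta> us + hodge2 h \<beta> us)"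


section \<open>Hermitian line bundles and connections\<close>

text \<open>The total space is the type \<open>'l\<close>; a local trivialisation is a pair of an open set \<open>V\<close> and a
  map \<open>\<tau>\<close> that identifies each fibre over \<open>V\<close> with the complex numbers.\<close>

record ('c, 'l) line_bundle =
  proj :: "'l \<Rightarrow> 'c"
  trivs :: "('c set \<times> ('l \<Rightarrow> complex)) set"
  herm :: "'l \<Rightarrow> 'l \<Rightarrow> complex"

definition hermitian_line_bundle ::
  "('c::topological_space, 'e::euclidean_space) chart set \<Rightarrow> ('c, 'l) line_bundle \<Rightarrow> bool" where
  "hermitian_line_bundle A E \<longleftrightarrow>
     (\<forall>(V, \<tau>)\<in>trivs E. open V \<and> (\<forall>x\<in>V. bij_betw \<tau> {u. proj E u = x} UNIV)) \<and>
     (\<Union>(V, \<tau>)\<in>trivs E. V) = UNIV \<and>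
     (\<forall>(V, \<tau>)\<in>trivs E. \<forall>(W, \<sigma>)\<in>trivs E. \<exists>g. smooth_fun_on A (V \<inter> W) g \<and>
        (\<forall>x\<in>V \<inter> W. g x \<noteq> 0) \<and> (\<forall>u. proj E u \<in> V \<inter> W \<longrightarrow> \<sigma> u = g (proj E u) * \<tau> u)) \<and>
     (\<forall>(V, \<tau>)\<in>trivs E. \<exists>\<rho>::'c \<Rightarrow> real. smooth_fun_on A V \<rho> \<and> (\<forall>x\<in>V. \<rho> x > 0) \<and>
        (\<forall>u w. proj E u \<in> V \<and> proj E w = proj E u \<longrightarrow>
           herm E u w = of_real (\<rho> (proj E u)) * \<tau> u * cnj (\<tau> w)))"

definition bundle_scale :: "('c, 'l) line_bundle \<Rightarrow> complex \<Rightarrow> 'l \<Rightarrow> 'l" where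
  "bundle_scale E z u = (THE w. proj E w = proj E u \<and>
     (\<forall>(V, \<tau>)\<in>trivs E. proj E u \<in> V \<longrightarrow> \<tau> w = z * \<tau> u))"

definition bundle_add :: "('c, 'l) line_bundle \<Rightarrow> 'l \<Rightarrow> 'l \<Rightarrow> 'l" where
  "bundle_add E u w = (THE y. proj E y = proj E u \<and>
     (\<forall>(V, \<tau>)\<in>trivs E. proj E u \<in> V \<longrightarrow> \<tau> y = \<tau> u + \<tau> w))"

text \<open>Smooth sections over an open set \<open>U\<close> (with irrelevant values outside \<open>U\<close>).\<close>

definition sections ::
  "('c, 'e::euclidean_space) chart set \<Rightarrow> ('c, 'l) line_bundle \<Rightarrow> 'c set \<Rightarrow> ('c \<Rightarrow> 'l) set" where
  "sections A E U = {s. (\<forall>x\<in>U. proj E (s x) = x) \<and>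
     (\<forall>(V, \<tau>)\<in>trivs E. smooth_fun_on A (U \<inter> V) (\<tau> \<circ> s))}"

text \<open>Hermitian connections as covariant derivatives: \<open>D s x X\<close> is the derivative at \<open>x\<close>, in the
  direction of the tangent vector \<open>X\<close>, of a smooth section \<open>s\<close> defined near \<open>x\<close>. The conditions are, in
  order: values in the right fibre, linearity in \<open>X\<close>, locality, additivity and the Leibniz rule in
  \<open>s\<close>, compatibility with the Hermitian metric, and smoothness along coordinate vector fields.\<close>

definition hermitian_connections ::
  "('c::topological_space, 'e::euclidean_space) chart set \<Rightarrow> ('c, 'l) line_bundle \<Rightarrow>
   (('c \<Rightarrow> 'l) \<Rightarrow> 'c \<Rightarrow> 'e \<Rightarrow> 'l) set" where
  "hermitian_connections A E = {D. \<forall>U. open U \<longrightarrow> (\<forall>s\<in>sections A E U.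
     (\<forall>x\<in>U. \<forall>X. proj E (D s x X) = x) \<and>
     (\<forall>x\<in>U. \<forall>X Y. \<forall>r::real.
        D s x (r *\<^sub>R X + Y) = bundle_add E (bundle_scale E (of_real r) (D s x X)) (D s x Y)) \<and>
     (\<forall>t\<in>sections A E U. (\<forall>x\<in>U. s x = t x) \<longrightarrow> (\<forall>x\<in>U. \<forall>X. D s x X = D t x X)) \<and>
     (\<forall>t\<in>sections A E U. \<forall>x\<in>U. \<forall>X.
        D (\<lambda>y. bundle_add E (s y) (t y)) x X = bundle_add E (D s x X) (D t x X)) \<and>
     (\<forall>h. smooth_fun_on A U h \<longrightarrow> (\<forall>x\<in>U. \<forall>X.
        D (\<lambda>y. bundle_scale E (h y) (s y)) x X =
          bundle_add E (bundle_scale E (fun_deriv A h x X) (s x)) (bundle_scale E (h x) (D s x X)))) \<and>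
     (\<forall>t\<in>sections A E U. \<forall>x\<in>U. \<forall>X.
        fun_deriv A (\<lambda>y. herm E (s y) (t y)) x X = herm E (D s x X) (t x) + herm E (s x) (D t x X)) \<and>
     (\<forall>c\<in>A. \<forall>X. (\<lambda>x. D s x (coord_vec A c x X)) \<in> sections A E (U \<inter> fst c)))}"

text \<open>The curvature \<open>F(a, b) s = D\<^sub>a D\<^sub>b s - D\<^sub>b D\<^sub>a s\<close>, where \<open>a\<close> and \<open>b\<close> are extended to commuting
  coordinate vector fields. An endomorphism of the one-dimensional fibre is multiplication by a unique
  complex number, which is also its trace; it is skew-Hermitian iff this number is imaginary. So forms
  with values in \<open>ad(E)\<close> are complex-valued forms with imaginary values.\<close>

definition curvature ::
  "('c::topological_space, 'e::euclidean_space) chart set \<Rightarrow> ('c, 'l) line_bundle \<Rightarrow>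
   (('c \<Rightarrow> 'l) \<Rightarrow> 'c \<Rightarrow> 'e \<Rightarrow> 'l) \<Rightarrow> 'c \<Rightarrow> 'e list \<Rightarrow> complex" where
  "curvature A E D x vs = (let c = chart_at A x; a = vs ! 0; b = vs ! 1 in
     THE z. \<forall>U s. open U \<and> x \<in> U \<and> s \<in> sections A E U \<longrightarrow>
       bundle_scale E z (s x) =
         bundle_add E (D (\<lambda>y. D s y (coord_vec A c y b)) x a)
           (bundle_scale E (- 1) (D (\<lambda>y. D s y (coord_vec A c y a)) x b)))"

definition ad_one_forms ::
  "('c, 'e::euclidean_space) chart set \<Rightarrow> ('c \<Rightarrow> 'e list \<Rightarrow> complex) set" where
  "ad_one_forms A = {B. smooth_form A 1 B \<and> (\<forall>x X. Re (B x [X]) = 0)}"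


section \<open>The configuration space, the one-form and the cycles\<close>

text \<open>Smooth sections of the pullback of the tangent bundle along \<open>f\<close>.\<close>

definition pullback_sections ::
  "('c::topological_space, 'd::euclidean_space) chart set \<Rightarrow>
   ('m::topological_space, 'e::euclidean_space) chart set \<Rightarrow> ('c \<Rightarrow> 'm) \<Rightarrow> ('c \<Rightarrow> 'e) set" where
  "pullback_sections A B f = {v. \<forall>c\<in>A. \<forall>d\<in>B.
     smooth_on ((\<lambda>x. vec_coord B d (f x) (v x)) \<circ> chart_inv c) (snd c ` (fst c \<inter> f -` fst d))}"

text \<open>The maps are immersions, so that the pullback metric is a metric.\<close>

definition configuration_space ::
  "('c::topological_space, real ^ 4) chart set \<Rightarrow> ('m::topological_space, real ^ 7) chart set \<Rightarrow>
   ('c, 'l) line_bundle \<Rightarrow> (('c \<Rightarrow> 'm) \<times> (('c \<Rightarrow> 'l) \<Rightarrow> 'c \<Rightarrow> real ^ 4 \<Rightarrow> 'l)) set" where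
  "configuration_space A B E = {f. immersion A B f} \<times> hermitian_connections A E"

text \<open>Variations have compact support, so that the integral exists; on a compact domain this is no
  restriction.\<close>

definition configuration_tangent ::
  "('c::topological_space, real ^ 4) chart set \<Rightarrow> ('m::topological_space, real ^ 7) chart set \<Rightarrow>
   ('c \<Rightarrow> 'm) \<Rightarrow> (('c \<Rightarrow> real ^ 7) \<times> ('c \<Rightarrow> (real ^ 4) list \<Rightarrow> complex)) set" where
  "configuration_tangent A B f = {(v, \<beta>). v \<in> pullback_sections A B f \<and> \<beta> \<in> ad_one_forms A \<and>
     (\<exists>K. compact K \<and> (\<forall>x. x \<notin> K \<longrightarrow> v x = 0 \<and> (\<forall>X. \<beta> x [X] = 0)))}"

definition Phi0 ::
  "('c::topological_space, real ^ 4) chart set \<Rightarrow> ('m, real ^ 7) chart set \<Rightarrow>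
   ('m \<Rightarrow> (real ^ 7) list \<Rightarrow> real) \<Rightarrow> ('c, 'l) line_bundle \<Rightarrow>
   ('c \<Rightarrow> 'm) \<times> (('c \<Rightarrow> 'l) \<Rightarrow> 'c \<Rightarrow> real ^ 4 \<Rightarrow> 'l) \<Rightarrow>
   ('c \<Rightarrow> real ^ 7) \<times> ('c \<Rightarrow> (real ^ 4) list \<Rightarrow> complex) \<Rightarrow> complex" where
  "Phi0 A B \<Omega> E = (\<lambda>(f, D) (v, \<beta>). form_integral A (\<lambda>x vs.
     wedge 2 2 (pullback_contract A B f v \<Omega> x) (curvature A E D x) vs +
     wedge 3 1 (pullback A B f \<Omega> x) (\<beta> x) vs))"

definition pullback_metric ::
  "('c, real ^ 4) chart set \<Rightarrow> ('m, real ^ 7) chart set \<Rightarrow> ('m \<Rightarrow> (real ^ 7) list \<Rightarrow> real) \<Rightarrow>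
   ('c \<Rightarrow> 'm) \<Rightarrow> 'c \<Rightarrow> real ^ 4 \<Rightarrow> real ^ 4 \<Rightarrow> real" where
  "pullback_metric A B \<Omega> f x a b = G2_metric (\<Omega> (f x)) (map_deriv A B f x a) (map_deriv A B f x b)"

definition coassociative ::
  "('c, real ^ 4) chart set \<Rightarrow> ('m, real ^ 7) chart set \<Rightarrow> ('m \<Rightarrow> (real ^ 7) list \<Rightarrow> real) \<Rightarrow>
   ('c \<Rightarrow> 'm) \<Rightarrow> bool" where
  "coassociative A B \<Omega> f \<longleftrightarrow> (\<forall>x vs. length vs = 3 \<longrightarrow> pullback A B f \<Omega> x vs = 0)"

text \<open>The standard orientation convention for coassociative submanifolds: the dual four-form is
  positive on positively oriented tangent frames.\<close>

definition calibrated_orientation ::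
  "('c, real ^ 4) chart set \<Rightarrow> ('m, real ^ 7) chart set \<Rightarrow> ('m \<Rightarrow> (real ^ 7) list \<Rightarrow> real) \<Rightarrow>
   ('c \<Rightarrow> 'm) \<Rightarrow> bool" where
  "calibrated_orientation A B \<Omega> f \<longleftrightarrow> (\<forall>x. pullback A B f (\<lambda>p. G2_dual (\<Omega> p)) x std_basis4 > 0)"

definition HSLag_cycle ::
  "('c::topological_space, real ^ 4) chart set \<Rightarrow> ('m, real ^ 7) chart set \<Rightarrow>
   ('m \<Rightarrow> (real ^ 7) list \<Rightarrow> real) \<Rightarrow> ('c, 'l) line_bundle \<Rightarrow>
   ('c \<Rightarrow> 'm) \<times> (('c \<Rightarrow> 'l) \<Rightarrow> 'c \<Rightarrow> real ^ 4 \<Rightarrow> 'l) \<Rightarrow> bool" where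
  "HSLag_cycle A B \<Omega> E = (\<lambda>(f, D). coassociative A B \<Omega> f \<and>
     (\<forall>x us. length us = 2 \<longrightarrow>
        self_dual_part (pullback_metric A B \<Omega> f x) (curvature A E D x) us = 0))"

end

theory Submission
  imports Defs
begin

text \<open>
  \<^bold>\<open>Why the theorem holds.\<close> The value of the one-form on \<open>(v, B)\<close> is the integral of
  \<open>f\<^sup>*(\<iota>\<^sub>v\<Omega>) \<and> F + f\<^sup>*\<Omega> \<and> B\<close>, so the zeros are found by pointwise linear algebra and localisation.

  \<^emph>\<open>Pointwise.\<close> In adapted coordinates \<open>\<Omega>\<close> is \<open>(n, a, b) \<mapsto> n \<bullet> (a \<times> b)\<close> for a cross product on
  \<open>\<real>\<^sup>7\<close> with \<open>(a \<times> b) \<bullet> (c \<times> d) = (a \<bullet> c) (b \<bullet> d) - (a \<bullet> d) (b \<bullet> c) + \<psi>(a, b, c, d)\<close>, where \<open>\<psi>\<close> is the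
  dual four-form (\<open>inner_cross7_cross7\<close>). Let \<open>w\<^sub>0, \<dots>, w\<^sub>3\<close> be an orthonormal basis of a four-plane on
  which \<open>\<Omega>\<close> vanishes and \<open>\<psi>(w\<^sub>0, \<dots>, w\<^sub>3) > 0\<close>. The vectors \<open>w\<^sub>0 \<times> w\<^sub>i\<close> complete it to an orthonormal
  basis of \<open>\<real>\<^sup>7\<close>, and \<open>w\<^sub>2 \<times> w\<^sub>3\<close> is a unit vector orthogonal to all of them except \<open>w\<^sub>0 \<times> w\<^sub>1\<close>. Their
  inner product is \<open>\<psi>(w\<^sub>0, \<dots>, w\<^sub>3) > 0\<close>, so the two agree, and likewise for the even permutations of
  \<open>w\<^sub>1, w\<^sub>2, w\<^sub>3\<close>. Hence the forms \<open>\<iota>\<^sub>v\<Omega>\<close> restrict to exactly the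
  self-dual two-forms of the plane, and \<open>f\<^sup>*(\<iota>\<^sub>v\<Omega>) \<and> F\<close> vanishes for all \<open>v\<close> if and only if \<open>F\<^sup>+ = 0\<close>
  (\<open>self_dual_part_pullback_iff\<close>). This gives at once that the cycles are zeros.

  \<^emph>\<open>Localisation.\<close> Conversely, suppose that the integrand, without a cut-off factor, is nonzero at a
  point for some constant coordinate one-form or some constant coordinate vector field. By continuity
  its product with a smooth bump function has nonzero integral (\<open>Phi0_one_form_nonzero\<close>,
  \<open>Phi0_field_nonzero\<close>). The one-forms \<open>\<i> dx\<^sub>j\<close> then give \<open>f\<^sup>*\<Omega> = 0\<close>, and after that the vector
  fields give \<open>F\<^sup>+ = 0\<close>.

  This needs the integral of a form supported in one chart to be its coordinate integral, whatever
  pieces cut up the manifold (\<open>form_integral_chart\<close>, by the change of variables formula), and the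
  curvature to be a continuous two-form (\<open>curvature_alternating\<close>, \<open>curvature_coord_continuous\<close>): in a
  local trivialisation it is the exterior derivative of the connection form, which is tensorial
  because second derivatives are symmetric.
\<close>

section \<open>Calculus of smooth functions\<close>

lemma Ck_on_continuous: "Ck_on k f S \<Longrightarrow> continuous_on S f"
  by (cases k) (auto intro!: differentiable_imp_continuous_on simp: differentiable_on_def differentiable_at_withinI)

lemma Ck_on_Suc_imp: "Ck_on (Suc k) f S \<Longrightarrow> Ck_on k f S"
proof (induction k arbitrary: f)
  case 0
  then show ?case using Ck_on_continuous Ck_on.simps(1) by blast
next
  case (Suc k)
  then show ?case by (metis Ck_on.simps(2))
qed

lemma Ck_on_subset: "Ck_on k f T \<Longrightarrow> S \<subseteq> T \<Longrightarrow> Ck_on k f S"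
  by (induction k arbitrary: f) (auto intro: continuous_on_subset)

lemma frechet_derivative_cong_open:
  assumes "open S" "x \<in> S" "\<And>y. y \<in> S \<Longrightarrow> f y = g y"
  shows "frechet_derivative f (at x) = frechet_derivative g (at x)"
proof -
  have "(f has_derivative D) (at x) \<longleftrightarrow> (g has_derivative D) (at x)" for D
    using assms has_derivative_transform_within_open[of f D x UNIV S g]
      has_derivative_transform_within_open[of g D x UNIV S f] by auto
  then show ?thesis by (simp add: frechet_derivative_def)
qed

lemma differentiable_cong_open:
  assumes "open S" "x \<in> S" "\<And>y. y \<in> S \<Longrightarrow> f y = g y" "f differentiable (at x)"
  shows "g differentiable (at x)"
  using assms has_derivative_transform_within_open[of f _ x UNIV S g]
  unfolding differentiable_def by blast

lemma Ck_on_cong: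
  assumes "open S" "\<And>x. x \<in> S \<Longrightarrow> f x = g x" "Ck_on k f S"
  shows "Ck_on k g S"
  using assms(2,3)
proof (induction k arbitrary: f g)
  case 0
  then show ?case using continuous_on_cong by fastforce
next
  case (Suc k)
  show ?case unfolding Ck_on.simps
  proof (intro conjI ballI allI)
    show "g differentiable at x" if "x \<in> S" for x
      using differentiable_cong_open[OF assms(1) that, of f g] Suc.prems that by auto
    show "Ck_on k (\<lambda>x. frechet_derivative g (at x) v) S" for v
    proof (rule Suc.IH)
      show "Ck_on k (\<lambda>x. frechet_derivative f (at x) v) S" using Suc.prems by simp
      show "frechet_derivative f (at x) v = frechet_derivative g (at x) v" if "x \<in> S" for x
        using frechet_derivative_cong_open[OF assms(1) that, of f g] Suc.prems(1) by simp
    qed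
  qed
qed

lemma Ck_on_Union:
  assumes "\<And>S. S \<in> \<S> \<Longrightarrow> open S \<and> Ck_on k f S"
  shows "Ck_on k f (\<Union>\<S>)"
  using assms
proof (induction k arbitrary: f)
  case 0
  then show ?case by (simp add: continuous_on_open_Union)
qed auto

lemma Ck_on_const: "Ck_on k (\<lambda>x. c) S"
  by (induction k arbitrary: c) auto

lemma Ck_on_SucI:
  assumes "open S" "\<And>x. x \<in> S \<Longrightarrow> (f has_derivative D x) (at x)"
    "\<And>v. Ck_on k (\<lambda>x. D x v) S"
  shows "Ck_on (Suc k) f S"
  unfolding Ck_on.simps
proof (intro conjI ballI allI)
  show "f differentiable at x" if "x \<in> S" for x
    using assms(2) that differentiable_def by blast
  show "Ck_on k (\<lambda>x. frechet_derivative f (at x) v) S" for v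
    by (rule Ck_on_cong[OF assms(1) _ assms(3)[of v]])
      (simp add: frechet_derivative_at[OF assms(2), symmetric])
qed

lemma Ck_on_SucD:
  assumes "Ck_on (Suc k) f S" "x \<in> S"
  shows "(f has_derivative frechet_derivative f (at x)) (at x)"
  using assms frechet_derivative_works by auto

lemma Ck_on_bounded_linear:
  assumes "bounded_linear L" "open S"
  shows "Ck_on k L S"
proof (cases k)
  case 0
  then show ?thesis by (simp add: assms(1) linear_continuous_on)
next
  case (Suc m)
  have "Ck_on (Suc m) L S"
    by (rule Ck_on_SucI[OF assms(2), of _ "\<lambda>_. L"])
      (auto intro: bounded_linear_imp_has_derivative[OF assms(1)] Ck_on_const)
  then show ?thesis using Suc by simp
qed

lemma Ck_on_add:
  assumes "open S" "Ck_on k f S" "Ck_on k g S"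
  shows "Ck_on k (\<lambda>x. f x + g x) S"
  using assms(2,3)
proof (induction k arbitrary: f g)
  case 0
  then show ?case by (auto intro: continuous_on_add)
next
  case (Suc k)
  show ?case
  proof (rule Ck_on_SucI[OF assms(1), of _ "\<lambda>x v. frechet_derivative f (at x) v + frechet_derivative g (at x) v"])
    show "((\<lambda>x. f x + g x) has_derivative (\<lambda>v. frechet_derivative f (at x) v + frechet_derivative g (at x) v)) (at x)"
      if "x \<in> S" for x
      using Suc.prems that by (intro has_derivative_add) (auto intro: Ck_on_SucD)
  qed (use Suc in auto)
qed

lemma Ck_on_sum:
  assumes "open S" "finite I" "\<And>i. i \<in> I \<Longrightarrow> Ck_on k (f i) S"
  shows "Ck_on k (\<lambda>x. \<Sum>i\<in>I. f i x) S"
  using assms(2,3)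
  by (induction I rule: finite_induct) (auto intro: Ck_on_const Ck_on_add[OF assms(1)])

lemma Ck_on_bilinear:
  assumes "bounded_bilinear prd" "open S" "Ck_on k f S" "Ck_on k g S"
  shows "Ck_on k (\<lambda>x. prd (f x) (g x)) S"
  using assms(3,4)
proof (induction k arbitrary: f g)
  case 0
  then show ?case using bounded_bilinear.continuous_on[OF assms(1)] by auto
next
  case (Suc k)
  show ?case
  proof (rule Ck_on_SucI[OF assms(2)])
    show "((\<lambda>x. prd (f x) (g x)) has_derivative
        (\<lambda>v. prd (f x) (frechet_derivative g (at x) v) + prd (frechet_derivative f (at x) v) (g x))) (at x)"
      if "x \<in> S" for x
      using Suc.prems that by (intro bounded_bilinear.FDERIV[OF assms(1)]) (auto intro: Ck_on_SucD)
    show "Ck_on k (\<lambda>x. prd (f x) (frechet_derivative g (at x) v) + prd (frechet_derivative f (at x) v) (g x)) S" for v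
    proof (intro Ck_on_add[OF assms(2)] Suc.IH)
      show "Ck_on k f S" "Ck_on k g S" using Suc.prems Ck_on_Suc_imp by blast+
    qed (use Suc.prems in auto)
  qed
qed

lemma linear_basis_expand:
  fixes L :: "'a::euclidean_space \<Rightarrow> 'b::real_vector"
  assumes "linear L"
  shows "L v = (\<Sum>i\<in>Basis. (v \<bullet> i) *\<^sub>R L i)"
proof -
  have "L v = L (\<Sum>i\<in>Basis. (v \<bullet> i) *\<^sub>R i)" by (simp only: euclidean_representation)
  also have "\<dots> = (\<Sum>i\<in>Basis. (v \<bullet> i) *\<^sub>R L i)"
    by (simp only: linear_sum[OF assms] linear_scale[OF assms])
  finally show ?thesis .
qed

text \<open>In the chain rule the direction of the outer derivative depends on the point; expanding it in the
  basis leaves derivatives in constant directions, to which the induction hypothesis applies.\<close>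

lemma Ck_on_compose:
  fixes f :: "'b::euclidean_space \<Rightarrow> 'c::real_normed_vector" and g :: "'a::euclidean_space \<Rightarrow> 'b"
  assumes "open S" "open T" "g ` S \<subseteq> T" "Ck_on k f T" "Ck_on k g S"
  shows "Ck_on k (\<lambda>x. f (g x)) S"
  using assms(4,5)
proof (induction k arbitrary: f)
  case 0
  then show ?case using assms(3) by (auto intro: continuous_on_compose2)
next
  case (Suc k)
  let ?D = "\<lambda>x v. \<Sum>i\<in>Basis. (frechet_derivative g (at x) v \<bullet> i) *\<^sub>R frechet_derivative f (at (g x)) i"
  show ?case
  proof (rule Ck_on_SucI[OF assms(1)])
    fix x assume "x \<in> S"
    then have f: "(f has_derivative frechet_derivative f (at (g x))) (at (g x))"
      and g: "(g has_derivative frechet_derivative g (at x)) (at x)"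
      using Suc.prems assms(3) by (auto intro!: Ck_on_SucD)
    have "?D x = frechet_derivative f (at (g x)) \<circ> frechet_derivative g (at x)"
      unfolding fun_eq_iff o_def
      by (intro allI linear_basis_expand[OF has_derivative_linear[OF f], symmetric])
    then show "((\<lambda>x. f (g x)) has_derivative ?D x) (at x)"
      using diff_chain_at[OF g f] by (simp add: o_def)
  next
    fix v
    have "Ck_on k g S" using Suc.prems Ck_on_Suc_imp by blast
    moreover have "Ck_on k (\<lambda>y. frechet_derivative f (at y) i) T" for i using Suc.prems(1) by simp
    ultimately have "Ck_on k (\<lambda>x. frechet_derivative f (at (g x)) i) S" for i
      using Suc.IH by blast
    moreover have "Ck_on k (\<lambda>x. frechet_derivative g (at x) v \<bullet> i) S" for i
      using Suc.prems(2) assms(1)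
      by (intro Ck_on_bilinear[OF bounded_bilinear_inner]) (auto intro: Ck_on_const)
    ultimately show "Ck_on k (\<lambda>x. ?D x v) S"
      using assms(1) by (intro Ck_on_sum Ck_on_bilinear[OF bounded_bilinear_scaleR]) auto
  qed
qed

lemma smooth_on_imp_continuous: "smooth_on f S \<Longrightarrow> continuous_on S f"
  unfolding smooth_on_def using Ck_on_continuous by blast

lemma smooth_on_subset: "smooth_on f T \<Longrightarrow> S \<subseteq> T \<Longrightarrow> smooth_on f S"
  unfolding smooth_on_def using Ck_on_subset by blast

lemma smooth_on_cong:
  "open S \<Longrightarrow> (\<And>x. x \<in> S \<Longrightarrow> f x = g x) \<Longrightarrow> smooth_on f S \<Longrightarrow> smooth_on g S"
  unfolding smooth_on_def using Ck_on_cong by blast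

lemma smooth_on_Un:
  "open S \<Longrightarrow> open T \<Longrightarrow> smooth_on f S \<Longrightarrow> smooth_on f T \<Longrightarrow> smooth_on f (S \<union> T)"
  unfolding smooth_on_def using Ck_on_Union[of "{S, T}"] by auto

lemma smooth_on_const: "smooth_on (\<lambda>x. c) S"
  unfolding smooth_on_def using Ck_on_const by blast

lemma smooth_on_bounded_linear: "bounded_linear L \<Longrightarrow> open S \<Longrightarrow> smooth_on L S"
  unfolding smooth_on_def using Ck_on_bounded_linear by blast

lemma smooth_on_add:
  "open S \<Longrightarrow> smooth_on f S \<Longrightarrow> smooth_on g S \<Longrightarrow> smooth_on (\<lambda>x. f x + g x) S"
  unfolding smooth_on_def using Ck_on_add by blast

lemma smooth_on_bilinear:
  "bounded_bilinear prd \<Longrightarrow> open S \<Longrightarrow> smooth_on f S \<Longrightarrow> smooth_on g S \<Longrightarrow>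
    smooth_on (\<lambda>x. prd (f x) (g x)) S"
  unfolding smooth_on_def using Ck_on_bilinear by blast

lemma smooth_on_compose:
  fixes f :: "'b::euclidean_space \<Rightarrow> 'c::real_normed_vector" and g :: "'a::euclidean_space \<Rightarrow> 'b"
  shows "open S \<Longrightarrow> open T \<Longrightarrow> g ` S \<subseteq> T \<Longrightarrow> smooth_on f T \<Longrightarrow> smooth_on g S \<Longrightarrow>
    smooth_on (\<lambda>x. f (g x)) S"
  unfolding smooth_on_def using Ck_on_compose by blast

lemma smooth_on_deriv: "smooth_on f S \<Longrightarrow> smooth_on (\<lambda>x. frechet_derivative f (at x) v) S"
  unfolding smooth_on_def by (metis Ck_on.simps(2))

lemma smooth_on_differentiable: "smooth_on f S \<Longrightarrow> x \<in> S \<Longrightarrow> f differentiable (at x)"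
  unfolding smooth_on_def by (metis Ck_on.simps(2))

lemma smooth_on_has_derivative:
  "smooth_on f S \<Longrightarrow> x \<in> S \<Longrightarrow> (f has_derivative frechet_derivative f (at x)) (at x)"
  using smooth_on_differentiable frechet_derivative_works by blast

subsection \<open>Symmetry of second derivatives\<close>

text \<open>The second difference of \<open>h\<close> over a parallelogram with sides \<open>t a\<close> and \<open>t b\<close>, by applying the mean
  value theorem in the direction \<open>b\<close> and then in the direction \<open>a\<close>.\<close>

lemma second_difference_mvt:
  fixes h :: "'a::euclidean_space \<Rightarrow> real"
  assumes h: "\<And>u. u \<in> ball x r \<Longrightarrow> (h has_derivative h' u) (at u)"
    and hb: "\<And>u. u \<in> ball x r \<Longrightarrow> ((\<lambda>z. h' z b) has_derivative h'' u) (at u)"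
    and t: "t > 0" "t * (norm a + norm b) < r"
  shows "\<exists>u. norm (u - x) \<le> t * (norm a + norm b) \<and>
    h (x + t *\<^sub>R a + t *\<^sub>R b) - h (x + t *\<^sub>R b) - h (x + t *\<^sub>R a) + h x = t * t * h'' u a"
proof -
  have inb: "x + s *\<^sub>R a + q *\<^sub>R b \<in> ball x r"
    and nb: "norm (s *\<^sub>R a + q *\<^sub>R b) \<le> t * (norm a + norm b)"
    if "0 \<le> s" "s \<le> t" "0 \<le> q" "q \<le> t" for s q
  proof -
    have "norm (s *\<^sub>R a + q *\<^sub>R b) \<le> s * norm a + q * norm b"
      using that norm_triangle_ineq[of "s *\<^sub>R a" "q *\<^sub>R b"] by simp
    also have "\<dots> \<le> t * (norm a + norm b)"
      using that by (simp add: distrib_left add_mono mult_right_mono)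
    finally show "norm (s *\<^sub>R a + q *\<^sub>R b) \<le> t * (norm a + norm b)" .
    moreover have "dist x (x + s *\<^sub>R a + q *\<^sub>R b) = norm (s *\<^sub>R a + q *\<^sub>R b)"
      unfolding dist_norm norm_minus_commute[of x] by (simp add: add.assoc)
    ultimately show "x + s *\<^sub>R a + q *\<^sub>R b \<in> ball x r"
      using t by simp
  qed
  define g where "g q = h (x + t *\<^sub>R a + q *\<^sub>R b) - h (x + q *\<^sub>R b)" for q
  have dg: "(g has_real_derivative (h' (x + t *\<^sub>R a + q *\<^sub>R b) b - h' (x + q *\<^sub>R b) b)) (at q)"
    if "0 \<le> q" "q \<le> t" for q
  proof -
    have 1: "((\<lambda>q. h (y + q *\<^sub>R b)) has_real_derivative h' (y + q *\<^sub>R b) b) (at q)"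
      if "y + q *\<^sub>R b \<in> ball x r" for y
    proof -
      have "((\<lambda>q. y + q *\<^sub>R b) has_derivative (\<lambda>q. q *\<^sub>R b)) (at q)"
        by (auto intro!: derivative_eq_intros)
      from diff_chain_at[OF this h[OF that]]
      have "((\<lambda>q. h (y + q *\<^sub>R b)) has_derivative (\<lambda>s. h' (y + q *\<^sub>R b) (s *\<^sub>R b))) (at q)"
        by (simp add: o_def)
      then show ?thesis
        unfolding has_field_derivative_def linear_scale[OF has_derivative_linear[OF h[OF that]]]
        by (rule has_derivative_eq_rhs) (auto simp: fun_eq_iff)
    qed
    show ?thesis unfolding g_def
    proof (intro DERIV_diff 1)
      show "x + t *\<^sub>R a + q *\<^sub>R b \<in> ball x r" using inb[of t q] that t by simp
      show "x + q *\<^sub>R b \<in> ball x r" using inb[of 0 q] that t by simp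
    qed
  qed
  obtain q where q: "0 < q" "q < t" "g t - g 0 = (t - 0) * (h' (x + t *\<^sub>R a + q *\<^sub>R b) b - h' (x + q *\<^sub>R b) b)"
    using MVT2[of 0 t g, OF t(1) dg] by auto
  define k where "k s = h' (x + s *\<^sub>R a + q *\<^sub>R b) b" for s
  have dk: "(k has_real_derivative h'' (x + s *\<^sub>R a + q *\<^sub>R b) a) (at s)" if "0 \<le> s" "s \<le> t" for s
  proof -
    have i: "x + s *\<^sub>R a + q *\<^sub>R b \<in> ball x r" using inb that q by auto
    have "((\<lambda>s. x + s *\<^sub>R a + q *\<^sub>R b) has_derivative (\<lambda>s. s *\<^sub>R a)) (at s)"
      by (auto intro!: derivative_eq_intros)
    from diff_chain_at[OF this hb[OF i]]
    have "(k has_derivative (\<lambda>r. h'' (x + s *\<^sub>R a + q *\<^sub>R b) (r *\<^sub>R a))) (at s)"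
      by (simp add: o_def k_def[abs_def])
    then show ?thesis
      unfolding has_field_derivative_def linear_scale[OF has_derivative_linear[OF hb[OF i]]]
      by (rule has_derivative_eq_rhs) (auto simp: fun_eq_iff)
  qed
  obtain s where s: "0 < s" "s < t" "k t - k 0 = (t - 0) * h'' (x + s *\<^sub>R a + q *\<^sub>R b) a"
    using MVT2[of 0 t k, OF t(1) dk] by auto
  have "h (x + t *\<^sub>R a + t *\<^sub>R b) - h (x + t *\<^sub>R b) - h (x + t *\<^sub>R a) + h x = g t - g 0"
    by (simp add: g_def)
  also have "\<dots> = t * (k t - k 0)" using q(3) by (simp add: k_def)
  also have "\<dots> = t * t * h'' (x + s *\<^sub>R a + q *\<^sub>R b) a" using s(3) by simp
  finally show ?thesis
    using nb[of s q] s q by (intro exI[of _ "x + s *\<^sub>R a + q *\<^sub>R b"]) (simp add: add.assoc)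
qed

lemma second_derivative_symmetric_real:
  fixes h :: "'a::euclidean_space \<Rightarrow> real"
  assumes S: "open S" "x \<in> S" and h: "Ck_on 2 h S"
  shows "frechet_derivative (\<lambda>z. frechet_derivative h (at z) b) (at x) a =
         frechet_derivative (\<lambda>z. frechet_derivative h (at z) a) (at x) b"
proof -
  let ?H = "\<lambda>b u. frechet_derivative (\<lambda>z. frechet_derivative h (at z) b) (at u)"
  have h2: "Ck_on (Suc (Suc 0)) h S" using h by (simp add: numeral_2_eq_2)
  have d1: "(h has_derivative frechet_derivative h (at u)) (at u)" if "u \<in> S" for u
    using Ck_on_SucD[OF h2 that] .
  have "Ck_on (Suc 0) (\<lambda>z. frechet_derivative h (at z) b) S" for b using h2 by simp
  then have d2: "((\<lambda>z. frechet_derivative h (at z) b) has_derivative ?H b u) (at u)"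
    if "u \<in> S" for u b using Ck_on_SucD[OF _ that] by blast
  have c: "continuous_on S (\<lambda>u. ?H b u a)" for a b using h2 by simp
  obtain r where r: "r > 0" "ball x r \<subseteq> S" using S openE by blast
  show ?thesis
  proof (rule ccontr)
    assume ne: "?H b x a \<noteq> ?H a x b"
    define e where "e = \<bar>?H b x a - ?H a x b\<bar> / 2"
    have e: "e > 0" using ne by (simp add: e_def)
    obtain d1 where D1: "d1 > 0" "\<And>u. u \<in> S \<Longrightarrow> dist u x < d1 \<Longrightarrow> dist (?H b u a) (?H b x a) < e"
      using c[of b a] S(2) e unfolding continuous_on_iff by metis
    obtain d2 where D2: "d2 > 0" "\<And>u. u \<in> S \<Longrightarrow> dist u x < d2 \<Longrightarrow> dist (?H a u b) (?H a x b) < e"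
      using c[of a b] S(2) e unfolding continuous_on_iff by metis
    define m where "m = min r (min d1 d2)"
    define N where "N = norm a + norm b + 1"
    \<comment> \<open>Parallelograms this small stay where both second derivatives vary by less than half their gap.\<close>
    define t where "t = m / (2 * N)"
    have m: "m > 0" using r D1 D2 by (simp add: m_def)
    have N: "N > 0" by (simp add: N_def add_nonneg_pos)
    have t: "t > 0" using m N by (simp add: t_def)
    have "t * (norm a + norm b) \<le> t * N" using t by (simp add: N_def)
    also have "\<dots> < m" using m N by (simp add: t_def)
    finally have tm: "t * (norm a + norm b) < m" .
    obtain u where u: "norm (u - x) \<le> t * (norm a + norm b)"
      "h (x + t *\<^sub>R a + t *\<^sub>R b) - h (x + t *\<^sub>R b) - h (x + t *\<^sub>R a) + h x = t * t * ?H b u a"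
      using second_difference_mvt[of x r h "\<lambda>u. frechet_derivative h (at u)" b "?H b" t a, OF d1 d2]
        r t tm by (auto simp: m_def subset_iff)
    obtain v where v: "norm (v - x) \<le> t * (norm b + norm a)"
      "h (x + t *\<^sub>R b + t *\<^sub>R a) - h (x + t *\<^sub>R a) - h (x + t *\<^sub>R b) + h x = t * t * ?H a v b"
      using second_difference_mvt[of x r h "\<lambda>u. frechet_derivative h (at u)" a "?H a" t b, OF d1 d2]
        r t tm by (auto simp: m_def subset_iff add.commute)
    have "x + t *\<^sub>R b + t *\<^sub>R a = x + t *\<^sub>R a + t *\<^sub>R b" by simp
    then have "h (x + t *\<^sub>R b + t *\<^sub>R a) = h (x + t *\<^sub>R a + t *\<^sub>R b)" by (rule arg_cong)
    then have "t * t * ?H b u a = t * t * ?H a v b"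
      using u(2) v(2) by linarith
    then have eq: "?H b u a = ?H a v b" using t by simp
    have "dist u x < m" "dist v x < m" using u(1) v(1) tm by (simp_all add: dist_norm add.commute)
    then have "\<bar>?H b u a - ?H b x a\<bar> < e" "\<bar>?H a v b - ?H a x b\<bar> < e"
      using D1(2)[of u] D2(2)[of v] r(2) by (auto simp: m_def dist_real_def subset_iff dist_commute)
    then show False using eq by (auto simp: e_def abs_if split: if_splits)
  qed
qed

lemma second_derivative_symmetric:
  fixes h :: "'a::euclidean_space \<Rightarrow> 'b::euclidean_space"
  assumes S: "open S" "x \<in> S" and h: "smooth_on h S"
  shows "frechet_derivative (\<lambda>z. frechet_derivative h (at z) b) (at x) a =
         frechet_derivative (\<lambda>z. frechet_derivative h (at z) a) (at x) b"
proof (rule euclidean_eqI)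
  fix i :: 'b assume i: "i \<in> Basis"
  have pull: "frechet_derivative (\<lambda>z. k z \<bullet> i) (at u) v = frechet_derivative k (at u) v \<bullet> i"
    if "smooth_on k S" "u \<in> S" for k u v
    using frechet_derivative_at[OF has_derivative_inner_left[OF smooth_on_has_derivative[OF that], of i]]
    by metis
  have sm: "smooth_on (\<lambda>z. h z \<bullet> i) S"
    by (rule smooth_on_bilinear[OF bounded_bilinear_inner S(1) h smooth_on_const])
  have *: "frechet_derivative (\<lambda>z. frechet_derivative h (at z) b) (at x) a \<bullet> i =
     frechet_derivative (\<lambda>z. frechet_derivative (\<lambda>z. h z \<bullet> i) (at z) b) (at x) a" for a b
  proof -
    have "frechet_derivative (\<lambda>z. frechet_derivative h (at z) b \<bullet> i) (at x) =
      frechet_derivative (\<lambda>z. frechet_derivative (\<lambda>z. h z \<bullet> i) (at z) b) (at x)"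
      by (rule frechet_derivative_cong_open[OF S]) (simp add: pull[OF h])
    then show ?thesis using pull[OF smooth_on_deriv[OF h] S(2)] by metis
  qed
  show "frechet_derivative (\<lambda>z. frechet_derivative h (at z) b) (at x) a \<bullet> i =
        frechet_derivative (\<lambda>z. frechet_derivative h (at z) a) (at x) b \<bullet> i"
    unfolding * using second_derivative_symmetric_real[OF S, of "\<lambda>z. h z \<bullet> i"] sm
    by (simp add: smooth_on_def)
qed

subsection \<open>Bump functions\<close>

text \<open>The flat functions \<open>t\<^sup>-\<^sup>n exp (-1/t)\<close>, extended by zero to \<open>t \<le> 0\<close>; the derivative of each is a
  linear combination of two others, so that the family is closed under differentiation.\<close>

definition flat_exp :: "nat \<Rightarrow> real \<Rightarrow> real" where
  "flat_exp n t = (if t > 0 then (1 / t) ^ n * exp (- (1 / t)) else 0)"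

lemma flat_exp_tendsto_0: "(flat_exp n \<longlongrightarrow> 0) (at_right 0)"
proof -
  have "((\<lambda>t::real. inverse t ^ n / exp (inverse t)) \<longlongrightarrow> 0) (at_right 0)"
    using filterlim_compose[OF tendsto_power_div_exp_0[of n] filterlim_inverse_at_top_right] .
  moreover have "\<forall>\<^sub>F t in at_right 0. inverse t ^ n / exp (inverse t) = flat_exp n t"
    by (auto simp: eventually_at_right_less flat_exp_def exp_minus divide_inverse
        intro!: eventually_mono[OF eventually_at_right_less])
  ultimately show ?thesis using tendsto_cong by fastforce
qed

lemma flat_exp_deriv:
  "(flat_exp n has_real_derivative (flat_exp (n + 2) t - real n * flat_exp (n + 1) t)) (at t)"
proof -
  consider "t > 0" | "t < 0" | "t = 0" by linarith
  then show ?thesis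
  proof cases
    case 1
    have "((\<lambda>t. (1 / t) ^ n * exp (- (1 / t))) has_real_derivative
        (flat_exp (n + 2) t - real n * flat_exp (n + 1) t)) (at t)"
    proof (cases n)
      case 0
      then show ?thesis using 1
        by (auto intro!: derivative_eq_intros simp: flat_exp_def field_simps power2_eq_square)
    next
      case (Suc m)
      have "((\<lambda>t. 1 / t) has_real_derivative - (1 / t\<^sup>2)) (at t)"
        using 1 by (auto intro!: derivative_eq_intros simp: power2_eq_square)
      then have "((\<lambda>t. (1 / t) ^ Suc m) has_real_derivative (1 + real m) * (- (1 / t\<^sup>2) * (1 / t) ^ m)) (at t)"
        by (rule DERIV_power_Suc)
      moreover have "((\<lambda>t. exp (- (1 / t))) has_real_derivative exp (- (1 / t)) * (1 / t\<^sup>2)) (at t)"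
        using 1 by (auto intro!: derivative_eq_intros simp: power2_eq_square)
      ultimately show ?thesis unfolding Suc
        by (rule DERIV_cong[OF DERIV_mult])
          (use 1 in \<open>simp add: flat_exp_def field_simps power2_eq_square\<close>)
    qed
    then show ?thesis
      by (rule has_field_derivative_transform_within_open[of _ _ _ "{0<..}"]) (use 1 in \<open>auto simp: flat_exp_def\<close>)
  next
    case 2
    have "((\<lambda>t. 0) has_real_derivative 0) (at t)" by simp
    then have "(flat_exp n has_real_derivative 0) (at t)"
      by (rule has_field_derivative_transform_within_open[of _ _ _ "{..<0}"]) (use 2 in \<open>auto simp: flat_exp_def\<close>)
    then show ?thesis using 2 by (simp add: flat_exp_def)
  next
    case 3
    have "((\<lambda>h. (flat_exp n (0 + h) - flat_exp n 0) / h) \<longlongrightarrow> 0) (at 0)"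
    proof (rule filterlim_split_at_real)
      have "\<forall>\<^sub>F h in at_left 0. 0 = (flat_exp n (0 + h) - flat_exp n 0) / h"
        by (auto simp: eventually_at_filter flat_exp_def)
      then show "((\<lambda>h. (flat_exp n (0 + h) - flat_exp n 0) / h) \<longlongrightarrow> 0) (at_left 0)"
        by (rule Lim_transform_eventually[OF tendsto_const])
      have "\<forall>\<^sub>F h in at_right 0. flat_exp (n + 1) h = (flat_exp n (0 + h) - flat_exp n 0) / h"
        by (rule eventually_mono[OF eventually_at_right_less]) (auto simp: flat_exp_def field_simps)
      then show "((\<lambda>h. (flat_exp n (0 + h) - flat_exp n 0) / h) \<longlongrightarrow> 0) (at_right 0)"
        by (rule Lim_transform_eventually[OF flat_exp_tendsto_0])
    qed
    then show ?thesis using 3 by (simp add: DERIV_def flat_exp_def)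
  qed
qed

lemma Ck_on_flat_exp: "Ck_on k (flat_exp n) UNIV"
proof (induction k arbitrary: n)
  case 0
  show ?case
    using DERIV_isCont[OF flat_exp_deriv] by (simp add: continuous_at_imp_continuous_on)
next
  case (Suc k)
  show ?case
  proof (rule Ck_on_SucI)
    show "(flat_exp n has_derivative (\<lambda>v. (flat_exp (n + 2) t - real n * flat_exp (n + 1) t) * v)) (at t)" for t
      using flat_exp_deriv[of n t] unfolding has_field_derivative_def .
    have "Ck_on k (\<lambda>t. flat_exp (n + 2) t + (- real n) * flat_exp (n + 1) t) UNIV"
      by (intro Ck_on_add Ck_on_bilinear[OF bounded_bilinear_mult] Suc Ck_on_const) auto
    then show "Ck_on k (\<lambda>t. (flat_exp (n + 2) t - real n * flat_exp (n + 1) t) * v) UNIV" for v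
      by (intro Ck_on_bilinear[OF bounded_bilinear_mult] Ck_on_const) auto
  qed auto
qed

lemma smooth_bump:
  fixes x0 :: "'a::euclidean_space"
  assumes "r > 0"
  obtains \<phi> :: "'a \<Rightarrow> real" where "smooth_on \<phi> UNIV" "\<And>y. \<phi> y \<ge> 0" "\<And>y. \<phi> y > 0 \<longleftrightarrow> y \<in> ball x0 r"
proof
  define q where "q y = r\<^sup>2 + (-1) * ((y + (- x0)) \<bullet> (y + (- x0)))" for y
  have "smooth_on (\<lambda>y. y) (UNIV :: 'a set)"
    by (rule smooth_on_bounded_linear[OF bounded_linear_ident]) simp
  then have "smooth_on q UNIV" unfolding q_def
    by (intro smooth_on_add smooth_on_const smooth_on_bilinear[OF bounded_bilinear_mult]
        smooth_on_bilinear[OF bounded_bilinear_inner]) auto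
  moreover have "smooth_on (flat_exp 0) UNIV" by (simp add: smooth_on_def Ck_on_flat_exp)
  ultimately show "smooth_on (\<lambda>y. flat_exp 0 (q y)) UNIV"
    using smooth_on_compose[of UNIV UNIV q "flat_exp 0"] by simp
  show "flat_exp 0 (q y) \<ge> 0" for y by (simp add: flat_exp_def)
  have "q y > 0 \<longleftrightarrow> norm (y - x0) < r" for y
    using assms abs_le_square_iff[of "norm (y - x0)" r] abs_le_square_iff[of r "norm (y - x0)"]
    unfolding q_def power2_norm_eq_inner[symmetric]
    by (simp add: dot_square_norm not_le[symmetric])
  then show "flat_exp 0 (q y) > 0 \<longleftrightarrow> y \<in> ball x0 r" for y
    by (simp add: flat_exp_def dist_norm norm_minus_commute)
qed

section \<open>Changes of charts\<close>

text \<open>The Jacobian at the point \<open>x\<close> of the transition from the chart \<open>c\<close> to the chart \<open>d\<close>.\<close>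

definition jac :: "('m, 'e::euclidean_space) chart \<Rightarrow> ('m, 'e) chart \<Rightarrow> 'm \<Rightarrow> 'e \<Rightarrow> 'e" where
  "jac c d x = frechet_derivative (snd d \<circ> chart_inv c) (at (snd c x))"

lemma coord_vec_jac: "coord_vec A c x = jac c (chart_at A x) x"
  by (simp add: coord_vec_def jac_def)

lemma vec_coord_jac: "vec_coord A c x = jac (chart_at A x) c x"
  by (simp add: vec_coord_def jac_def)

context
  fixes A :: "('m::{t2_space, second_countable_topology}, 'e::euclidean_space) chart set"
  assumes A: "smooth_atlas A"
begin

lemma chart_homeo: "c \<in> A \<Longrightarrow> homeomorphism (fst c) (snd c ` fst c) (snd c) (chart_inv c)"
  using A by (auto simp: smooth_atlas_def)

lemma chart_dom_open: "c \<in> A \<Longrightarrow> open (fst c)"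
  using A by (auto simp: smooth_atlas_def)

lemma chart_inv_left: "c \<in> A \<Longrightarrow> x \<in> fst c \<Longrightarrow> chart_inv c (snd c x) = x"
  using chart_homeo by (auto simp: homeomorphism_def)

lemma chart_inv_cont: "c \<in> A \<Longrightarrow> continuous_on (snd c ` fst c) (chart_inv c)"
  using chart_homeo by (auto simp: homeomorphism_def)

lemma chart_image_iff:
  "c \<in> A \<Longrightarrow> y \<in> snd c ` (fst c \<inter> U) \<longleftrightarrow> y \<in> snd c ` fst c \<and> chart_inv c y \<in> U"
  using chart_inv_left[of c] by auto

lemma chart_image_open:
  assumes "c \<in> A" "open U"
  shows "open (snd c ` (fst c \<inter> U))"
proof -
  have "open (snd c ` fst c \<inter> chart_inv c -` U)"
    using continuous_open_preimage[OF chart_inv_cont[OF assms(1)] _ assms(2)] A assms(1)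
    by (auto simp: smooth_atlas_def)
  moreover have "snd c ` (fst c \<inter> U) = snd c ` fst c \<inter> chart_inv c -` U"
    using chart_image_iff[OF assms(1)] by blast
  ultimately show ?thesis by simp
qed

lemma chart_range_open: "c \<in> A \<Longrightarrow> open (snd c ` fst c)"
  using chart_image_open[of c UNIV] by simp

lemma chart_at_in: "chart_at A x \<in> A" "x \<in> fst (chart_at A x)"
proof -
  have "x \<in> (\<Union>c\<in>A. fst c)" using A by (simp add: smooth_atlas_def)
  then have "\<exists>c. c \<in> A \<and> x \<in> fst c" by blast
  from someI_ex[OF this] show "chart_at A x \<in> A" "x \<in> fst (chart_at A x)"
    by (auto simp: chart_at_def)
qed

lemma transition_smooth:
  "c \<in> A \<Longrightarrow> d \<in> A \<Longrightarrow> smooth_on (snd d \<circ> chart_inv c) (snd c ` (fst c \<inter> fst d))"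
  using A by (auto simp: smooth_atlas_def)

lemma jac_has_derivative:
  assumes "c \<in> A" "d \<in> A" "x \<in> fst c" "x \<in> fst d"
  shows "((snd d \<circ> chart_inv c) has_derivative jac c d x) (at (snd c x))"
  unfolding jac_def using smooth_on_has_derivative[OF transition_smooth[OF assms(1,2)]] assms by auto

lemma jac_linear:
  assumes "c \<in> A" "d \<in> A" "x \<in> fst c" "x \<in> fst d"
  shows "linear (jac c d x)"
  using has_derivative_linear[OF jac_has_derivative[OF assms]] .

text \<open>The chain rule for a function that is read in two charts.\<close>

lemma chart_change_has_derivative:
  assumes "c \<in> A" "d \<in> A" "x \<in> fst c" "x \<in> fst d"
    and h: "((h \<circ> chart_inv d) has_derivative D) (at (snd d x))"
  shows "((h \<circ> chart_inv c) has_derivative (D \<circ> jac c d x)) (at (snd c x))"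
proof -
  have "((h \<circ> chart_inv d) has_derivative D) (at ((snd d \<circ> chart_inv c) (snd c x)))"
    using h chart_inv_left assms by simp
  from diff_chain_at[OF jac_has_derivative[OF assms(1-4)] this]
  show ?thesis
  proof (rule has_derivative_transform_within_open)
    show "open (snd c ` (fst c \<inter> fst d))" using chart_image_open chart_dom_open assms by blast
    show "snd c x \<in> snd c ` (fst c \<inter> fst d)" using assms by auto
    show "(h \<circ> chart_inv d \<circ> (snd d \<circ> chart_inv c)) y = (h \<circ> chart_inv c) y"
      if "y \<in> snd c ` (fst c \<inter> fst d)" for y using that assms chart_inv_left[of c] chart_inv_left[of d] by auto
  qed
qed

lemma jac_cocycle:
  assumes "c \<in> A" "d \<in> A" "e \<in> A" "x \<in> fst c" "x \<in> fst d" "x \<in> fst e"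
  shows "jac d e x (jac c d x v) = jac c e x v"
  using has_derivative_unique[OF chart_change_has_derivative[OF assms(1,2,4,5) jac_has_derivative[OF assms(2,3,5,6)]]
      jac_has_derivative[OF assms(1,3,4,6)]]
  by (auto simp: fun_eq_iff)

lemma jac_refl:
  assumes "c \<in> A" "x \<in> fst c"
  shows "jac c c x v = v"
proof -
  have "((\<lambda>y. y) has_derivative (\<lambda>v. v)) (at (snd c x))" by (rule has_derivative_ident)
  then have "((snd c \<circ> chart_inv c) has_derivative (\<lambda>v. v)) (at (snd c x))"
    by (rule has_derivative_transform_within_open[OF _ chart_range_open[OF assms(1)]])
      (use assms chart_inv_left[of c] in auto)
  from has_derivative_unique[OF this jac_has_derivative[OF assms(1,1,2,2)]] show ?thesis by metis
qed

lemma jac_inverse: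
  assumes "c \<in> A" "d \<in> A" "x \<in> fst c" "x \<in> fst d"
  shows "jac d c x (jac c d x v) = v"
  using jac_cocycle[of c d c] jac_refl assms by simp

lemma jac_smooth:
  assumes "c \<in> A" "d \<in> A"
  shows "smooth_on (\<lambda>w. jac c d (chart_inv c w) v) (snd c ` (fst c \<inter> fst d))"
proof (rule smooth_on_cong[OF _ _ smooth_on_deriv[OF transition_smooth[OF assms], of v]])
  show "open (snd c ` (fst c \<inter> fst d))" using chart_image_open chart_dom_open assms by blast
qed (use assms chart_inv_left[of c] in \<open>auto simp: jac_def\<close>)

lemma coord_vec_linear: "c \<in> A \<Longrightarrow> x \<in> fst c \<Longrightarrow> linear (coord_vec A c x)"
  unfolding coord_vec_jac using jac_linear chart_at_in by blast

lemma coord_vec_chart_at: "coord_vec A (chart_at A x) x v = v"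
  unfolding coord_vec_jac using jac_refl chart_at_in by blast

lemma coord_vec_vec_coord:
  "c \<in> A \<Longrightarrow> x \<in> fst c \<Longrightarrow> coord_vec A c x (vec_coord A c x v) = v"
  unfolding coord_vec_jac vec_coord_jac using jac_inverse chart_at_in by blast

lemma vec_coord_linear: "c \<in> A \<Longrightarrow> x \<in> fst c \<Longrightarrow> linear (vec_coord A c x)"
  unfolding vec_coord_jac using jac_linear chart_at_in by blast

lemma vec_coord_coord_vec:
  assumes "c \<in> A" "d \<in> A" "x \<in> fst c" "x \<in> fst d"
  shows "vec_coord A d x (coord_vec A c x v) = jac c d x v"
  unfolding coord_vec_jac vec_coord_jac using jac_cocycle chart_at_in assms by blast

lemma coord_vec_jac_eq:
  assumes "c \<in> A" "d \<in> A" "x \<in> fst c" "x \<in> fst d"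
  shows "coord_vec A d x (jac c d x v) = coord_vec A c x v"
  unfolding coord_vec_jac using jac_cocycle chart_at_in assms by blast

lemma fun_deriv_coord_vec:
  assumes c: "c \<in> A" "x \<in> fst c" and h: "(h \<circ> chart_inv c) differentiable (at (snd c x))"
  shows "fun_deriv A h x (coord_vec A c x X) = frechet_derivative (h \<circ> chart_inv c) (at (snd c x)) X"
proof -
  let ?d = "chart_at A x"
  have "((h \<circ> chart_inv ?d) has_derivative
      frechet_derivative (h \<circ> chart_inv c) (at (snd c x)) \<circ> jac ?d c x) (at (snd ?d x))"
    using chart_change_has_derivative[OF chart_at_in(1) c(1) chart_at_in(2) c(2)] h frechet_derivative_works by blast
  then have "fun_deriv A h x = frechet_derivative (h \<circ> chart_inv c) (at (snd c x)) \<circ> jac ?d c x"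
    unfolding fun_deriv_def by (rule frechet_derivative_at[symmetric])
  then show ?thesis using jac_inverse[OF c(1) chart_at_in(1) c(2) chart_at_in(2)] by (simp add: coord_vec_jac)
qed

lemma chart_partition_exists: "\<exists>c S. chart_partition A c S"
proof -
  have "open S" if "S \<in> fst ` A" for S using that chart_dom_open by blast
  then obtain F where F: "F \<subseteq> fst ` A" "countable F" "\<Union>F = \<Union>(fst ` A)"
    using Lindelof[of "fst ` A"] by metis
  have U: "\<Union>F = UNIV" using F A by (auto simp: smooth_atlas_def)
  then have ne: "F \<noteq> {}" by auto
  have "\<exists>c. c \<in> A \<and> fst c = from_nat_into F n" for n
    using from_nat_into[OF ne, of n] F(1) by (metis imageE subsetD)
  then obtain c where c: "\<And>n. c n \<in> A" "\<And>n. fst (c n) = from_nat_into F n" by metis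
  have "(\<Union>n. fst (c n)) = UNIV"
    using range_from_nat_into[OF ne F(2)] U c(2) by auto
  moreover have "disjointed (\<lambda>n. fst (c n)) i \<in> sets borel" for i
  proof -
    have "range (\<lambda>n. fst (c n)) \<subseteq> sets borel" using chart_dom_open[OF c(1)] by (intro image_subsetI borel_open)
    from sets.range_disjointed_sets[OF this] show ?thesis by blast
  qed
  ultimately have "chart_partition A c (disjointed (\<lambda>n. fst (c n)))"
    using c(1) disjointed_subset[of "\<lambda>n. fst (c n)"]
    by (auto simp: chart_partition_def disjoint_family_disjointed UN_disjointed_eq)
  then show ?thesis by blast
qed

end

text \<open>The differential of \<open>f\<close>, which is given by components in preferred charts, read in arbitrary charts.\<close>

lemma map_deriv_coord_vec:
  fixes A :: "('c::{t2_space, second_countable_topology}, 'd::euclidean_space) chart set"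
    and B :: "('m::{t2_space, second_countable_topology}, 'e::euclidean_space) chart set"
  assumes A: "smooth_atlas A" and B: "smooth_atlas B" and f: "smooth_map A B f"
    and c: "c \<in> A" "x \<in> fst c" and d: "d \<in> B" "f x \<in> fst d"
  shows "map_deriv A B f x (coord_vec A c x X) =
    coord_vec B d (f x) (frechet_derivative (snd d \<circ> f \<circ> chart_inv c) (at (snd c x)) X)"
proof -
  let ?a = "chart_at A x" and ?b = "chart_at B (f x)"
  have a: "?a \<in> A" "x \<in> fst ?a" and b: "?b \<in> B" "f x \<in> fst ?b"
    using chart_at_in[OF A] chart_at_in[OF B] by auto
  have sm: "((snd d \<circ> f \<circ> chart_inv c) has_derivative frechet_derivative (snd d \<circ> f \<circ> chart_inv c) (at (snd c x)))
      (at (snd c x))" if "c \<in> A" "x \<in> fst c" "d \<in> B" "f x \<in> fst d" for c d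
    using f that by (intro smooth_on_has_derivative[of _ "snd c ` (fst c \<inter> f -` fst d)"]) (auto simp: smooth_map_def)
  have 1: "((snd ?b \<circ> f \<circ> chart_inv c) has_derivative map_deriv A B f x \<circ> jac c ?a x) (at (snd c x))"
    using chart_change_has_derivative[OF A c(1) a(1) c(2) a(2), of "snd ?b \<circ> f"] sm[OF a b]
    by (simp add: map_deriv_def o_assoc)
  have "((snd ?b \<circ> chart_inv d) has_derivative jac d ?b (f x)) (at ((snd d \<circ> f \<circ> chart_inv c) (snd c x)))"
    using jac_has_derivative[OF B d(1) b(1) d(2) b(2)] chart_inv_left[OF A c] by simp
  from diff_chain_at[OF sm[OF c d] this]
  have 2: "((snd ?b \<circ> f \<circ> chart_inv c) has_derivative
      jac d ?b (f x) \<circ> frechet_derivative (snd d \<circ> f \<circ> chart_inv c) (at (snd c x))) (at (snd c x))"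
  proof (rule has_derivative_transform_within_open)
    have "open (f -` fst d)"
      using f chart_dom_open[OF B d(1)] by (auto simp: smooth_map_def intro: open_vimage)
    then show "open (snd c ` (fst c \<inter> f -` fst d))" using chart_image_open[OF A c(1)] by blast
    show "snd c x \<in> snd c ` (fst c \<inter> f -` fst d)" using c d by auto
    show "(snd ?b \<circ> chart_inv d \<circ> (snd d \<circ> f \<circ> chart_inv c)) y = (snd ?b \<circ> f \<circ> chart_inv c) y"
      if "y \<in> snd c ` (fst c \<inter> f -` fst d)" for y
      using that chart_inv_left[OF A c(1)] chart_inv_left[OF B d(1)] by auto
  qed
  from has_derivative_unique[OF 1 2] show ?thesis by (simp add: coord_vec_jac fun_eq_iff)
qed

lemma map_deriv_linear:
  fixes A :: "('c::{t2_space, second_countable_topology}, 'd::euclidean_space) chart set"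
    and B :: "('m::{t2_space, second_countable_topology}, 'e::euclidean_space) chart set"
  assumes A: "smooth_atlas A" and B: "smooth_atlas B" and f: "smooth_map A B f"
  shows "linear (map_deriv A B f x)"
  unfolding map_deriv_def
proof (rule has_derivative_linear[OF smooth_on_has_derivative])
  show "smooth_on (snd (chart_at B (f x)) \<circ> f \<circ> chart_inv (chart_at A x))
      (snd (chart_at A x) ` (fst (chart_at A x) \<inter> f -` fst (chart_at B (f x))))"
    using f chart_at_in[OF A] chart_at_in[OF B] by (auto simp: smooth_map_def)
qed (use chart_at_in[OF A] chart_at_in[OF B] in auto)

section \<open>Alternating forms on four-space\<close>

lemma sum_permutes_3:
  fixes G :: "int \<Rightarrow> nat \<Rightarrow> nat \<Rightarrow> nat \<Rightarrow> 'a::ab_group_add"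
  shows "(\<Sum>\<sigma> | \<sigma> permutes {..<3}. G (sign \<sigma>) (\<sigma> 0) (\<sigma> 1) (\<sigma> 2)) =
    G 1 0 1 2 + G (-1) 0 2 1 + G (-1) 1 0 2 + G 1 1 2 0 + G 1 2 0 1 + G (-1) 2 1 0"
proof -
  have e: "{..<3::nat} = {0, 1, 2}" by auto
  have "finite {1::nat, 2}" "(0::nat) \<notin> {1, 2}" "finite {2::nat}" "(1::nat) \<notin> {2}" by auto
  note s = sum_over_permutations_insert[OF this(1,2)] sum_over_permutations_insert[OF this(3,4)]
  show ?thesis unfolding e s permutes_sing
    by (simp add: sign_swap_id permutation_swap_id sign_compose sign_id swap_id_eq algebra_simps)
qed

lemma sum_permutes_4:
  fixes G :: "int \<Rightarrow> nat \<Rightarrow> nat \<Rightarrow> nat \<Rightarrow> nat \<Rightarrow> 'a::ab_group_add"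
  shows "(\<Sum>\<sigma> | \<sigma> permutes {..<4}. G (sign \<sigma>) (\<sigma> 0) (\<sigma> 1) (\<sigma> 2) (\<sigma> 3)) =
    G 1 0 1 2 3 + G (-1) 0 1 3 2 + G (-1) 0 2 1 3 + G 1 0 2 3 1 + G 1 0 3 1 2 + G (-1) 0 3 2 1 +
    G (-1) 1 0 2 3 + G 1 1 0 3 2 + G 1 1 2 0 3 + G (-1) 1 2 3 0 + G (-1) 1 3 0 2 + G 1 1 3 2 0 +
    G 1 2 0 1 3 + G (-1) 2 0 3 1 + G (-1) 2 1 0 3 + G 1 2 1 3 0 + G 1 2 3 0 1 + G (-1) 2 3 1 0 +
    G (-1) 3 0 1 2 + G 1 3 0 2 1 + G 1 3 1 0 2 + G (-1) 3 1 2 0 + G (-1) 3 2 0 1 + G 1 3 2 1 0"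
proof -
  have e: "{..<4::nat} = {0, 1, 2, 3}" by auto
  have "finite {1::nat, 2, 3}" "(0::nat) \<notin> {1, 2, 3}"
    "finite {2::nat, 3}" "(1::nat) \<notin> {2, 3}" "finite {3::nat}" "(2::nat) \<notin> {3}" by auto
  note s = sum_over_permutations_insert[OF this(1,2)] sum_over_permutations_insert[OF this(3,4)]
     sum_over_permutations_insert[OF this(5,6)]
  show ?thesis unfolding e s permutes_sing
    by (simp add: sign_swap_id permutation_swap_id permutation_compose sign_compose sign_id swap_id_eq ac_simps)
qed

lemma dx4_list: "dx [i, j, k, l] [a, b, c, d] =
   (a$i * (b$j * (c$k * d$l - d$k * c$l) - c$j * (b$k * d$l - d$k * b$l) + d$j * (b$k * c$l - c$k * b$l))
  - b$i * (a$j * (c$k * d$l - d$k * c$l) - c$j * (a$k * d$l - d$k * a$l) + d$j * (a$k * c$l - c$k * a$l))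
  + c$i * (a$j * (b$k * d$l - d$k * b$l) - b$j * (a$k * d$l - d$k * a$l) + d$j * (a$k * b$l - b$k * a$l))
  - d$i * (a$j * (b$k * c$l - c$k * b$l) - b$j * (a$k * c$l - c$k * a$l) + c$j * (a$k * b$l - b$k * a$l)))"
proof -
  let ?v = "[a, b, c, d]"
  have "dx [i, j, k, l] ?v = (\<Sum>\<sigma> | \<sigma> permutes {..<4}. of_int (sign \<sigma>) *
      (?v ! \<sigma> 0 $ i * ?v ! \<sigma> 1 $ j * ?v ! \<sigma> 2 $ k * ?v ! \<sigma> 3 $ l))"
    by (simp add: dx_def eval_nat_numeral lessThan_Suc ac_simps)
  also note sum_permutes_4[of "\<lambda>s p q r t. of_int s * (?v ! p $ i * ?v ! q $ j * ?v ! r $ k * ?v ! t $ l)"]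
  finally show ?thesis by (simp add: algebra_simps)
qed

lemma dx3_list: "dx [i, j, k] [a, b, c] =
   a$i * (b$j * c$k - c$j * b$k) - b$i * (a$j * c$k - c$j * a$k) + c$i * (a$j * b$k - b$j * a$k)"
proof -
  let ?v = "[a, b, c]"
  have "dx [i, j, k] ?v = (\<Sum>\<sigma> | \<sigma> permutes {..<3}. of_int (sign \<sigma>) *
      (?v ! \<sigma> 0 $ i * ?v ! \<sigma> 1 $ j * ?v ! \<sigma> 2 $ k))"
    by (simp add: dx_def eval_nat_numeral lessThan_Suc ac_simps)
  also note sum_permutes_3[of "\<lambda>s p q r. of_int s * (?v ! p $ i * ?v ! q $ j * ?v ! r $ k)"]
  finally show ?thesis by (simp add: algebra_simps)
qed

lemma alternatingD_linear:
  "alternating k \<alpha> \<Longrightarrow> length vs = k \<Longrightarrow> i < k \<Longrightarrow> linear (\<lambda>X. \<alpha> (vs[i := X]))"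
  unfolding alternating_def by blast

lemma alternating_zero: "alternating k \<alpha> \<Longrightarrow> length vs = k \<Longrightarrow> i < j \<Longrightarrow> j < k \<Longrightarrow> vs ! i = vs ! j \<Longrightarrow> \<alpha> vs = 0"
  unfolding alternating_def by blast

lemma alternating_swap:
  assumes \<alpha>: "alternating k \<alpha>" and vs: "length vs = k" and ij: "i < j" "j < k"
  shows "\<alpha> (vs[i := vs ! j, j := vs ! i]) = - \<alpha> vs"
proof -
  have z: "\<alpha> (vs[i := X, j := X]) = 0" for X
    by (rule alternating_zero[OF \<alpha> _ ij]) (use vs ij in auto)
  have l1: "\<alpha> (vs[i := X + Y, j := Z]) = \<alpha> (vs[i := X, j := Z]) + \<alpha> (vs[i := Y, j := Z])" for X Y Z
    using linear_add[OF alternatingD_linear[OF \<alpha>, of "vs[j := Z]" i]] vs ij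
    by (simp add: list_update_swap)
  have l2: "\<alpha> (vs[i := Z, j := X + Y]) = \<alpha> (vs[i := Z, j := X]) + \<alpha> (vs[i := Z, j := Y])" for X Y Z
    using linear_add[OF alternatingD_linear[OF \<alpha>, of "vs[i := Z]" j]] vs ij by simp
  have "\<alpha> (vs[i := vs ! i + vs ! j, j := vs ! i + vs ! j]) = 0" by (rule z)
  then have "\<alpha> (vs[i := vs ! j, j := vs ! i]) + \<alpha> (vs[i := vs ! i, j := vs ! j]) = 0"
    unfolding l1 l2 by (simp only: z add_0_left add_0_right)
  then show ?thesis by (simp only: list_update_id eq_neg_iff_add_eq_0)
qed

lemma alternating2_swap: "alternating 2 \<alpha> \<Longrightarrow> \<alpha> [b, a] = - \<alpha> [a, b]"
  using alternating_swap[of 2 \<alpha> "[a, b]" 0 1] by simp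

lemma alternating3_swap:
  assumes "alternating 3 \<alpha>"
  shows "\<alpha> [b, a, c] = - \<alpha> [a, b, c]" "\<alpha> [a, c, b] = - \<alpha> [a, b, c]" "\<alpha> [c, b, a] = - \<alpha> [a, b, c]"
  using alternating_swap[OF assms, of "[a, b, c]" 0 1] alternating_swap[OF assms, of "[a, b, c]" 1 2]
    alternating_swap[OF assms, of "[a, b, c]" 0 2] by (simp_all add: eval_nat_numeral)

lemma length_4_iff: "length vs = 4 \<longleftrightarrow> (\<exists>a b c d. vs = [a, b, c, d])"
  by (auto simp: eval_nat_numeral length_Suc_conv)

lemma length_3_iff: "length vs = 3 \<longleftrightarrow> (\<exists>a b c. vs = [a, b, c])"
  by (auto simp: eval_nat_numeral length_Suc_conv)

lemma length_2_iff: "length vs = 2 \<longleftrightarrow> (\<exists>a b. vs = [a, b])"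
  by (auto simp: eval_nat_numeral length_Suc_conv)

lemma less_4_iff: "i < (4::nat) \<longleftrightarrow> i = 0 \<or> i = 1 \<or> i = 2 \<or> i = 3" by auto
lemma less_3_iff: "i < (3::nat) \<longleftrightarrow> i = 0 \<or> i = 1 \<or> i = 2" by auto
lemma less_2_iff: "i < (2::nat) \<longleftrightarrow> i = 0 \<or> i = 1" by auto

lemma alternating2_iff:
  "alternating 2 \<alpha> \<longleftrightarrow> (\<forall>a. linear (\<lambda>X. \<alpha> [X, a])) \<and> (\<forall>a. linear (\<lambda>X. \<alpha> [a, X])) \<and> (\<forall>a. \<alpha> [a, a] = 0)"
  (is "_ \<longleftrightarrow> ?R")
proof
  assume a: "alternating 2 \<alpha>"
  show ?R
    using alternatingD_linear[OF a, of "[_, _]" 0] alternatingD_linear[OF a, of "[_, _]" 1]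
      alternating_zero[OF a, of "[_, _]" 0 1] by simp
qed (auto simp: alternating_def length_2_iff less_2_iff)

lemma alternating3D:
  assumes a: "alternating 3 \<alpha>"
  shows "linear (\<lambda>X. \<alpha> [X, b, c])" "linear (\<lambda>X. \<alpha> [b, X, c])" "linear (\<lambda>X. \<alpha> [b, c, X])"
    "\<alpha> [b, b, c] = 0" "\<alpha> [b, c, b] = 0" "\<alpha> [c, b, b] = 0"
  using alternatingD_linear[OF a, of "[b, b, c]" 0] alternatingD_linear[OF a, of "[b, b, c]" 1]
     alternatingD_linear[OF a, of "[b, c, c]" 2] alternating_zero[OF a, of "[b, b, c]" 0 1]
     alternating_zero[OF a, of "[b, c, b]" 0 2] alternating_zero[OF a, of "[c, b, b]" 1 2]
  by (simp_all add: eval_nat_numeral)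

lemma alternating4I:
  assumes "\<And>b c d. linear (\<lambda>X. \<alpha> [X, b, c, d])" "\<And>b c d. linear (\<lambda>X. \<alpha> [b, X, c, d])"
    "\<And>b c d. linear (\<lambda>X. \<alpha> [b, c, X, d])" "\<And>b c d. linear (\<lambda>X. \<alpha> [b, c, d, X])"
    "\<And>a b c. \<alpha> [a, a, b, c] = 0" "\<And>a b c. \<alpha> [a, b, a, c] = 0" "\<And>a b c. \<alpha> [a, b, c, a] = 0"
    "\<And>a b c. \<alpha> [b, a, a, c] = 0" "\<And>a b c. \<alpha> [b, a, c, a] = 0" "\<And>a b c. \<alpha> [b, c, a, a] = 0"
  shows "alternating 4 \<alpha>"
  unfolding alternating_def length_4_iff less_4_iff
  using assms by (auto simp: less_4_iff less_3_iff less_2_iff)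

lemma alternating4D:
  assumes a: "alternating 4 \<alpha>"
  shows "linear (\<lambda>X. \<alpha> [X, b, c, d])" "linear (\<lambda>X. \<alpha> [b, X, c, d])"
    "linear (\<lambda>X. \<alpha> [b, c, X, d])" "linear (\<lambda>X. \<alpha> [b, c, d, X])"
    "\<alpha> [b, b, c, d] = 0" "\<alpha> [b, c, b, d] = 0" "\<alpha> [b, c, d, b] = 0"
    "\<alpha> [c, b, b, d] = 0" "\<alpha> [c, b, d, b] = 0" "\<alpha> [c, d, b, b] = 0"
  using alternatingD_linear[OF a, of "[b, b, c, d]" 0] alternatingD_linear[OF a, of "[b, b, c, d]" 1]
     alternatingD_linear[OF a, of "[b, c, c, d]" 2] alternatingD_linear[OF a, of "[b, c, d, d]" 3]
     alternating_zero[OF a, of "[b, b, c, d]" 0 1]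
     alternating_zero[OF a, of "[b, c, b, d]" 0 2] alternating_zero[OF a, of "[b, c, d, b]" 0 3]
     alternating_zero[OF a, of "[c, b, b, d]" 1 2] alternating_zero[OF a, of "[c, b, d, b]" 1 3]
     alternating_zero[OF a, of "[c, d, b, b]" 2 3]
  by (simp_all add: eval_nat_numeral)

lemma alternating4_swap:
  assumes "alternating 4 \<alpha>"
  shows "\<alpha> [b, a, c, d] = - \<alpha> [a, b, c, d]" "\<alpha> [a, c, b, d] = - \<alpha> [a, b, c, d]" "\<alpha> [a, b, d, c] = - \<alpha> [a, b, c, d]"
  using alternating_swap[OF assms, of "[a, b, c, d]" 0 1] alternating_swap[OF assms, of "[a, b, c, d]" 1 2]
    alternating_swap[OF assms, of "[a, b, c, d]" 2 3] by (simp_all add: eval_nat_numeral)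

text \<open>The 24 permutations contribute each of the six shuffles four times, which the normalisation removes.\<close>

lemma wedge22_list:
  fixes \<beta> :: "'e::real_vector list \<Rightarrow> 'b::real_vector"
  assumes \<alpha>: "alternating 2 \<alpha>" and \<beta>: "alternating 2 \<beta>"
  shows "wedge 2 2 \<alpha> \<beta> [a, b, c, d] = \<alpha> [a, b] *\<^sub>R \<beta> [c, d] - \<alpha> [a, c] *\<^sub>R \<beta> [b, d] + \<alpha> [a, d] *\<^sub>R \<beta> [b, c]
    + \<alpha> [b, c] *\<^sub>R \<beta> [a, d] - \<alpha> [b, d] *\<^sub>R \<beta> [a, c] + \<alpha> [c, d] *\<^sub>R \<beta> [a, b]"
    (is "_ = ?R")
proof -
  let ?v = "[a, b, c, d]"
  note sA = alternating2_swap[OF \<alpha>] and sB = alternating2_swap[OF \<beta>]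
  have "[0..<2] = [0, 1::nat]" "[2..<2 + 2] = [2, 3::nat]" by (simp_all add: upt_rec)
  then have "wedge 2 2 \<alpha> \<beta> ?v = (1 / 4) *\<^sub>R (\<Sum>\<sigma> | \<sigma> permutes {..<4}.
      (of_int (sign \<sigma>) * \<alpha> [?v ! \<sigma> 0, ?v ! \<sigma> 1]) *\<^sub>R \<beta> [?v ! \<sigma> 2, ?v ! \<sigma> 3])"
    by (simp add: wedge_def)
  also have "\<dots> = (1 / 4) *\<^sub>R (4 *\<^sub>R ?R)"
  proof (rule arg_cong[where f = "\<lambda>x. (1 / 4) *\<^sub>R x"])
    have q: "4 *\<^sub>R x = x + x + x + x" for x :: 'b
      using scaleR_left_distrib[of 2 2 x] by (simp add: scaleR_2 add.assoc)
    show "(\<Sum>\<sigma> | \<sigma> permutes {..<4}.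
      (of_int (sign \<sigma>) * \<alpha> [?v ! \<sigma> 0, ?v ! \<sigma> 1]) *\<^sub>R \<beta> [?v ! \<sigma> 2, ?v ! \<sigma> 3]) = 4 *\<^sub>R ?R"
      unfolding sum_permutes_4[of "\<lambda>s p q r t. (of_int s * \<alpha> [?v ! p, ?v ! q]) *\<^sub>R \<beta> [?v ! r, ?v ! t]"] q
      by (simp add: sA[of b a] sA[of c a] sA[of d a] sA[of c b] sA[of d b] sA[of d c]
          sB[of b a] sB[of c a] sB[of d a] sB[of c b] sB[of d b] sB[of d c])
  qed
  finally show ?thesis by simp
qed

lemma wedge31_list:
  fixes \<beta> :: "'e::real_vector list \<Rightarrow> 'b::real_vector"
  assumes \<alpha>: "alternating 3 \<alpha>"
  shows "wedge 3 1 \<alpha> \<beta> [a, b, c, d] = \<alpha> [a, b, c] *\<^sub>R \<beta> [d] - \<alpha> [a, b, d] *\<^sub>R \<beta> [c]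
    + \<alpha> [a, c, d] *\<^sub>R \<beta> [b] - \<alpha> [b, c, d] *\<^sub>R \<beta> [a]" (is "_ = ?R")
proof -
  let ?v = "[a, b, c, d]"
  note sw = alternating3_swap[OF \<alpha>]
  have s: "\<alpha> [y, x, z] = - \<alpha> [x, y, z]" "\<alpha> [x, z, y] = - \<alpha> [x, y, z]" "\<alpha> [z, y, x] = - \<alpha> [x, y, z]"
    "\<alpha> [y, z, x] = \<alpha> [x, y, z]" "\<alpha> [z, x, y] = \<alpha> [x, y, z]" for x y z
    using sw(1)[of y x z] sw(2)[of x z y] sw(3)[of z y x] sw(1)[of y z x] sw(2)[of z y x] sw(2)[of y z x]
       sw(1)[of z x y] sw(3)[of y z x]  by simp_all
  have "[0..<3] = [0, 1, 2::nat]" "[3..<3 + 1] = [3::nat]" by (simp_all add: upt_rec)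
  moreover have "(3 + 1::nat) = 4" by simp
  ultimately have "wedge 3 1 \<alpha> \<beta> ?v = (1 / 6) *\<^sub>R (\<Sum>\<sigma> | \<sigma> permutes {..<4}.
      (of_int (sign \<sigma>) * \<alpha> [?v ! \<sigma> 0, ?v ! \<sigma> 1, ?v ! \<sigma> 2]) *\<^sub>R \<beta> [?v ! \<sigma> 3])"
    unfolding wedge_def by (simp only:) (simp add: fact_numeral)
  also have "\<dots> = (1 / 6) *\<^sub>R (6 *\<^sub>R ?R)"
  proof (rule arg_cong[where f = "\<lambda>x. (1 / 6) *\<^sub>R x"])
    have q: "6 *\<^sub>R x = x + x + x + x + x + x" for x :: 'b
      using scaleR_left_distrib[of 2 2 x] scaleR_left_distrib[of 4 2 x] by (simp add: scaleR_2 add.assoc)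
    show "(\<Sum>\<sigma> | \<sigma> permutes {..<4}.
      (of_int (sign \<sigma>) * \<alpha> [?v ! \<sigma> 0, ?v ! \<sigma> 1, ?v ! \<sigma> 2]) *\<^sub>R \<beta> [?v ! \<sigma> 3]) = 6 *\<^sub>R ?R"
      unfolding sum_permutes_4[of "\<lambda>s p q r t. (of_int s * \<alpha> [?v ! p, ?v ! q, ?v ! r]) *\<^sub>R \<beta> [?v ! t]"] q
      by (simp add: s[where x = a and y = b and z = c] s[where x = a and y = b and z = d]
          s[where x = a and y = c and z = d] s[where x = b and y = c and z = d])
  qed
  finally show ?thesis by simp
qed


lemma scaleR_linear: "linear f \<Longrightarrow> linear (\<lambda>x. f x *\<^sub>R c)" "linear g \<Longrightarrow> linear (\<lambda>x. r *\<^sub>R g x)"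
  by (auto intro!: linearI simp: linear_add linear_scale scaleR_add_left scaleR_add_right)

lemma wedge22_alternating:
  assumes \<alpha>: "alternating 2 \<alpha>" and \<beta>: "alternating 2 \<beta>"
  shows "alternating 4 (wedge 2 2 \<alpha> \<beta>)"
proof -
  have l: "linear (\<lambda>X. \<alpha> [X, a])" "linear (\<lambda>X. \<alpha> [a, X])" "linear (\<lambda>X. \<beta> [X, a])" "linear (\<lambda>X. \<beta> [a, X])"
    and z: "\<alpha> [a, a] = 0" "\<beta> [a, a] = 0" for a
    using \<alpha> \<beta> by (auto simp: alternating2_iff)
  note sA = alternating2_swap[OF \<alpha>] and sB = alternating2_swap[OF \<beta>]
  show ?thesis
  proof (rule alternating4I, goal_cases)
    case (8 a b c) then show ?case by (simp add: wedge22_list[OF \<alpha> \<beta>] z)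
  next
    case (9 a b c) then show ?case by (simp add: wedge22_list[OF \<alpha> \<beta>] z sA[of c a] sB[of c a])
  next
    case (6 a b c) then show ?case by (simp add: wedge22_list[OF \<alpha> \<beta>] z sA[of b a] sB[of b a])
  next
    case (7 a b c) then show ?case by (simp add: wedge22_list[OF \<alpha> \<beta>] z sA[of b a] sB[of b a] sA[of c a] sB[of c a])
  qed (simp_all add: wedge22_list[OF \<alpha> \<beta>] z linear_compose_add linear_compose_sub scaleR_linear l)
qed

lemma wedge31_alternating:
  assumes \<alpha>: "alternating 3 \<alpha>" and \<beta>: "alternating 1 \<beta>"
  shows "alternating 4 (wedge 3 1 \<alpha> \<beta>)"
proof -
  have lb: "linear (\<lambda>X. \<beta> [X])" using alternatingD_linear[OF \<beta>, of "[0]" 0] by simp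
  note l = alternating3D(1-3)[OF \<alpha>] and z = alternating3D(4-6)[OF \<alpha>]
  note sw = alternating3_swap[OF \<alpha>]
  show ?thesis
  proof (rule alternating4I, goal_cases)
    case (6 a b c) then show ?case by (simp del: One_nat_def add: wedge31_list[OF \<alpha>] z sw(1)[of b a])
  next
    case (7 a b c) then show ?case using sw(1)[of b a c] sw(2)[of b c a] by (simp del: One_nat_def add: wedge31_list[OF \<alpha>] z)
  next
    case (9 b a c) then show ?case using sw(2)[of a c b] by (simp del: One_nat_def add: wedge31_list[OF \<alpha>] z)
  qed (simp_all del: One_nat_def add: wedge31_list[OF \<alpha>] z linear_compose_add linear_compose_sub scaleR_linear l lb)
qed

lemma UNIV_4: "(UNIV :: 4 set) = {0, 1, 2, 3}"
  by (rule card_subset_eq[symmetric]) simp_all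

lemma sum_UNIV_4: "(\<Sum>i\<in>UNIV. g (i::4)) = g 0 + g 1 + g 2 + g 3"
  for g :: "4 \<Rightarrow> 'a::comm_monoid_add"
  unfolding UNIV_4 by (simp add: add.assoc)

lemma vec4_expand: "(x :: real ^ 4) = x $ 0 *\<^sub>R axis 0 1 + x $ 1 *\<^sub>R axis 1 1 + x $ 2 *\<^sub>R axis 2 1 + x $ 3 *\<^sub>R axis 3 1"
  using basis_expansion[of x] by (simp add: sum_UNIV_4 scalar_mult_eq_scaleR)

lemma linear_zero_4:
  assumes "linear (g :: real ^ 4 \<Rightarrow> 'b::real_vector)" "\<And>i. g (axis i 1) = 0"
  shows "g x = 0"
  by (subst vec4_expand) (simp add: linear_add[OF assms(1)] linear_scale[OF assms(1)] assms(2))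

lemma all_4: "(\<forall>i::4. P i) \<longleftrightarrow> P 0 \<and> P 1 \<and> P 2 \<and> P 3"
  using UNIV_4 by (metis UNIV_I empty_iff insert_iff)

text \<open>Each argument is expanded in the standard basis; repeated basis vectors give zero, and the others can be
  sorted.\<close>

lemma alternating4_eq_0:
  fixes \<delta> :: "(real ^ 4) list \<Rightarrow> 'b::real_vector"
  assumes \<delta>: "alternating 4 \<delta>" and 0: "\<delta> std_basis4 = 0"
  shows "\<delta> [a, b, c, d] = 0"
proof -
  define e :: "4 \<Rightarrow> real ^ 4" where "e i = axis i 1" for i
  note z = alternating4D(5-10)[OF \<delta>] and l = alternating4D(1-4)[OF \<delta>]
  have s: "\<delta> [y, x, u, v] = 0 \<longleftrightarrow> \<delta> [x, y, u, v] = 0" "\<delta> [u, y, x, v] = 0 \<longleftrightarrow> \<delta> [u, x, y, v] = 0"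
    "\<delta> [u, v, y, x] = 0 \<longleftrightarrow> \<delta> [u, v, x, y] = 0" for x y u v
    using alternating4_swap[OF \<delta>] by (metis neg_equal_0_iff_equal)+
  note ss = s[where x = "e 0" and y = "e 1"] s[where x = "e 0" and y = "e 2"] s[where x = "e 0" and y = "e 3"] s[where x = "e 1" and y = "e 2"] s[where x = "e 1" and y = "e 3"] s[where x = "e 2" and y = "e 3"]
  have 0: "\<delta> [e 0, e 1, e 2, e 3] = 0" using 0 by (simp add: std_basis4_def e_def)
  have "\<forall>i j k m. \<delta> [e i, e j, e k, e m] = 0"
    unfolding all_4 by (simp add: z ss 0)
  then have "\<delta> [e i, e j, e k, d] = 0" for i j k d
    using linear_zero_4[OF l(4)] by (simp add: e_def)
  then have "\<delta> [e i, e j, c, d] = 0" for i j c d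
    using linear_zero_4[OF l(3)] by (simp add: e_def)
  then have "\<delta> [e i, b, c, d] = 0" for i b c d
    using linear_zero_4[OF l(2)] by (simp add: e_def)
  then show ?thesis using linear_zero_4[OF l(1)] by (simp add: e_def)
qed

lemma alternating3_eq_0:
  fixes \<delta> :: "(real ^ 4) list \<Rightarrow> 'b::real_vector"
  assumes \<delta>: "alternating 3 \<delta>"
    and 0: "\<delta> [axis 0 1, axis 1 1, axis 2 1] = 0" "\<delta> [axis 0 1, axis 1 1, axis 3 1] = 0"
     "\<delta> [axis 0 1, axis 2 1, axis 3 1] = 0" "\<delta> [axis 1 1, axis 2 1, axis 3 1] = 0"
  shows "\<delta> [a, b, c] = 0"
proof -
  define e :: "4 \<Rightarrow> real ^ 4" where "e i = axis i 1" for i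
  note z = alternating3D(4-6)[OF \<delta>] and l = alternating3D(1-3)[OF \<delta>]
  have s: "\<delta> [y, x, u] = 0 \<longleftrightarrow> \<delta> [x, y, u] = 0" "\<delta> [u, y, x] = 0 \<longleftrightarrow> \<delta> [u, x, y] = 0" for x y u
    using alternating3_swap[OF \<delta>] by (metis neg_equal_0_iff_equal)+
  note ss = s[where x = "e 0" and y = "e 1"] s[where x = "e 0" and y = "e 2"] s[where x = "e 0" and y = "e 3"] s[where x = "e 1" and y = "e 2"] s[where x = "e 1" and y = "e 3"] s[where x = "e 2" and y = "e 3"]
  have "\<forall>i j k. \<delta> [e i, e j, e k] = 0"
    unfolding all_4 by (simp add: z ss 0[folded e_def])
  then have "\<delta> [e i, e j, c] = 0" for i j c
    using linear_zero_4[OF l(3)] by (simp add: e_def)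
  then have "\<delta> [e i, b, c] = 0" for i b c
    using linear_zero_4[OF l(2)] by (simp add: e_def)
  then show ?thesis using linear_zero_4[OF l(1)] by (simp add: e_def)
qed

lemma dx_alternating4: "alternating 4 (dx [i, j, k, l] :: (real ^ 'n::finite) list \<Rightarrow> real)"
  by (rule alternating4I) (auto intro!: linearI simp: dx4_list algebra_simps)

lemma dx_std_basis4: "dx [0, 1, 2, 3] std_basis4 = 1"
  by (simp add: std_basis4_def dx4_list axis_def)

lemma top_form_eq:
  fixes \<omega> :: "(real ^ 4) list \<Rightarrow> 'b::real_vector"
  assumes \<omega>: "alternating 4 \<omega>" and vs: "length vs = 4"
  shows "\<omega> vs = dx [0, 1, 2, 3] vs *\<^sub>R \<omega> std_basis4"
proof -
  note D = alternating4D[OF \<omega>] alternating4D[OF dx_alternating4[of "0::4" 1 2 3]]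
  have "alternating 4 (\<lambda>vs. \<omega> vs - dx [0, 1, 2, 3] vs *\<^sub>R \<omega> std_basis4)"
    by (rule alternating4I) (simp_all add: D linear_compose_sub scaleR_linear)
  from alternating4_eq_0[OF this] show ?thesis
    using vs by (auto simp: length_4_iff dx_std_basis4)
qed

lemma det_eq_dx: "det (matrix J) = dx [0, 1, 2, 3] (map J std_basis4)" for J :: "real ^ 4 \<Rightarrow> real ^ 4"
proof -
  have "finite {1::4, 2, 3}" "(0::4) \<notin> {1, 2, 3}"
    "finite {2::4, 3}" "(1::4) \<notin> {2, 3}" "finite {3::4}" "(2::4) \<notin> {3}" by auto
  note s = sum_over_permutations_insert[OF this(1,2)] sum_over_permutations_insert[OF this(3,4)]
     sum_over_permutations_insert[OF this(5,6)]
  have p: "prod g UNIV = g 0 * g 1 * g 2 * g 3" for g :: "4 \<Rightarrow> real"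
    unfolding UNIV_4 by (simp add: mult.assoc)
  show ?thesis unfolding det_def p unfolding UNIV_4 s permutes_sing
    by (simp add: sign_swap_id permutation_swap_id permutation_compose sign_compose sign_id swap_id_eq
        matrix_def std_basis4_def dx4_list algebra_simps)
qed

section \<open>Integration of forms supported in one chart\<close>

text \<open>The change of variables formula for vector-valued functions and the Lebesgue measure, restated for
  scalar functions and \<open>lborel\<close>. Borel measurability of the left-hand integrand is a hypothesis because
  integrability over the completed measure does not provide it.\<close>

lemma change_of_variables_real:
  fixes \<phi> :: "real ^ 4 \<Rightarrow> real ^ 4" and f :: "real ^ 4 \<Rightarrow> real"
  assumes S: "S \<in> sets borel" "\<phi> ` S \<in> sets borel"
    and der: "\<And>x. x \<in> S \<Longrightarrow> (\<phi> has_derivative D x) (at x)" and inj: "inj_on \<phi> S"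
    and f: "set_integrable lborel (\<phi> ` S) f"
    and h: "set_borel_measurable borel S (\<lambda>x. \<bar>det (matrix (D x))\<bar> * f (\<phi> x))"
  shows "set_integrable lborel S (\<lambda>x. \<bar>det (matrix (D x))\<bar> * f (\<phi> x)) \<and>
    (LINT x:S|lborel. \<bar>det (matrix (D x))\<bar> * f (\<phi> x)) = (LINT y:\<phi> ` S|lborel. f y)"
proof -
  let ?h = "\<lambda>x. \<bar>det (matrix (D x))\<bar> * f (\<phi> x)"
  have mf: "(\<lambda>y. indicator (\<phi> ` S) y *\<^sub>R f y) \<in> borel_measurable lborel"
    using f unfolding set_integrable_def by (rule borel_measurable_integrable)
  have mh: "(\<lambda>y. indicator S y *\<^sub>R ?h y) \<in> borel_measurable lborel"
    using h unfolding set_borel_measurable_def by simp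
  have af: "f absolutely_integrable_on (\<phi> ` S)"
    using f mf unfolding set_integrable_def by (simp add: integrable_completion)
  have SL: "S \<in> sets lebesgue" using S by simp
  have cv: "(\<lambda>x. \<bar>det (matrix (D x))\<bar> *\<^sub>R vec (f (\<phi> x)) :: real ^ 1) absolutely_integrable_on S \<and>
      integral S (\<lambda>x. \<bar>det (matrix (D x))\<bar> *\<^sub>R vec (f (\<phi> x)) :: real ^ 1) = vec (integral (\<phi> ` S) f)
     \<longleftrightarrow> (\<lambda>x. vec (f x) :: real ^ 1) absolutely_integrable_on (\<phi> ` S) \<and>
        integral (\<phi> ` S) (\<lambda>x. vec (f x) :: real ^ 1) = vec (integral (\<phi> ` S) f)"
    by (rule has_absolute_integral_change_of_variables[OF SL has_derivative_at_withinI[OF der] inj])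
  have "?h absolutely_integrable_on S \<and> integral S ?h = integral (\<phi> ` S) f"
    using cv af by (simp add: absolutely_integrable_on_1_iff integral_on_1_eq)
  then have ah: "?h absolutely_integrable_on S" and eq: "integral S ?h = integral (\<phi> ` S) f" by auto
  have ih: "set_integrable lborel S ?h"
    using ah mh unfolding set_integrable_def by (simp add: integrable_completion)
  have "(LINT x:S|lborel. ?h x) = (LINT x:S|lebesgue. ?h x)"
    unfolding set_lebesgue_integral_def using integral_completion[OF mh] by simp
  also have "\<dots> = (LINT y:\<phi> ` S|lebesgue. f y)"
    using set_lebesgue_integral_eq_integral(2)[OF ah] set_lebesgue_integral_eq_integral(2)[OF af] eq by simp
  also have "\<dots> = (LINT y:\<phi> ` S|lborel. f y)"
    unfolding set_lebesgue_integral_def using integral_completion[OF mf] by simp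
  finally show ?thesis using ih by blast
qed

lemma change_of_variables_complex:
  fixes \<phi> :: "real ^ 4 \<Rightarrow> real ^ 4" and f :: "real ^ 4 \<Rightarrow> complex"
  assumes S: "S \<in> sets borel" "\<phi> ` S \<in> sets borel"
    and der: "\<And>x. x \<in> S \<Longrightarrow> (\<phi> has_derivative D x) (at x)" and inj: "inj_on \<phi> S"
    and f: "set_integrable lborel (\<phi> ` S) f"
    and h: "set_borel_measurable borel S (\<lambda>x. \<bar>det (matrix (D x))\<bar> *\<^sub>R f (\<phi> x))"
  shows "(LINT x:S|lborel. \<bar>det (matrix (D x))\<bar> *\<^sub>R f (\<phi> x)) = (LINT y:\<phi> ` S|lborel. f y)"
proof -
  let ?h = "\<lambda>x. \<bar>det (matrix (D x))\<bar> *\<^sub>R f (\<phi> x)"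
  have mh: "(\<lambda>x. indicator S x *\<^sub>R ?h x) \<in> borel_measurable borel"
    using h unfolding set_borel_measurable_def .
  have fi: "integrable lborel (\<lambda>x. indicator (\<phi> ` S) x *\<^sub>R f x)"
    using f unfolding set_integrable_def .
  have re: "set_integrable lborel S (\<lambda>x. Re (?h x)) \<and>
      (LINT x:S|lborel. Re (?h x)) = (LINT y:\<phi> ` S|lborel. Re (f y))"
    using change_of_variables_real[OF S der inj, of "\<lambda>y. Re (f y)"]
      integrable_Re[OF fi] conjunct1[OF mh[unfolded borel_measurable_complex_iff]]
    by (simp add: set_integrable_def set_borel_measurable_def mult.assoc)
  have im: "set_integrable lborel S (\<lambda>x. Im (?h x)) \<and>
      (LINT x:S|lborel. Im (?h x)) = (LINT y:\<phi> ` S|lborel. Im (f y))"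
    using change_of_variables_real[OF S der inj, of "\<lambda>y. Im (f y)"]
      integrable_Im[OF fi] conjunct2[OF mh[unfolded borel_measurable_complex_iff]]
    by (simp add: set_integrable_def set_borel_measurable_def mult.assoc)
  have "(\<lambda>x. indicator S x *\<^sub>R ?h x) =
     (\<lambda>x. complex_of_real (indicator S x *\<^sub>R Re (?h x)) + \<i> * complex_of_real (indicator S x *\<^sub>R Im (?h x)))"
    by (rule ext) (simp add: complex_eq_iff)
  moreover have "complex_integrable lborel (\<lambda>x. complex_of_real (indicator S x *\<^sub>R Re (?h x)))"
    "complex_integrable lborel (\<lambda>x. complex_of_real (indicator S x *\<^sub>R Im (?h x)))"
    unfolding complex_of_real_integrable_eq using re im unfolding set_integrable_def by blast+
  ultimately have hi: "integrable lborel (\<lambda>x. indicator S x *\<^sub>R ?h x)"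
    by (simp only: Bochner_Integration.integrable_add integrable_mult_right)
  show ?thesis
    using re im integral_Re[OF hi] integral_Im[OF hi] integral_Re[OF fi] integral_Im[OF fi]
    unfolding set_lebesgue_integral_def by (simp add: complex_eq_iff mult.assoc)
qed

lemma alternating_map_linear:
  fixes L :: "'a::real_vector \<Rightarrow> 'e::real_vector"
  assumes "alternating k \<alpha>" "linear L"
  shows "alternating k (\<lambda>vs. \<alpha> (map L vs))"
  unfolding alternating_def
proof (intro conjI allI impI)
  fix vs :: "'a list" and i assume "length vs = k \<and> i < k"
  then have "linear (\<lambda>X. \<alpha> ((map L vs)[i := X]))"
    using alternatingD_linear[OF assms(1), of "map L vs" i] by simp
  from linear_compose[OF assms(2) this]
  show "linear (\<lambda>X. \<alpha> (map L (vs[i := X])))" by (simp add: o_def map_update)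
next
  fix vs :: "'a list" and i j assume "length vs = k \<and> i < j \<and> j < k \<and> vs ! i = vs ! j"
  then show "\<alpha> (map L vs) = 0"
    by (intro alternating_zero[OF assms(1), of _ i j]) auto
qed

lemma coord_form_std_basis_change:
  fixes A :: "('c::{t2_space, second_countable_topology}, real ^ 4) chart set"
    and \<omega> :: "'c \<Rightarrow> (real ^ 4) list \<Rightarrow> 'b::real_vector"
  assumes A: "smooth_atlas A" and c: "c \<in> A" "x \<in> fst c" and d: "d \<in> A" "x \<in> fst d"
    and alt: "alternating 4 (\<omega> x)"
  shows "coord_form A \<omega> d (snd d x) std_basis4 =
    det (matrix (jac d c x)) *\<^sub>R coord_form A \<omega> c (snd c x) std_basis4"
proof -
  let ?\<eta> = "\<lambda>vs. \<omega> x (map (coord_vec A c x) vs)"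
  have "coord_form A \<omega> d (snd d x) std_basis4 = ?\<eta> (map (jac d c x) std_basis4)"
    unfolding coord_form_def chart_inv_left[OF A d]
    using coord_vec_jac_eq[OF A d(1) c(1) d(2) c(2)] by (simp add: o_def)
  also have "\<dots> = dx [0, 1, 2, 3] (map (jac d c x) std_basis4) *\<^sub>R ?\<eta> std_basis4"
    by (rule top_form_eq[OF alternating_map_linear[OF alt coord_vec_linear[OF A c]]])
      (simp add: std_basis4_def)
  finally show ?thesis by (simp add: det_eq_dx coord_form_def chart_inv_left[OF A c])
qed

lemma chart_image_borel:
  fixes A :: "('c::{t2_space, second_countable_topology}, 'e::euclidean_space) chart set"
  assumes A: "smooth_atlas A" and c: "c \<in> A" and S: "S \<in> sets borel"
  shows "snd c ` (S \<inter> fst c) \<in> sets borel"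
proof -
  let ?V = "snd c ` fst c"
  have V: "open ?V" using chart_range_open[OF A c] .
  have "chart_inv c \<in> borel_measurable (restrict_space borel ?V)"
    by (rule borel_measurable_continuous_on_restrict[OF chart_inv_cont[OF A c]])
  from measurable_sets[OF this S]
  have "chart_inv c -` S \<inter> ?V \<in> sets (restrict_space borel ?V)"
    by (simp add: space_restrict_space)
  then have "chart_inv c -` S \<inter> ?V \<in> sets borel"
    using V by (simp add: sets_restrict_space_iff)
  moreover have "chart_inv c -` S \<inter> ?V = snd c ` (S \<inter> fst c)"
    using chart_image_iff[OF A c, of _ S] by (auto simp: Int_commute)
  ultimately show ?thesis by simp
qed

text \<open>The integral was defined through an arbitrary partition into pieces inside arbitrary charts. On each
  piece the change of variables to the chart \<open>c\<close> has positive Jacobian determinant, and the pieces are put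
  together by countable additivity.\<close>

theorem form_integral_chart:
  fixes A :: "('c::{t2_space, second_countable_topology}, real ^ 4) chart set"
    and \<omega> :: "'c \<Rightarrow> (real ^ 4) list \<Rightarrow> complex"
  assumes A: "oriented_atlas A" and c: "c \<in> A"
    and alt: "\<And>x. alternating 4 (\<omega> x)"
    and supp: "\<And>x vs. x \<notin> fst c \<Longrightarrow> length vs = 4 \<Longrightarrow> \<omega> x vs = 0"
    and int: "set_integrable lborel (snd c ` fst c) (\<lambda>y. coord_form A \<omega> c y std_basis4)"
  shows "form_integral A \<omega> = (LINT y:snd c ` fst c|lborel. coord_form A \<omega> c y std_basis4)"
proof -
  have SA: "smooth_atlas A" using A by (simp add: oriented_atlas_def)
  let ?g = "\<lambda>d y. coord_form A \<omega> d y std_basis4"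
  define cS where "cS = (SOME (c, S). chart_partition A c S)"
  obtain cc S where cS: "cS = (cc, S)" by (cases cS)
  have "\<exists>p. case p of (c, S) \<Rightarrow> chart_partition A c S"
    using chart_partition_exists[OF SA] by auto
  from someI_ex[OF this] have P: "chart_partition A cc S"
    using cS unfolding cS_def by auto
  have cc: "cc i \<in> A" and S: "S i \<in> sets borel" "S i \<subseteq> fst (cc i)" for i
    using P by (auto simp: chart_partition_def)
  have disj: "i \<noteq> j \<Longrightarrow> S i \<inter> S j = {}" for i j
    using P by (auto simp: chart_partition_def disjoint_family_on_def)
  have un: "(\<Union>i. S i) = UNIV" using P by (auto simp: chart_partition_def)
  define T where "T i = snd c ` (S i \<inter> fst c)" for i
  have Tb: "T i \<in> sets borel" for i unfolding T_def by (rule chart_image_borel[OF SA c S(1)])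
  have TV: "T i \<subseteq> snd c ` fst c" for i by (auto simp: T_def)
  have Tint: "set_integrable lborel (T i) (?g c)" for i
    by (rule set_integrable_subset[OF int]) (use Tb TV in auto)
  have piece: "(LINT y:snd (cc i) ` S i|lborel. ?g (cc i) y) = (LINT y:T i|lborel. ?g c y)" for i
  proof -
    let ?d = "cc i"
    have d: "?d \<in> A" by (rule cc)
    define R where "R = snd ?d ` (S i \<inter> fst c)"
    define \<phi> where "\<phi> = snd c \<circ> chart_inv ?d"
    define D where "D w = jac ?d c (chart_inv ?d w)" for w
    define W where "W = snd ?d ` (fst ?d \<inter> fst c)"
    have W: "open W" unfolding W_def using chart_image_open[OF SA d] chart_dom_open[OF SA c] by blast
    have RW: "R \<subseteq> W" using S(2)[of i] by (auto simp: R_def W_def)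
    have R: "\<exists>x. x \<in> S i \<and> x \<in> fst c \<and> x \<in> fst ?d \<and> w = snd ?d x" if "w \<in> R" for w
      using that S(2)[of i] by (auto simp: R_def)
    have inv: "chart_inv ?d (snd ?d x) = x" if "x \<in> fst ?d" for x using chart_inv_left[OF SA d that] .
    have Rb: "R \<in> sets borel"
    proof -
      have "R = snd ?d ` ((S i \<inter> fst c) \<inter> fst ?d)" using S(2)[of i] by (auto simp: R_def)
      moreover have "S i \<inter> fst c \<in> sets borel" using S(1) chart_dom_open[OF SA c] by auto
      ultimately show ?thesis using chart_image_borel[OF SA d] by simp
    qed
    have \<phi>R: "\<phi> ` R = T i"
      unfolding R_def T_def \<phi>_def image_image using inv S(2)[of i] by (intro image_cong) auto
    have der: "(\<phi> has_derivative D w) (at w)" if "w \<in> R" for w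
      using R[OF that] jac_has_derivative[OF SA d c] inv by (auto simp: \<phi>_def D_def)
    have inj: "inj_on \<phi> R"
    proof (rule inj_on_inverseI)
      show "(snd ?d \<circ> chart_inv c) (\<phi> w) = w" if "w \<in> R" for w
        using R[OF that] inv chart_inv_left[OF SA c] by (auto simp: \<phi>_def)
    qed
    have detpos: "det (matrix (D w)) > 0" if "w \<in> R" for w
      using R[OF that] A d c inv by (auto simp: oriented_atlas_def D_def jac_def)
    have eq: "?g ?d w = \<bar>det (matrix (D w))\<bar> *\<^sub>R ?g c (\<phi> w)" if w: "w \<in> R" for w
    proof -
      obtain x where x: "x \<in> fst c" "x \<in> fst ?d" "w = snd ?d x" using R[OF w] by blast
      have "?g ?d (snd ?d x) = det (matrix (jac ?d c x)) *\<^sub>R ?g c (snd c x)"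
        by (rule coord_form_std_basis_change[OF SA c x(1) d x(2) alt])
      then show ?thesis using x detpos[OF w] inv by (simp add: \<phi>_def D_def)
    qed
    \<comment> \<open>The coordinate expression is only known to be measurable on the chart range, hence the indicators.\<close>
    have meas: "set_borel_measurable borel R (\<lambda>x. \<bar>det (matrix (D x))\<bar> *\<^sub>R ?g c (\<phi> x))"
    proof -
      have ts: "smooth_on \<phi> W" unfolding \<phi>_def W_def by (rule transition_smooth[OF SA d c])
      have "continuous_on W (\<lambda>w. D w v)" for v
        unfolding D_def W_def by (rule smooth_on_imp_continuous[OF jac_smooth[OF SA d c]])
      then have cD: "continuous_on W (\<lambda>w. \<bar>det (matrix (D w))\<bar>)"
        unfolding det_def matrix_def by (intro continuous_intros) (auto intro!: continuous_intros)
      then have 1: "(\<lambda>w. \<bar>det (matrix (D w))\<bar>) \<in> borel_measurable (restrict_space borel W)"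
        by (rule borel_measurable_continuous_on_restrict)
      have p1: "\<phi> \<in> borel_measurable (restrict_space borel W)"
        by (rule borel_measurable_continuous_on_restrict[OF smooth_on_imp_continuous[OF ts]])
      have "(\<lambda>y. indicator (snd c ` fst c) y *\<^sub>R ?g c y) \<in> borel_measurable borel"
        using borel_measurable_integrable[OF int[unfolded set_integrable_def]] by simp
      from measurable_compose[OF p1 this]
      have 2: "(\<lambda>w. indicator (snd c ` fst c) (\<phi> w) *\<^sub>R ?g c (\<phi> w)) \<in> borel_measurable (restrict_space borel W)" .
      have "(\<lambda>w. \<bar>det (matrix (D w))\<bar> *\<^sub>R (indicator (snd c ` fst c) (\<phi> w) *\<^sub>R ?g c (\<phi> w)))
          \<in> borel_measurable (restrict_space borel W)"
        using 1 2 by (rule borel_measurable_scaleR)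
      then have "(\<lambda>w. indicator W w *\<^sub>R (\<bar>det (matrix (D w))\<bar> *\<^sub>R (indicator (snd c ` fst c) (\<phi> w) *\<^sub>R ?g c (\<phi> w))))
          \<in> borel_measurable borel"
        using W by (simp add: borel_measurable_restrict_space_iff)
      then have "(\<lambda>w. indicator R w *\<^sub>R (indicator W w *\<^sub>R (\<bar>det (matrix (D w))\<bar> *\<^sub>R (indicator (snd c ` fst c) (\<phi> w) *\<^sub>R ?g c (\<phi> w)))))
          \<in> borel_measurable borel"
        by (rule borel_measurable_scaleR[OF borel_measurable_indicator[OF Rb]])
      moreover have "indicator R w *\<^sub>R (indicator W w *\<^sub>R (\<bar>det (matrix (D w))\<bar> *\<^sub>R (indicator (snd c ` fst c) (\<phi> w) *\<^sub>R ?g c (\<phi> w))))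
        = indicator R w *\<^sub>R (\<bar>det (matrix (D w))\<bar> *\<^sub>R ?g c (\<phi> w))" for w
        using RW \<phi>R TV[of i] by (auto simp: indicator_def)
      ultimately show ?thesis unfolding set_borel_measurable_def by (simp only:)
    qed
    have "(LINT y:snd ?d ` S i|lborel. ?g ?d y) = (LINT y:R|lborel. ?g ?d y)"
      unfolding set_lebesgue_integral_def
    proof (rule Bochner_Integration.integral_cong[OF refl])
      fix y
      have "?g ?d y = 0" if "y \<in> snd ?d ` S i" "y \<notin> R"
      proof -
        obtain x where x: "x \<in> S i" "y = snd ?d x" using \<open>y \<in> snd ?d ` S i\<close> by auto
        then have "x \<notin> fst c" "chart_inv ?d y = x" using \<open>y \<notin> R\<close> S(2)[of i] inv by (auto simp: R_def)
        then show ?thesis using supp by (simp add: coord_form_def std_basis4_def)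
      qed
      moreover have "R \<subseteq> snd ?d ` S i" by (auto simp: R_def)
      ultimately show "indicat_real (snd ?d ` S i) y *\<^sub>R ?g ?d y = indicat_real R y *\<^sub>R ?g ?d y"
        by (auto simp: indicator_def)
    qed
    also have "\<dots> = (LINT w:R|lborel. \<bar>det (matrix (D w))\<bar> *\<^sub>R ?g c (\<phi> w))"
      unfolding set_lebesgue_integral_def
      by (rule Bochner_Integration.integral_cong[OF refl]) (auto simp: indicator_def eq)
    also have "\<dots> = (LINT y:\<phi> ` R|lborel. ?g c y)"
      by (rule change_of_variables_complex[OF Rb _ der inj _ meas]) (use Tb Tint in \<open>auto simp: \<phi>R\<close>)
    finally show ?thesis unfolding \<phi>R .
  qed
  have "form_integral A \<omega> = (\<Sum>i. LINT y:snd (cc i) ` S i|lborel. ?g (cc i) y)"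
    unfolding form_integral_def cS_def[symmetric] cS by simp
  also have "\<dots> = (\<Sum>i. LINT y:T i|lborel. ?g c y)" by (simp add: piece)
  also have "\<dots> = (LINT y:(\<Union>i. T i)|lborel. ?g c y)"
  proof (rule lebesgue_integral_countable_add[symmetric])
    show "T i \<in> sets lborel" for i using Tb by simp
    show "T i \<inter> T j = {}" if "i \<noteq> j" for i j
    proof (rule equals0I)
      fix y assume "y \<in> T i \<inter> T j"
      then obtain x x' where "x \<in> S i" "x \<in> fst c" "y = snd c x" "x' \<in> S j" "x' \<in> fst c" "y = snd c x'"
        by (auto simp: T_def)
      then have "x = x'" using chart_inv_left[OF SA c] by metis
      then show False using \<open>x \<in> S i\<close> \<open>x' \<in> S j\<close> disj[OF that] by auto
    qed
    show "set_integrable lborel (\<Union> (range T)) (?g c)"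
      by (rule set_integrable_subset[OF int]) (use Tb TV in auto)
  qed
  also have "(\<Union>i. T i) = snd c ` fst c" unfolding T_def image_UN[symmetric] using un by (simp flip: Int_UN_distrib2 add: Int_commute)
  finally show ?thesis .
qed


text \<open>The radius depends only on \<open>G\<close>, and not on the bump function, which is chosen afterwards.\<close>

lemma bump_integral_nonzero:
  fixes G :: "'a::euclidean_space \<Rightarrow> complex"
  assumes V: "open V" "y0 \<in> V" and G: "continuous_on V G" "G y0 \<noteq> 0"
  obtains r where "r > 0" "cball y0 r \<subseteq> V"
    "\<And>\<phi> U. continuous_on UNIV \<phi> \<Longrightarrow> (\<And>y. \<phi> y \<ge> 0) \<Longrightarrow> (\<And>y. \<phi> y > 0 \<longleftrightarrow> y \<in> ball y0 r) \<Longrightarrow> V \<subseteq> U \<Longrightarrow>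
      set_integrable lborel U (\<lambda>y. \<phi> y *\<^sub>R G y) \<and> (LINT y:U|lborel. \<phi> y *\<^sub>R G y) \<noteq> 0"
proof -
  \<comment> \<open>Rotating by this phase makes the real part of the integrand positive near \<open>y0\<close>.\<close>
  define z where "z = cnj (G y0)"
  have cz: "continuous_on V (\<lambda>y. Re (z * G y))" using G by (intro continuous_intros)
  have "z * G y0 = of_real ((norm (G y0))\<^sup>2)"
    by (metis complex_norm_square mult.commute z_def)
  then have "Re (z * G y0) > 0" using G(2) by simp
  then have "open (V \<inter> (\<lambda>y. Re (z * G y)) -` {0<..})" "y0 \<in> V \<inter> (\<lambda>y. Re (z * G y)) -` {0<..}"
    using V continuous_open_preimage[OF cz V(1), of "{0<..}"] by auto
  then obtain r where r: "r > 0" "cball y0 r \<subseteq> V \<inter> (\<lambda>y. Re (z * G y)) -` {0<..}"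
    using open_contains_cball by blast
  show thesis
  proof
    show "r > 0" "cball y0 r \<subseteq> V" using r by auto
    fix \<phi> :: "'a \<Rightarrow> real" and U
    assume \<phi>: "continuous_on UNIV \<phi>" "\<And>y. \<phi> y \<ge> 0" "\<And>y. \<phi> y > 0 \<longleftrightarrow> y \<in> ball y0 r" and U: "V \<subseteq> U"
    have \<phi>0: "\<phi> y = 0" if "y \<notin> ball y0 r" for y using \<phi>(2,3)[of y] that by auto
    have bU: "y \<in> U" "Re (z * G y) > 0" if "y \<in> ball y0 r" for y
    proof -
      have "y \<in> cball y0 r" using that by simp
      then show "y \<in> U" "Re (z * G y) > 0" using r(2) U by blast+
    qed
    have "continuous_on (cball y0 r) (\<lambda>y. \<phi> y *\<^sub>R G y)"
    proof (intro continuous_intros)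
      show "continuous_on (cball y0 r) \<phi>" using \<phi>(1) continuous_on_subset by blast
      show "continuous_on (cball y0 r) G" using G(1) r(2) by (meson continuous_on_subset le_inf_iff)
    qed
    then have "integrable lborel (\<lambda>y. indicator (cball y0 r) y *\<^sub>R (\<phi> y *\<^sub>R G y))"
      by (intro borel_integrable_compact) auto
    moreover have eq: "indicator (cball y0 r) y *\<^sub>R (\<phi> y *\<^sub>R G y) = indicator U y *\<^sub>R (\<phi> y *\<^sub>R G y)" for y
      using \<phi>0[of y] bU(1)[of y] by (cases "y \<in> ball y0 r") (auto simp: indicator_def)
    ultimately have int: "integrable lborel (\<lambda>y. indicator U y *\<^sub>R (\<phi> y *\<^sub>R G y))" by (simp only:)
    let ?h = "\<lambda>y. Re (z * (indicator U y *\<^sub>R (\<phi> y *\<^sub>R G y)))"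
    have h: "?h y = \<phi> y * Re (z * G y)" for y
      using \<phi>0[of y] bU(1)[of y] by (cases "y \<in> ball y0 r") (auto simp: indicator_def algebra_simps)
    have pos: "?h y > 0" if "y \<in> ball y0 r" for y
      unfolding h using that \<phi>(3)[of y] bU(2)[OF that] by (intro mult_pos_pos) blast+
    have hnn: "?h y \<ge> 0" for y
      using pos[of y] \<phi>0[of y] unfolding h by (cases "y \<in> ball y0 r") auto
    have inth: "integrable lborel ?h" using int by (intro integrable_Re integrable_mult_right)
    have "(LINT y:U|lborel. \<phi> y *\<^sub>R G y) \<noteq> 0"
    proof
      assume "(LINT y:U|lborel. \<phi> y *\<^sub>R G y) = 0"
      then have "(LINT y|lborel. indicator U y *\<^sub>R (\<phi> y *\<^sub>R G y)) = 0"
        by (simp only: set_lebesgue_integral_def)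
      moreover have "(LINT y|lborel. ?h y) = Re (z * (LINT y|lborel. indicator U y *\<^sub>R (\<phi> y *\<^sub>R G y)))"
        by (simp only: integral_Re[OF integrable_mult_right[OF int]] integral_mult_right_zero)
      ultimately have "(LINT y|lborel. ?h y) = 0" by (simp only: mult_zero_right zero_complex.sel)
      then have "AE y in lborel. ?h y = 0"
        using integral_nonneg_eq_0_iff_AE[OF inth] hnn by simp
      then have "AE y in lborel. y \<notin> ball y0 r"
      proof eventually_elim
        case (elim y)
        then show ?case using pos[of y] by fastforce
      qed
      then have "ball y0 r \<in> null_sets lborel" by (subst AE_iff_null_sets) auto
      then have "measure lborel (ball y0 r) = 0" by (simp add: null_sets_def measure_def)
      then show False using content_ball_pos[OF r(1), of y0] by simp
    qed
    then show "set_integrable lborel U (\<lambda>y. \<phi> y *\<^sub>R G y) \<and> (LINT y:U|lborel. \<phi> y *\<^sub>R G y) \<noteq> 0"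
      using int unfolding set_integrable_def by blast
  qed
qed

section \<open>Curvature of Hermitian connections\<close>

lemma smooth_fun_on_subset: "smooth_fun_on A U h \<Longrightarrow> U' \<subseteq> U \<Longrightarrow> smooth_fun_on A U' h"
  unfolding smooth_fun_on_def by (blast intro: smooth_on_subset)

lemma smooth_fun_on_cong:
  fixes A :: "('c::{t2_space, second_countable_topology}, 'e::euclidean_space) chart set"
  assumes A: "smooth_atlas A" and U: "open U" and eq: "\<And>x. x \<in> U \<Longrightarrow> h x = k x" and h: "smooth_fun_on A U h"
  shows "smooth_fun_on A U k"
  unfolding smooth_fun_on_def
proof
  fix c assume c: "c \<in> A"
  show "smooth_on (k \<circ> chart_inv c) (snd c ` (fst c \<inter> U))"
  proof (rule smooth_on_cong[OF chart_image_open[OF A c U]])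
    show "smooth_on (h \<circ> chart_inv c) (snd c ` (fst c \<inter> U))" using h c by (simp add: smooth_fun_on_def)
    show "(h \<circ> chart_inv c) w = (k \<circ> chart_inv c) w" if "w \<in> snd c ` (fst c \<inter> U)" for w
      using that chart_image_iff[OF A c, of w U] eq by simp
  qed
qed

lemma sections_subset: "s \<in> sections A E U \<Longrightarrow> U' \<subseteq> U \<Longrightarrow> s \<in> sections A E U'"
  unfolding sections_def by (auto intro!: smooth_fun_on_subset[of A "U \<inter> _" _ "U' \<inter> _"])

text \<open>The local section that has the constant value one in the trivialisation \<open>\<tau>\<close>; only its values over the
  domain of \<open>\<tau>\<close> matter.\<close>

definition unit_section :: "('c, 'l) line_bundle \<Rightarrow> ('l \<Rightarrow> complex) \<Rightarrow> 'c \<Rightarrow> 'l" where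
  "unit_section E \<tau> y = (SOME u. proj E u = y \<and> \<tau> u = 1)"

text \<open>The connection form of \<open>D\<close> in the trivialisation \<open>\<tau>\<close>.\<close>

definition conn_form ::
  "('c, 'l) line_bundle \<Rightarrow> (('c \<Rightarrow> 'l) \<Rightarrow> 'c \<Rightarrow> 'e \<Rightarrow> 'l) \<Rightarrow> ('l \<Rightarrow> complex) \<Rightarrow> 'c \<Rightarrow> 'e \<Rightarrow> complex" where
  "conn_form E D \<tau> y X = \<tau> (D (unit_section E \<tau>) y X)"

text \<open>The component of the connection form along the coordinate vector field \<open>X\<close> of the chart \<open>c\<close>, as a
  function of the coordinates.\<close>

definition conn_coord ::
  "('c, 'e::euclidean_space) chart set \<Rightarrow> ('c, 'l) line_bundle \<Rightarrow> (('c \<Rightarrow> 'l) \<Rightarrow> 'c \<Rightarrow> 'e \<Rightarrow> 'l) \<Rightarrow>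
   ('l \<Rightarrow> complex) \<Rightarrow> ('c, 'e) chart \<Rightarrow> 'e \<Rightarrow> 'e \<Rightarrow> complex" where
  "conn_coord A E D \<tau> c X w = conn_form E D \<tau> (chart_inv c w) (coord_vec A c (chart_inv c w) X)"

text \<open>The exterior derivative of the connection form, computed in the chart \<open>c\<close>, on the coordinate vectors
  \<open>a\<close> and \<open>b\<close>.\<close>

definition curv_coord ::
  "('c, 'e::euclidean_space) chart set \<Rightarrow> ('c, 'l) line_bundle \<Rightarrow> (('c \<Rightarrow> 'l) \<Rightarrow> 'c \<Rightarrow> 'e \<Rightarrow> 'l) \<Rightarrow>
   ('l \<Rightarrow> complex) \<Rightarrow> ('c, 'e) chart \<Rightarrow> 'c \<Rightarrow> 'e \<Rightarrow> 'e \<Rightarrow> complex" where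
  "curv_coord A E D \<tau> c x a b =
     frechet_derivative (conn_coord A E D \<tau> c b) (at (snd c x)) a -
     frechet_derivative (conn_coord A E D \<tau> c a) (at (snd c x)) b"

context
  fixes A :: "('c::{t2_space, second_countable_topology}, 'e::euclidean_space) chart set"
    and E :: "('c, 'l) line_bundle"
  assumes A: "smooth_atlas A" and E: "hermitian_line_bundle A E"
begin

lemma triv_open: "(V, \<tau>) \<in> trivs E \<Longrightarrow> open V"
  using E by (auto simp: hermitian_line_bundle_def)

lemma triv_bij: "(V, \<tau>) \<in> trivs E \<Longrightarrow> x \<in> V \<Longrightarrow> bij_betw \<tau> {u. proj E u = x} UNIV"
  using E by (auto simp: hermitian_line_bundle_def)

lemma triv_inj:
  "(V, \<tau>) \<in> trivs E \<Longrightarrow> proj E u \<in> V \<Longrightarrow> proj E w = proj E u \<Longrightarrow> \<tau> w = \<tau> u \<Longrightarrow> w = u"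
  using triv_bij[of V \<tau> "proj E u"] unfolding bij_betw_def inj_on_def by blast

lemma triv_surj:
  assumes "(V, \<tau>) \<in> trivs E" "x \<in> V"
  obtains u where "proj E u = x" "\<tau> u = z"
proof -
  have "z \<in> \<tau> ` {u. proj E u = x}" using triv_bij[OF assms] by (simp add: bij_betw_def)
  then show ?thesis using that by auto
qed

lemma triv_cover: obtains V \<tau> where "(V, \<tau>) \<in> trivs E" "x \<in> V"
proof -
  have "(\<Union>(V, \<tau>)\<in>trivs E. V) = UNIV" using E by (simp add: hermitian_line_bundle_def)
  then have "x \<in> (\<Union>(V, \<tau>)\<in>trivs E. V)" by simp
  then show ?thesis using that by auto
qed

lemma triv_transition:
  assumes "(V, \<tau>) \<in> trivs E" "(W, \<sigma>) \<in> trivs E"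
  obtains g where "smooth_fun_on A (V \<inter> W) g" "\<And>x. x \<in> V \<inter> W \<Longrightarrow> g x \<noteq> 0"
    "\<And>u. proj E u \<in> V \<inter> W \<Longrightarrow> \<sigma> u = g (proj E u) * \<tau> u"
proof -
  note 1 = bspec[OF E[unfolded hermitian_line_bundle_def, THEN conjunct2, THEN conjunct2, THEN conjunct1]
      assms(1), unfolded prod.case]
  show ?thesis using bspec[OF 1 assms(2), unfolded prod.case] that by blast
qed

lemma bundle_scale:
  "proj E (bundle_scale E z u) = proj E u"
  "(V, \<tau>) \<in> trivs E \<Longrightarrow> proj E u \<in> V \<Longrightarrow> \<tau> (bundle_scale E z u) = z * \<tau> u"
proof -
  obtain V0 \<tau>0 where t0: "(V0, \<tau>0) \<in> trivs E" "proj E u \<in> V0" using triv_cover .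
  obtain w where w: "proj E w = proj E u" "\<tau>0 w = z * \<tau>0 u" using triv_surj[OF t0] .
  let ?P = "\<lambda>w. proj E w = proj E u \<and> (\<forall>(V, \<tau>)\<in>trivs E. proj E u \<in> V \<longrightarrow> \<tau> w = z * \<tau> u)"
  have "?P w"
  proof (intro conjI ballI, rule w(1), clarify)
    fix V \<tau> assume t: "(V, \<tau>) \<in> trivs E" "proj E u \<in> V"
    obtain g where "\<And>u. proj E u \<in> V0 \<inter> V \<Longrightarrow> \<tau> u = g (proj E u) * \<tau>0 u"
      using triv_transition[OF t0(1) t(1)] by metis
    then show "\<tau> w = z * \<tau> u" using w t t0 by simp
  qed
  \<comment> \<open>The transition functions are linear on fibres, so one trivialisation determines all of them.\<close>
  moreover have "w' = w" if "?P w'" for w'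
    using triv_inj[OF t0(1), of w w'] that w t0 by auto
  ultimately have "?P (bundle_scale E z u)"
    unfolding bundle_scale_def by (rule theI)
  then show "proj E (bundle_scale E z u) = proj E u"
    "(V, \<tau>) \<in> trivs E \<Longrightarrow> proj E u \<in> V \<Longrightarrow> \<tau> (bundle_scale E z u) = z * \<tau> u" by auto
qed

lemma bundle_add:
  assumes uv: "proj E v = proj E u"
  shows "proj E (bundle_add E u v) = proj E u"
  "(V, \<tau>) \<in> trivs E \<Longrightarrow> proj E u \<in> V \<Longrightarrow> \<tau> (bundle_add E u v) = \<tau> u + \<tau> v"
proof -
  obtain V0 \<tau>0 where t0: "(V0, \<tau>0) \<in> trivs E" "proj E u \<in> V0" using triv_cover .
  obtain w where w: "proj E w = proj E u" "\<tau>0 w = \<tau>0 u + \<tau>0 v" using triv_surj[OF t0] .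
  let ?P = "\<lambda>w. proj E w = proj E u \<and> (\<forall>(V, \<tau>)\<in>trivs E. proj E u \<in> V \<longrightarrow> \<tau> w = \<tau> u + \<tau> v)"
  have "?P w"
  proof (intro conjI ballI, rule w(1), clarify)
    fix V \<tau> assume t: "(V, \<tau>) \<in> trivs E" "proj E u \<in> V"
    obtain g where "\<And>u. proj E u \<in> V0 \<inter> V \<Longrightarrow> \<tau> u = g (proj E u) * \<tau>0 u"
      using triv_transition[OF t0(1) t(1)] by metis
    then show "\<tau> w = \<tau> u + \<tau> v" using w t t0 uv by (simp add: distrib_left)
  qed
  moreover have "w' = w" if "?P w'" for w'
    using triv_inj[OF t0(1), of w w'] that w t0 by auto
  ultimately have "?P (bundle_add E u v)"
    unfolding bundle_add_def by (rule theI)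
  then show "proj E (bundle_add E u v) = proj E u"
    "(V, \<tau>) \<in> trivs E \<Longrightarrow> proj E u \<in> V \<Longrightarrow> \<tau> (bundle_add E u v) = \<tau> u + \<tau> v" by auto
qed

lemma unit_section:
  assumes "(V, \<tau>) \<in> trivs E" "x \<in> V"
  shows "proj E (unit_section E \<tau> x) = x" "\<tau> (unit_section E \<tau> x) = 1"
proof -
  have "\<exists>u. proj E u = x \<and> \<tau> u = 1" using triv_surj[OF assms] by metis
  from someI_ex[OF this] show "proj E (unit_section E \<tau> x) = x" "\<tau> (unit_section E \<tau> x) = 1"
    by (auto simp: unit_section_def)
qed

lemma unit_section_smooth:
  assumes t: "(V, \<tau>) \<in> trivs E"
  shows "unit_section E \<tau> \<in> sections A E V"
  unfolding sections_def
proof (intro CollectI conjI ballI, rule unit_section(1)[OF t], assumption, clarify)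
  fix W \<sigma> assume w: "(W, \<sigma>) \<in> trivs E"
  obtain g where g: "smooth_fun_on A (V \<inter> W) g" "\<And>u. proj E u \<in> V \<inter> W \<Longrightarrow> \<sigma> u = g (proj E u) * \<tau> u"
    using triv_transition[OF t w] by metis
  show "smooth_fun_on A (V \<inter> W) (\<sigma> \<circ> unit_section E \<tau>)"
  proof (rule smooth_fun_on_cong[OF A _ _ g(1)])
    show "open (V \<inter> W)" using triv_open t w by blast
    show "g x = (\<sigma> \<circ> unit_section E \<tau>) x" if "x \<in> V \<inter> W" for x
      using g(2)[of "unit_section E \<tau> x"] unit_section[OF t, of x] that by simp
  qed
qed

lemma sections_cong:
  assumes "open U" "s \<in> sections A E U" "\<And>x. x \<in> U \<Longrightarrow> s x = s' x"
  shows "s' \<in> sections A E U"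
  unfolding sections_def
proof (intro CollectI conjI ballI, goal_cases)
  case (1 x) then show ?case using assms by (auto simp: sections_def)
next
  case (2 p)
  then obtain V \<tau> where p: "p = (V, \<tau>)" "(V, \<tau>) \<in> trivs E" by (cases p) auto
  have "smooth_fun_on A (U \<inter> V) (\<tau> \<circ> s')"
    by (rule smooth_fun_on_cong[OF A, of _ "\<tau> \<circ> s"])
      (use assms p triv_open[OF p(2)] in \<open>auto simp: sections_def\<close>)
  then show ?case by (simp add: p)
qed

lemma sections_proj: "s \<in> sections A E U \<Longrightarrow> x \<in> U \<Longrightarrow> proj E (s x) = x"
  by (auto simp: sections_def)

lemma sections_smooth: "s \<in> sections A E U \<Longrightarrow> (V, \<tau>) \<in> trivs E \<Longrightarrow> smooth_fun_on A (U \<inter> V) (\<tau> \<circ> s)"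
  by (auto simp: sections_def)

context
  fixes D :: "('c \<Rightarrow> 'l) \<Rightarrow> 'c \<Rightarrow> 'e \<Rightarrow> 'l"
  assumes D: "D \<in> hermitian_connections A E"
begin

lemma connD:
  assumes "open U" "s \<in> sections A E U"
  shows conn_proj: "x \<in> U \<Longrightarrow> proj E (D s x X) = x"
    and conn_linear: "x \<in> U \<Longrightarrow>
      D s x (r *\<^sub>R X + Y) = bundle_add E (bundle_scale E (of_real r) (D s x X)) (D s x Y)"
    and conn_local: "t \<in> sections A E U \<Longrightarrow> (\<And>x. x \<in> U \<Longrightarrow> s x = t x) \<Longrightarrow> x \<in> U \<Longrightarrow> D s x X = D t x X"
    and conn_leibniz: "smooth_fun_on A U h \<Longrightarrow> x \<in> U \<Longrightarrow>
      D (\<lambda>y. bundle_scale E (h y) (s y)) x X =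
          bundle_add E (bundle_scale E (fun_deriv A h x X) (s x)) (bundle_scale E (h x) (D s x X))"
    and conn_smooth: "c \<in> A \<Longrightarrow> (\<lambda>x. D s x (coord_vec A c x X)) \<in> sections A E (U \<inter> fst c)"
proof -
  note C = bspec[OF mp[OF spec[OF D[unfolded hermitian_connections_def mem_Collect_eq], of U] assms(1)] assms(2)]
  note C2 = C[THEN conjunct2] note C3 = C2[THEN conjunct2] note C4 = C3[THEN conjunct2]
  note C5 = C4[THEN conjunct2] note C6 = C5[THEN conjunct2] note C7 = C6[THEN conjunct2]
  show "x \<in> U \<Longrightarrow> proj E (D s x X) = x" using C[THEN conjunct1] by simp
  show "x \<in> U \<Longrightarrow>
      D s x (r *\<^sub>R X + Y) = bundle_add E (bundle_scale E (of_real r) (D s x X)) (D s x Y)"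
    using C2[THEN conjunct1] by simp
  show "t \<in> sections A E U \<Longrightarrow> (\<And>x. x \<in> U \<Longrightarrow> s x = t x) \<Longrightarrow> x \<in> U \<Longrightarrow> D s x X = D t x X"
    using C3[THEN conjunct1] by simp
  show "smooth_fun_on A U h \<Longrightarrow> x \<in> U \<Longrightarrow>
      D (\<lambda>y. bundle_scale E (h y) (s y)) x X =
          bundle_add E (bundle_scale E (fun_deriv A h x X) (s x)) (bundle_scale E (h x) (D s x X))"
    using C5[THEN conjunct1] by simp
  show "c \<in> A \<Longrightarrow> (\<lambda>x. D s x (coord_vec A c x X)) \<in> sections A E (U \<inter> fst c)"
    using C7 by simp
qed

context
  fixes V :: "'c set" and \<tau> :: "'l \<Rightarrow> complex"
  assumes t: "(V, \<tau>) \<in> trivs E"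
begin

lemma conn_form_linear:
  assumes x: "x \<in> V"
  shows "linear (conn_form E D \<tau> x)"
proof -
  have V: "open V" using triv_open t by blast
  note e = unit_section_smooth[OF t]
  have 1: "conn_form E D \<tau> x (r *\<^sub>R X + Y) = of_real r * conn_form E D \<tau> x X + conn_form E D \<tau> x Y" for r X Y
    unfolding conn_form_def conn_linear[OF V e x]
    using bundle_add(2)[OF _ t] bundle_scale(1) bundle_scale(2)[OF t] conn_proj[OF V e x] t x by simp
  have 0: "conn_form E D \<tau> x 0 = 0" using 1[of 1 0 0] by simp
  show ?thesis
    using 1[of 1] 1[of _ _ 0] 0 by (intro linearI) (simp_all add: scaleR_conv_of_real)
qed

lemma conn_coord_smooth:
  assumes c: "c \<in> A"
  shows "smooth_on (conn_coord A E D \<tau> c X) (snd c ` (fst c \<inter> V))"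
proof -
  have V: "open V" using triv_open t by blast
  have "smooth_fun_on A (V \<inter> fst c \<inter> V) (\<tau> \<circ> (\<lambda>x. D (unit_section E \<tau>) x (coord_vec A c x X)))"
    by (rule sections_smooth[OF conn_smooth[OF V unit_section_smooth[OF t] c] t])
  then have "smooth_on ((\<tau> \<circ> (\<lambda>x. D (unit_section E \<tau>) x (coord_vec A c x X))) \<circ> chart_inv c)
      (snd c ` (fst c \<inter> (V \<inter> fst c \<inter> V)))"
    using c by (simp add: smooth_fun_on_def)
  moreover have "fst c \<inter> (V \<inter> fst c \<inter> V) = fst c \<inter> V" by auto
  ultimately show ?thesis by (simp add: conn_coord_def[abs_def] conn_form_def o_def)
qed

lemma conn_coord_expand:
  assumes c: "c \<in> A" and w: "w \<in> snd c ` (fst c \<inter> V)"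
  shows "conn_coord A E D \<tau> c X w = (\<Sum>i\<in>Basis. (X \<bullet> i) *\<^sub>R conn_coord A E D \<tau> c i w)"
proof -
  let ?x = "chart_inv c w"
  have x: "?x \<in> fst c" "?x \<in> V" using w chart_inv_left[OF A c] by auto
  show ?thesis unfolding conn_coord_def
    using linear_basis_expand[OF linear_compose[OF coord_vec_linear[OF A c x(1)] conn_form_linear[OF x(2)]], of X]
    by (simp add: o_def)
qed

text \<open>\<open>D (h e) = dh e + h D e\<close> for the unit section \<open>e\<close>; locality reduces the given section to this form.\<close>

lemma conn_trivialized:
  assumes U: "open U" and s: "s \<in> sections A E U" and x: "x \<in> U" "x \<in> V"
  shows "\<tau> (D s x X) = fun_deriv A (\<tau> \<circ> s) x X + \<tau> (s x) * conn_form E D \<tau> x X"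
proof -
  let ?U = "U \<inter> V" and ?h = "\<tau> \<circ> s" and ?e = "unit_section E \<tau>"
  have U': "open ?U" using triv_open[OF t] U by blast
  have s': "s \<in> sections A E ?U" by (rule sections_subset[OF s]) auto
  have e: "?e \<in> sections A E ?U" by (rule sections_subset[OF unit_section_smooth[OF t]]) auto
  have h: "smooth_fun_on A ?U ?h" by (rule sections_smooth[OF s t])
  have xU: "x \<in> ?U" using x by simp
  have eq: "s y = bundle_scale E (?h y) (?e y)" if "y \<in> ?U" for y
    using that bundle_scale(1)[of "?h y" "?e y"] bundle_scale(2)[OF t, of "?e y" "?h y"] unit_section[OF t, of y] sections_proj[OF s', of y]
    by (intro triv_inj[OF t]) auto
  have "D s x X = D (\<lambda>y. bundle_scale E (?h y) (?e y)) x X"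
    by (rule conn_local[OF U' s' sections_cong[OF U' s' eq] eq xU])
  also have "\<dots> = bundle_add E (bundle_scale E (fun_deriv A ?h x X) (?e x)) (bundle_scale E (?h x) (D ?e x X))"
    by (rule conn_leibniz[OF U' e h xU])
  also have "\<tau> \<dots> = fun_deriv A ?h x X * \<tau> (?e x) + ?h x * \<tau> (D ?e x X)"
    using bundle_add(2)[OF _ t] bundle_scale(1) bundle_scale(2)[OF t] unit_section[OF t x(2)] x conn_proj[OF U' e xU] by simp
  finally show ?thesis using unit_section[OF t x(2)] by (simp add: conn_form_def o_def)
qed

lemma conn_coord_section:
  assumes U: "open U" and s: "s \<in> sections A E U" and x: "x \<in> U" "x \<in> V" and c: "c \<in> A" "x \<in> fst c"
  shows "\<tau> (D s x (coord_vec A c x b)) =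
    frechet_derivative (\<tau> \<circ> s \<circ> chart_inv c) (at (snd c x)) b + \<tau> (s x) * conn_coord A E D \<tau> c b (snd c x)"
proof -
  have "smooth_on (\<tau> \<circ> s \<circ> chart_inv c) (snd c ` (fst c \<inter> (U \<inter> V)))"
    using sections_smooth[OF s t] c by (simp add: smooth_fun_on_def)
  then have "(\<tau> \<circ> s \<circ> chart_inv c) differentiable (at (snd c x))"
    using x c by (intro smooth_on_differentiable) auto
  from fun_deriv_coord_vec[OF A c this]
  show ?thesis using conn_trivialized[OF U s x] by (simp add: conn_coord_def chart_inv_left[OF A c])
qed

lemma conn_second_derivative:
  assumes U: "open U" and s: "s \<in> sections A E U" and x: "x \<in> U" "x \<in> V" and c: "c \<in> A" "x \<in> fst c"
  defines "H \<equiv> \<tau> \<circ> s \<circ> chart_inv c"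
  shows "\<tau> (D (\<lambda>y. D s y (coord_vec A c y b)) x (coord_vec A c x a)) =
     frechet_derivative (\<lambda>w. frechet_derivative H (at w) b) (at (snd c x)) a
     + frechet_derivative H (at (snd c x)) a * conn_coord A E D \<tau> c b (snd c x)
     + \<tau> (s x) * frechet_derivative (conn_coord A E D \<tau> c b) (at (snd c x)) a
     + (frechet_derivative H (at (snd c x)) b + \<tau> (s x) * conn_coord A E D \<tau> c b (snd c x))
        * conn_coord A E D \<tau> c a (snd c x)"
proof -
  let ?W = "snd c ` (fst c \<inter> (U \<inter> V))" and ?w = "snd c x" and ?T = "conn_coord A E D \<tau> c"
  let ?s = "\<lambda>y. D s y (coord_vec A c y b)"
  have W: "open ?W" using chart_image_open[OF A c(1)] triv_open[OF t] U by blast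
  have w: "?w \<in> ?W" using x c by auto
  have H: "smooth_on H ?W"
    using sections_smooth[OF s t] c by (simp add: smooth_fun_on_def H_def)
  have T: "smooth_on (?T b) ?W" by (rule smooth_on_subset[OF conn_coord_smooth[OF c(1)]]) auto
  have Hx: "H ?w = \<tau> (s x)" using chart_inv_left[OF A c] by (simp add: H_def)
  have sU: "?s \<in> sections A E (U \<inter> fst c)" by (rule conn_smooth[OF U s c(1)])
  have oU: "open (U \<inter> fst c)" using U chart_dom_open[OF A c(1)] by blast
  have loc: "(\<tau> \<circ> ?s \<circ> chart_inv c) w = frechet_derivative H (at w) b + H w * ?T b w" if "w \<in> ?W" for w
  proof -
    obtain y where y: "y \<in> fst c" "y \<in> U" "y \<in> V" "w = snd c y" using \<open>w \<in> ?W\<close> by auto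
    show ?thesis
      using conn_coord_section[OF U s y(2,3) c(1) y(1)] chart_inv_left[OF A c(1) y(1)]
      by (simp add: H_def y(4))
  qed
  have "((\<lambda>w. frechet_derivative H (at w) b + H w * ?T b w) has_derivative
     (\<lambda>a. frechet_derivative (\<lambda>w. frechet_derivative H (at w) b) (at ?w) a
       + (H ?w * frechet_derivative (?T b) (at ?w) a + frechet_derivative H (at ?w) a * ?T b ?w))) (at ?w)"
    by (intro has_derivative_add has_derivative_mult smooth_on_has_derivative[OF H w]
        smooth_on_has_derivative[OF T w] smooth_on_has_derivative[OF smooth_on_deriv[OF H] w])
  then have "((\<tau> \<circ> ?s \<circ> chart_inv c) has_derivative
     (\<lambda>a. frechet_derivative (\<lambda>w. frechet_derivative H (at w) b) (at ?w) a
       + (H ?w * frechet_derivative (?T b) (at ?w) a + frechet_derivative H (at ?w) a * ?T b ?w))) (at ?w)"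
    by (rule has_derivative_transform_within_open[OF _ W w]) (rule loc[symmetric])
  from frechet_derivative_at[OF this, symmetric]
  have d: "frechet_derivative (\<tau> \<circ> ?s \<circ> chart_inv c) (at ?w) a =
     frechet_derivative (\<lambda>w. frechet_derivative H (at w) b) (at ?w) a
       + (H ?w * frechet_derivative (?T b) (at ?w) a + frechet_derivative H (at ?w) a * ?T b ?w)"
    by simp
  have "\<tau> (?s x) = frechet_derivative H (at ?w) b + \<tau> (s x) * ?T b ?w"
    using conn_coord_section[OF U s x c] by (simp add: H_def)
  with conn_coord_section[OF oU sU _ x(2) c, of a] d Hx show ?thesis
    using x c by (simp add: algebra_simps)
qed

text \<open>Of the second covariant derivative of \<open>h e\<close> only the terms symmetric in \<open>a\<close> and \<open>b\<close> contain derivatives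
  of \<open>h\<close>, so the commutator is multiplication by the exterior derivative of the connection form.\<close>

lemma curvature_eq:
  assumes x: "x \<in> V"
  shows "curvature A E D x [a, b] = curv_coord A E D \<tau> (chart_at A x) x a b"
proof -
  let ?c = "chart_at A x"
  have c: "?c \<in> A" "x \<in> fst ?c" using chart_at_in[OF A] by auto
  let ?R = "\<lambda>s. bundle_add E (D (\<lambda>y. D s y (coord_vec A ?c y b)) x a)
           (bundle_scale E (- 1) (D (\<lambda>y. D s y (coord_vec A ?c y a)) x b))"
  have R: "proj E (?R s) = x" "\<tau> (?R s) = \<tau> (s x) * curv_coord A E D \<tau> ?c x a b"
    if U: "open U" "x \<in> U" "s \<in> sections A E U" for U s
  proof -
    have oU: "open (U \<inter> fst ?c)" using U chart_dom_open[OF A c(1)] by blast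
    have sm: "smooth_on (\<tau> \<circ> s \<circ> chart_inv ?c) (snd ?c ` (fst ?c \<inter> (U \<inter> V)))"
      using sections_smooth[OF U(3) t] c by (simp add: smooth_fun_on_def)
    have o: "open (snd ?c ` (fst ?c \<inter> (U \<inter> V)))"
      using chart_image_open[OF A c(1)] triv_open[OF t] U by blast
    have p: "proj E (D (\<lambda>y. D s y (coord_vec A ?c y b)) x a) = x" for a b
      by (rule conn_proj[OF oU conn_smooth[OF U(1,3) c(1)]]) (use U c in auto)
    show "proj E (?R s) = x" using bundle_add(1) bundle_scale(1) p by simp
    have "\<tau> (?R s) = \<tau> (D (\<lambda>y. D s y (coord_vec A ?c y b)) x a) - \<tau> (D (\<lambda>y. D s y (coord_vec A ?c y a)) x b)"
      using bundle_add(2)[OF _ t] bundle_scale(1) bundle_scale(2)[OF t] p x by simp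
    also have "\<dots> = \<tau> (s x) * curv_coord A E D \<tau> ?c x a b"
      using conn_second_derivative[OF U(1,3,2) x c, of b a] conn_second_derivative[OF U(1,3,2) x c, of a b]
        second_derivative_symmetric[OF o _ sm, of "snd ?c x" a b] U x c
      by (simp add: coord_vec_chart_at[OF A] curv_coord_def algebra_simps)
    finally show "\<tau> (?R s) = \<tau> (s x) * curv_coord A E D \<tau> ?c x a b" .
  qed
  show ?thesis
    unfolding curvature_def Let_def
  proof (rule the_equality)
    show "\<forall>U s. open U \<and> x \<in> U \<and> s \<in> sections A E U \<longrightarrow>
       bundle_scale E (curv_coord A E D \<tau> ?c x a b) (s x) =
         bundle_add E (D (\<lambda>y. D s y (coord_vec A ?c y ([a, b] ! 1))) x ([a, b] ! 0))
           (bundle_scale E (- 1) (D (\<lambda>y. D s y (coord_vec A ?c y ([a, b] ! 0))) x ([a, b] ! 1)))"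
    proof (intro allI impI, elim conjE)
      fix U s assume U: "open U" "x \<in> U" "s \<in> sections A E U"
      have "bundle_scale E (curv_coord A E D \<tau> ?c x a b) (s x) = ?R s"
        by (rule triv_inj[OF t]) (use R[OF U] x bundle_scale(1) bundle_scale(2)[OF t] sections_proj[OF U(3,2)] in auto)
      then show "bundle_scale E (curv_coord A E D \<tau> ?c x a b) (s x) =
         bundle_add E (D (\<lambda>y. D s y (coord_vec A ?c y ([a, b] ! 1))) x ([a, b] ! 0))
           (bundle_scale E (- 1) (D (\<lambda>y. D s y (coord_vec A ?c y ([a, b] ! 0))) x ([a, b] ! 1)))"
        by simp
    qed
  next
    \<comment> \<open>The unit section is nonzero at \<open>x\<close>, so it determines the factor.\<close>
    fix z assume "\<forall>U s. open U \<and> x \<in> U \<and> s \<in> sections A E U \<longrightarrow>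
       bundle_scale E z (s x) =
         bundle_add E (D (\<lambda>y. D s y (coord_vec A ?c y ([a, b] ! 1))) x ([a, b] ! 0))
           (bundle_scale E (- 1) (D (\<lambda>y. D s y (coord_vec A ?c y ([a, b] ! 0))) x ([a, b] ! 1)))"
    from spec[OF spec[OF this, of V], of "unit_section E \<tau>"]
    have z: "bundle_scale E z (unit_section E \<tau> x) = ?R (unit_section E \<tau>)"
      using triv_open[OF t] x unit_section_smooth[OF t] by simp
    show "z = curv_coord A E D \<tau> ?c x a b"
      using arg_cong[OF z, of \<tau>] R(2)[OF triv_open[OF t] x unit_section_smooth[OF t]]
        bundle_scale(2)[OF t] unit_section[OF t x] x by simp
  qed
qed

lemma conn_coord_deriv_linear:
  assumes x: "x \<in> V" and c: "c \<in> A" "x \<in> fst c"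
  shows "frechet_derivative (conn_coord A E D \<tau> c X) (at (snd c x)) a =
    (\<Sum>i\<in>Basis. (X \<bullet> i) *\<^sub>R frechet_derivative (conn_coord A E D \<tau> c i) (at (snd c x)) a)"
proof -
  let ?W = "snd c ` (fst c \<inter> V)" and ?T = "conn_coord A E D \<tau> c"
  have W: "open ?W" using chart_image_open[OF A c(1)] triv_open[OF t] by blast
  have w: "snd c x \<in> ?W" using x c by auto
  have "((\<lambda>w. \<Sum>i\<in>Basis. (X \<bullet> i) *\<^sub>R ?T i w) has_derivative
     (\<lambda>a. \<Sum>i\<in>Basis. (X \<bullet> i) *\<^sub>R frechet_derivative (?T i) (at (snd c x)) a)) (at (snd c x))"
    by (intro has_derivative_sum has_derivative_scaleR_right smooth_on_has_derivative[OF conn_coord_smooth[OF c(1)] w])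
  then have "(?T X has_derivative
     (\<lambda>a. \<Sum>i\<in>Basis. (X \<bullet> i) *\<^sub>R frechet_derivative (?T i) (at (snd c x)) a)) (at (snd c x))"
    by (rule has_derivative_transform_within_open[OF _ W w]) (simp add: conn_coord_expand[OF c(1), of _ X])
  from frechet_derivative_at[OF this, symmetric] show ?thesis by simp
qed

lemma curv_coord_bilinear:
  assumes x: "x \<in> V" and c: "c \<in> A" "x \<in> fst c"
  shows "linear (\<lambda>a. curv_coord A E D \<tau> c x a b)" "linear (\<lambda>b. curv_coord A E D \<tau> c x a b)"
proof -
  have w: "snd c x \<in> snd c ` (fst c \<inter> V)" using x c by auto
  have l1: "linear (frechet_derivative (conn_coord A E D \<tau> c X) (at (snd c x)))" for X
    by (rule has_derivative_linear[OF smooth_on_has_derivative[OF conn_coord_smooth[OF c(1)] w]])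
  have l2: "linear (\<lambda>X. frechet_derivative (conn_coord A E D \<tau> c X) (at (snd c x)) a)" for a
  proof -
    have "(\<lambda>X. frechet_derivative (conn_coord A E D \<tau> c X) (at (snd c x)) a) =
      (\<lambda>X. \<Sum>i\<in>Basis. (X \<bullet> i) *\<^sub>R frechet_derivative (conn_coord A E D \<tau> c i) (at (snd c x)) a)"
      by (rule ext) (rule conn_coord_deriv_linear[OF x c])
    moreover have "linear (\<lambda>X. \<Sum>i\<in>Basis. (X \<bullet> i) *\<^sub>R frechet_derivative (conn_coord A E D \<tau> c i) (at (snd c x)) a)"
      by (intro linear_compose_sum ballI scaleR_linear bounded_linear.linear[OF bounded_linear_inner_left])
    ultimately show ?thesis by (simp only:)
  qed
  show "linear (\<lambda>a. curv_coord A E D \<tau> c x a b)" "linear (\<lambda>b. curv_coord A E D \<tau> c x a b)"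
    unfolding curv_coord_def by (intro linear_compose_sub l1 l2)+
qed

text \<open>Naturality of the exterior derivative: the second derivatives of the transition map cancel by symmetry.\<close>

lemma curv_coord_change:
  assumes x: "x \<in> V" and c: "c \<in> A" "x \<in> fst c" and d: "d \<in> A" "x \<in> fst d"
  shows "curv_coord A E D \<tau> d x (jac c d x a) (jac c d x b) = curv_coord A E D \<tau> c x a b"
proof -
  let ?W = "snd c ` (fst c \<inter> (fst d \<inter> V))" and ?w = "snd c x"
  let ?T = "conn_coord A E D \<tau>" and ?\<phi> = "snd d \<circ> chart_inv c"
  let ?J = "\<lambda>b w. frechet_derivative ?\<phi> (at w) b"
  have W: "open ?W" using chart_image_open[OF A c(1)] triv_open[OF t] chart_dom_open[OF A d(1)] by blast
  have w: "?w \<in> ?W" using x c d by auto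
  have \<phi>: "smooth_on ?\<phi> ?W" by (rule smooth_on_subset[OF transition_smooth[OF A c(1) d(1)]]) auto
  have Jw: "?J v ?w = jac c d x v" for v by (simp add: jac_def)
  have \<phi>w: "?\<phi> ?w = snd d x" using chart_inv_left[OF A c] by simp
  have loc: "?T c b w = (\<Sum>i\<in>Basis. (?J b w \<bullet> i) *\<^sub>R ?T d i (?\<phi> w))" if "w \<in> ?W" for w b
  proof -
    obtain y where y: "y \<in> fst c" "y \<in> fst d" "y \<in> V" "w = snd c y" using \<open>w \<in> ?W\<close> by auto
    have i: "chart_inv c w = y" using chart_inv_left[OF A c(1) y(1)] y(4) by simp
    have "?T c b w = ?T d (jac c d y b) (snd d y)"
      unfolding conn_coord_def i chart_inv_left[OF A d(1) y(2)]
      using coord_vec_jac_eq[OF A c(1) d(1) y(1,2)] by simp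
    also have "\<dots> = (\<Sum>i\<in>Basis. (jac c d y b \<bullet> i) *\<^sub>R ?T d i (snd d y))"
      by (rule conn_coord_expand[OF d(1)]) (use y in auto)
    finally show ?thesis using i y by (simp add: jac_def)
  qed
  have dT: "((\<lambda>w. ?T d i (?\<phi> w)) has_derivative
      (\<lambda>a. frechet_derivative (?T d i) (at (snd d x)) (jac c d x a))) (at ?w)" for i
  proof -
    have "(?T d i has_derivative frechet_derivative (?T d i) (at (snd d x))) (at (?\<phi> ?w))"
      unfolding \<phi>w by (rule smooth_on_has_derivative[OF conn_coord_smooth[OF d(1)]]) (use x d in auto)
    from diff_chain_at[OF jac_has_derivative[OF A c(1) d(1) c(2) d(2)] this] show ?thesis by (simp add: o_def)
  qed
  have "frechet_derivative (?T c b) (at ?w) a =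
     (\<Sum>i\<in>Basis. (jac c d x b \<bullet> i) *\<^sub>R frechet_derivative (?T d i) (at (snd d x)) (jac c d x a)
       + (frechet_derivative (?J b) (at ?w) a \<bullet> i) *\<^sub>R ?T d i (snd d x))" for a b
  proof -
    have "((\<lambda>w. \<Sum>i\<in>Basis. (?J b w \<bullet> i) *\<^sub>R ?T d i (?\<phi> w)) has_derivative
       (\<lambda>a. \<Sum>i\<in>Basis. (?J b ?w \<bullet> i) *\<^sub>R frechet_derivative (?T d i) (at (snd d x)) (jac c d x a)
       + (frechet_derivative (?J b) (at ?w) a \<bullet> i) *\<^sub>R ?T d i (?\<phi> ?w))) (at ?w)"
      by (intro has_derivative_sum has_derivative_scaleR has_derivative_inner_left dT
          smooth_on_has_derivative[OF smooth_on_deriv[OF \<phi>] w])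
    then have "(?T c b has_derivative
       (\<lambda>a. \<Sum>i\<in>Basis. (?J b ?w \<bullet> i) *\<^sub>R frechet_derivative (?T d i) (at (snd d x)) (jac c d x a)
       + (frechet_derivative (?J b) (at ?w) a \<bullet> i) *\<^sub>R ?T d i (?\<phi> ?w))) (at ?w)"
      by (rule has_derivative_transform_within_open[OF _ W w]) (rule loc[symmetric])
    from frechet_derivative_at[OF this, symmetric] show ?thesis by (simp only: Jw \<phi>w)
  qed
  then have "frechet_derivative (?T c b) (at ?w) a =
     frechet_derivative (?T d (jac c d x b)) (at (snd d x)) (jac c d x a)
       + (\<Sum>i\<in>Basis. (frechet_derivative (?J b) (at ?w) a \<bullet> i) *\<^sub>R ?T d i (snd d x))" for a b
    by (simp only: conn_coord_deriv_linear[OF x d, of "jac c d x b"] sum.distrib)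
  then show ?thesis
    unfolding curv_coord_def
    using second_derivative_symmetric[OF W w \<phi>, of a b] by simp
qed

end

lemma curvature_alternating: "alternating 2 (curvature A E D x)"
proof -
  obtain V \<tau> where t: "(V, \<tau>) \<in> trivs E" "x \<in> V" using triv_cover .
  show ?thesis
    unfolding alternating2_iff curvature_eq[OF t]
    using curv_coord_bilinear[OF t chart_at_in[OF A]] by (simp add: curv_coord_def)
qed

lemma curvature_coord_continuous:
  assumes c: "c \<in> A"
  shows "continuous_on (snd c ` fst c) (\<lambda>w. coord_form A (curvature A E D) c w [X, Y])"
proof (rule continuous_at_imp_continuous_on, rule ballI)
  fix w assume "w \<in> snd c ` fst c"
  then obtain x where x: "x \<in> fst c" "w = snd c x" by auto
  obtain V \<tau> where t: "(V, \<tau>) \<in> trivs E" "x \<in> V" using triv_cover .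
  let ?W = "snd c ` (fst c \<inter> V)"
  let ?k = "\<lambda>w. frechet_derivative (conn_coord A E D \<tau> c Y) (at w) X
      - frechet_derivative (conn_coord A E D \<tau> c X) (at w) Y"
  have W: "open ?W" using chart_image_open[OF A c] triv_open[OF t(1)] by blast
  have "continuous_on ?W ?k"
    by (intro continuous_on_diff smooth_on_imp_continuous smooth_on_deriv conn_coord_smooth[OF t(1) c])
  moreover have "?k w = coord_form A (curvature A E D) c w [X, Y]" if "w \<in> ?W" for w
  proof -
    obtain y where y: "y \<in> fst c" "y \<in> V" "w = snd c y" using \<open>w \<in> ?W\<close> by auto
    show ?thesis
      using curv_coord_change[OF t(1) y(2) c y(1) chart_at_in[OF A, of y], of X Y]
      by (simp add: coord_form_def y(3) chart_inv_left[OF A c y(1)] curvature_eq[OF t(1) y(2)]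
          coord_vec_jac curv_coord_def)
  qed
  ultimately have "continuous_on ?W (\<lambda>w. coord_form A (curvature A E D) c w [X, Y])"
    using continuous_on_cong by (metis (no_types, lifting))
  then show "isCont (\<lambda>w. coord_form A (curvature A E D) c w [X, Y]) w"
    using continuous_on_eq_continuous_at[OF W] x t by blast
qed

end

end

section \<open>The cross product on \<open>\<real>\<^sup>7\<close> and coassociative four-planes\<close>

lemma UNIV_7: "(UNIV :: 7 set) = {0, 1, 2, 3, 4, 5, 6}"
  by (rule card_subset_eq[symmetric]) simp_all

lemma sum_UNIV_7: "(\<Sum>i\<in>UNIV. g (i::7)) = g 0 + g 1 + g 2 + g 3 + g 4 + g 5 + g 6"
  for g :: "7 \<Rightarrow> 'a::comm_monoid_add"
  unfolding UNIV_7 by (simp add: add.assoc)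

lemma inner_7: "x \<bullet> y = x$0 * y$0 + x$1 * y$1 + x$2 * y$2 + x$3 * y$3 + x$4 * y$4 + x$5 * y$5 + x$6 * y$6"
  for x y :: "real ^ 7"
  by (simp add: inner_vec_def sum_UNIV_7)

text \<open>The cross product determined by the model three-form and the standard inner product: its inner product
  with \<open>n\<close> is the value of the form on \<open>n, a, b\<close>.\<close>

definition cross7 :: "real ^ 7 \<Rightarrow> real ^ 7 \<Rightarrow> real ^ 7" where
  "cross7 a b = (\<chi> k. G2_form [axis k 1, a, b])"

text \<open>The components of the bivector of \<open>a\<close> and \<open>b\<close>; both the cross product and the dual form are linear in
  them.\<close>

definition minor2 :: "real ^ 'n \<Rightarrow> real ^ 'n \<Rightarrow> 'n::finite \<Rightarrow> 'n \<Rightarrow> real" where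
  "minor2 a b i j = a $ i * b $ j - b $ i * a $ j"

lemma minor2_antisym: "minor2 a b j i = - minor2 a b i j"
  by (simp add: minor2_def)

lemma minor2_sort_7:
  fixes a b :: "real ^ 7"
  shows "minor2 a b 1 0 = - minor2 a b 0 1" "minor2 a b 2 0 = - minor2 a b 0 2" "minor2 a b 3 0 = - minor2 a b 0 3"
    "minor2 a b 3 1 = - minor2 a b 1 3" "minor2 a b 4 0 = - minor2 a b 0 4" "minor2 a b 4 1 = - minor2 a b 1 4"
    "minor2 a b 4 2 = - minor2 a b 2 4" "minor2 a b 4 3 = - minor2 a b 3 4" "minor2 a b 5 0 = - minor2 a b 0 5"
    "minor2 a b 5 1 = - minor2 a b 1 5" "minor2 a b 5 2 = - minor2 a b 2 5" "minor2 a b 5 3 = - minor2 a b 3 5"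
    "minor2 a b 6 0 = - minor2 a b 0 6" "minor2 a b 6 1 = - minor2 a b 1 6" "minor2 a b 6 2 = - minor2 a b 2 6"
    "minor2 a b 6 3 = - minor2 a b 3 6" "minor2 a b 6 4 = - minor2 a b 4 6"
  by (rule minor2_antisym)+

lemma dx3_minor2: "dx [i, j, k] [n, a, b] =
    n $ i * minor2 a b j k - n $ j * minor2 a b i k + n $ k * minor2 a b i j"
  by (simp add: dx3_list minor2_def algebra_simps)

lemma dx4_minor2: "dx [i, j, k, l] [a, b, c, d] =
    minor2 a b i j * minor2 c d k l - minor2 a b i k * minor2 c d j l + minor2 a b i l * minor2 c d j k
    + minor2 a b j k * minor2 c d i l - minor2 a b j l * minor2 c d i k + minor2 a b k l * minor2 c d i j"
  by (simp add: dx4_list minor2_def algebra_simps)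

lemma cross7_components:
  defines "p \<equiv> minor2"
  shows "cross7 a b $ 0 = p a b 1 4 + p a b 2 5 + p a b 3 6"
    "cross7 a b $ 1 = - p a b 0 4 + p a b 3 5 - p a b 2 6"
    "cross7 a b $ 2 = - p a b 3 4 - p a b 0 5 + p a b 1 6"
    "cross7 a b $ 3 = p a b 2 4 - p a b 1 5 - p a b 0 6"
    "cross7 a b $ 4 = p a b 5 6 + p a b 0 1 - p a b 2 3"
    "cross7 a b $ 5 = - p a b 4 6 + p a b 0 2 + p a b 1 3"
    "cross7 a b $ 6 = p a b 4 5 + p a b 0 3 - p a b 1 2"
  unfolding p_def cross7_def
  by (simp_all add: G2_form_def dx3_minor2 axis_def minor2_sort_7)

lemma inner_cross7: "n \<bullet> cross7 a b = G2_form [n, a, b]"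
  by (simp add: inner_7 cross7_components G2_form_def dx3_minor2 minor2_sort_7
      algebra_simps)

lemma lagrange_identity_7: "(a \<bullet> c) * (b \<bullet> d) - (a \<bullet> d) * (b \<bullet> c) =
  minor2 a b 0 1 * minor2 c d 0 1 + minor2 a b 0 2 * minor2 c d 0 2 + minor2 a b 0 3 * minor2 c d 0 3
    + minor2 a b 0 4 * minor2 c d 0 4 + minor2 a b 0 5 * minor2 c d 0 5 + minor2 a b 0 6 * minor2 c d 0
    6 + minor2 a b 1 2 * minor2 c d 1 2 + minor2 a b 1 3 * minor2 c d 1 3 + minor2 a b 1 4 * minor2 c d
    1 4 + minor2 a b 1 5 * minor2 c d 1 5 + minor2 a b 1 6 * minor2 c d 1 6 + minor2 a b 2 3 * minor2 c
    d 2 3 + minor2 a b 2 4 * minor2 c d 2 4 + minor2 a b 2 5 * minor2 c d 2 5 + minor2 a b 2 6 * minor2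
    c d 2 6 + minor2 a b 3 4 * minor2 c d 3 4 + minor2 a b 3 5 * minor2 c d 3 5 + minor2 a b 3 6 *
    minor2 c d 3 6 + minor2 a b 4 5 * minor2 c d 4 5 + minor2 a b 4 6 * minor2 c d 4 6 + minor2 a b 5 6
    * minor2 c d 5 6"
  for a b c d :: "real ^ 7"
  unfolding inner_7 minor2_def by algebra

lemma inner_cross7_cross7: "cross7 a b \<bullet> cross7 c d =
  (a \<bullet> c) * (b \<bullet> d) - (a \<bullet> d) * (b \<bullet> c) + G2_dual_form [a, b, c, d]"
  unfolding lagrange_identity_7
  unfolding inner_7 cross7_components G2_dual_form_def dx4_minor2 minor2_sort_7
  by (simp add: algebra_simps)

lemma G2_form_alternating: "alternating 3 G2_form"
  unfolding alternating_def length_3_iff less_3_iff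
  by (auto simp: less_3_iff less_2_iff G2_form_def dx3_list algebra_simps intro!: linearI)

lemma cross7_antisym: "cross7 b a = - cross7 a b"
  unfolding cross7_def using alternating3_swap(2)[OF G2_form_alternating, of _ b a] by (simp add: vec_eq_iff)

lemma G2_dual_form_alternating: "alternating 4 G2_dual_form"
proof -
  note D = alternating4D[OF dx_alternating4]
  show ?thesis
    by (rule alternating4I) (simp_all add: G2_dual_form_def D linear_compose_add linear_compose_sub)
qed

lemma orthonormal_complete:
  fixes g :: "nat \<Rightarrow> 'a::euclidean_space"
  assumes g: "\<And>i j. i < DIM('a) \<Longrightarrow> j < DIM('a) \<Longrightarrow> g i \<bullet> g j = (if i = j then 1 else 0)"
    and x: "\<And>i. i < DIM('a) \<Longrightarrow> x \<bullet> g i = 0"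
  shows "x = 0"
proof (rule ccontr)
  assume x0: "x \<noteq> 0"
  let ?S = "g ` {..<DIM('a)}"
  have inj: "inj_on g {..<DIM('a)}"
  proof (rule inj_onI)
    fix i j assume "i \<in> {..<DIM('a)}" "j \<in> {..<DIM('a)}" "g i = g j"
    then show "i = j" using g[of i i] g[of i j] by (auto split: if_splits)
  qed
  have xS: "x \<notin> ?S"
  proof
    assume "x \<in> ?S"
    then obtain i where "i < DIM('a)" "x = g i" by auto
    then show False using x[of i] g[of i i] by simp
  qed
  have "pairwise orthogonal (insert x ?S)"
    using g x by (auto simp: pairwise_def orthogonal_def inner_commute)
  moreover have "0 \<notin> insert x ?S"
  proof
    assume "0 \<in> insert x ?S"
    then obtain i where "i < DIM('a)" "g i = 0" using x0 by auto
    then show False using g[of i i] by simp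
  qed
  ultimately have "independent (insert x ?S)" by (rule pairwise_orthogonal_independent)
  then have "card (insert x ?S) \<le> DIM('a)" using independent_bound by blast
  then show False using xS card_image[OF inj] by simp
qed

text \<open>For four orthonormal vectors on which the three-form vanishes, the products with \<open>u 0\<close> span the normal
  space, and \<open>u 2 \<times> u 3\<close> is orthogonal to two of them, hence a multiple of the third. The factor is the
  value of the dual form, so it has square one, and its sign is that of the orientation.\<close>

lemma coassociative_cross7_eq:
  assumes on: "\<And>i j. i < 4 \<Longrightarrow> j < 4 \<Longrightarrow> u i \<bullet> u j = (if i = j then 1 else 0)"
    and co: "\<And>i j k. i < 4 \<Longrightarrow> j < 4 \<Longrightarrow> k < 4 \<Longrightarrow> G2_form [u i, u j, u k] = 0"
    and pos: "G2_dual_form [u 0, u 1, u 2, u 3] > 0"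
  shows "cross7 (u 0) (u 1) = cross7 (u (2::nat)) (u 3)"
proof -
  note z = alternating4D(5-10)[OF G2_dual_form_alternating]
  note c = inner_cross7_cross7
  let ?n1 = "cross7 (u 0) (u 1)" and ?n2 = "cross7 (u 0) (u 2)" and ?n3 = "cross7 (u 0) (u 3)"
  let ?m = "cross7 (u 2) (u 3)"
  let ?s = "G2_dual_form [u 0, u 1, u 2, u 3]"
  have nn: "?n1 \<bullet> ?n1 = 1" "?n2 \<bullet> ?n2 = 1" "?n3 \<bullet> ?n3 = 1" "?n1 \<bullet> ?n2 = 0" "?n1 \<bullet> ?n3 = 0" "?n2 \<bullet> ?n3 = 0"
    "?m \<bullet> ?m = 1" "?m \<bullet> ?n2 = 0" "?m \<bullet> ?n3 = 0" "?n1 \<bullet> ?m = ?s"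
    by (simp_all add: c z on)
  have un: "u k \<bullet> cross7 (u i) (u j) = 0" if "i < 4" "j < 4" "k < 4" for i j k
    using co that by (simp add: inner_cross7)
  define g where "g i = (if i < 4 then u i else if i = 4 then ?n1 else if i = 5 then ?n2 else ?n3)" for i :: nat
  have D: "DIM(real ^ 7) = 7" by simp
  have gi: "i < 7 \<longleftrightarrow> i < 4 \<or> i = 4 \<or> i = 5 \<or> i = 6" for i :: nat by auto
  have "?m - ?s *\<^sub>R ?n1 = 0"
  proof (rule orthonormal_complete[of g])
    fix i j :: nat assume ij: "i < DIM(real ^ 7)" "j < DIM(real ^ 7)"
    then show "g i \<bullet> g j = (if i = j then 1 else 0)"
      unfolding D gi using nn un on by (auto simp: g_def inner_commute)
  next
    fix i :: nat assume "i < DIM(real ^ 7)"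
    then show "(?m - ?s *\<^sub>R ?n1) \<bullet> g i = 0"
      unfolding D gi using nn un by (auto simp: g_def inner_diff_left inner_commute)
  qed
  then have m: "?m = ?s *\<^sub>R ?n1" by simp
  have "?s * ?s = 1" using nn(1,7) unfolding m by simp
  then have "?s = 1" using pos by (metis abs_1 abs_mult_self_eq abs_of_pos abs_square_eq_1 power2_eq_square)
  then show ?thesis using m by simp
qed

section \<open>Self-duality in an oriented orthonormal frame\<close>

text \<open>Vectors on which the volume form does not vanish span, so a linear map is determined on them.\<close>

lemma dx_frame_linear_zero:
  fixes g :: "real ^ 4 \<Rightarrow> 'b::real_vector"
  assumes d: "dx [0, 1, 2, 3] [a, b, c, d] \<noteq> 0" and g: "linear g" "g a = 0" "g b = 0" "g c = 0" "g d = 0"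
  shows "g x = 0"
proof -
  define K :: "real ^ 4 \<Rightarrow> real ^ 4" where
    "K y = y $ 0 *\<^sub>R a + y $ 1 *\<^sub>R b + y $ 2 *\<^sub>R c + y $ 3 *\<^sub>R d" for y
  have K: "linear K" unfolding K_def by (intro linearI) (auto simp: algebra_simps)
  have "map K std_basis4 = [a, b, c, d]" by (simp add: std_basis4_def K_def axis_def)
  then have "det (matrix K) \<noteq> 0" using d by (simp add: det_eq_dx)
  then have "surj K" using det_nz_iff_inj[OF K] linear_injective_imp_surjective[OF K] by simp
  then obtain y where "x = K y" by (metis surjD)
  then show ?thesis using g by (simp add: K_def linear_add linear_scale)
qed

lemma oriented_onb_exists:
  fixes J :: "real ^ 4 \<Rightarrow> real ^ 7"
  assumes J: "linear J" "inj J"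
  shows "\<exists>b. oriented_onb (\<lambda>x y. J x \<bullet> J y) b"
proof -
  have sub: "subspace (range J)" using J(1) by (simp add: linear_subspace_image)
  obtain B where B: "B \<subseteq> range J" "pairwise orthogonal B" "\<And>x. x \<in> B \<Longrightarrow> norm x = 1"
    "independent B" "card B = dim (range J)" "span B = range J"
    using orthonormal_basis_subspace[OF sub] by metis
  have "dim (range J) = 4" using dim_image_eq[OF J(1), of UNIV] J(2) by (simp add: dim_UNIV)
  then have card: "card B = 4" using B by simp
  obtain ws where ws: "set ws = B" "distinct ws"
    using finite_distinct_list[of B] independent_imp_finite[OF B(4)] by auto
  have len: "length ws = 4" using ws card distinct_card by fastforce
  define bs where "bs = map (inv J) ws"
  have J_bs: "J (bs ! i) = ws ! i" if "i < 4" for i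
    using that len ws(1) B(1) f_inv_into_f[of "ws ! i" J UNIV] nth_mem[of i ws] by (auto simp: bs_def)
  have on: "J (bs ! i) \<bullet> J (bs ! j) = (if i = j then 1 else 0)" if "i < 4" "j < 4" for i j
  proof (cases "i = j")
    case True
    then show ?thesis using B(3)[of "ws ! i"] nth_mem[of i ws] ws(1) len that J_bs by (simp add: dot_square_norm)
  next
    case False
    then have "ws ! i \<noteq> ws ! j" using ws(2) len that by (simp add: nth_eq_iff_index_eq)
    then show ?thesis using B(2) nth_mem[of i ws] nth_mem[of j ws] ws(1) len that False J_bs
      by (auto simp: pairwise_def orthogonal_def)
  qed
  obtain b0 b1 b2 b3 where bs: "bs = [b0, b1, b2, b3]"
    using len by (auto simp: length_4_iff bs_def)
  have o: "J b0 \<bullet> J b0 = 1" "J b1 \<bullet> J b1 = 1" "J b2 \<bullet> J b2 = 1" "J b3 \<bullet> J b3 = 1"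
    "J b0 \<bullet> J b1 = 0" "J b0 \<bullet> J b2 = 0" "J b0 \<bullet> J b3 = 0" "J b1 \<bullet> J b2 = 0" "J b1 \<bullet> J b3 = 0" "J b2 \<bullet> J b3 = 0"
    using on[of 0 0] on[of 1 1] on[of 2 2] on[of 3 3] on[of 0 1] on[of 0 2] on[of 0 3] on[of 1 2] on[of 1 3] on[of 2 3]
    by (simp_all add: bs)
  define K :: "real ^ 4 \<Rightarrow> real ^ 4" where
    "K y = y $ 0 *\<^sub>R b0 + y $ 1 *\<^sub>R b1 + y $ 2 *\<^sub>R b2 + y $ 3 *\<^sub>R b3" for y
  have K: "linear K" unfolding K_def by (intro linearI) (auto simp: algebra_simps)
  have sq: "J (K y) \<bullet> J (K y) = (y $ 0)\<^sup>2 + (y $ 1)\<^sup>2 + (y $ 2)\<^sup>2 + (y $ 3)\<^sup>2" for y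
    by (simp add: K_def linear_add[OF J(1)] linear_scale[OF J(1)] inner_add_left inner_add_right o
        inner_commute[of "J b1" "J b0"] inner_commute[of "J b2" "J b0"] inner_commute[of "J b3" "J b0"]
        inner_commute[of "J b2" "J b1"] inner_commute[of "J b3" "J b1"] inner_commute[of "J b3" "J b2"] power2_eq_square)
  have "y = 0" if "K y = 0" for y
  proof -
    have "(y $ 0)\<^sup>2 + (y $ 1)\<^sup>2 + (y $ 2)\<^sup>2 + (y $ 3)\<^sup>2 = 0"
      using sq[of y] that linear_0[OF J(1)] by simp
    then show ?thesis by (simp add: add_nonneg_eq_0_iff vec_eq_iff all_4)
  qed
  then have "inj K" using K by (simp add: linear_injective_0)
  then have "det (matrix K) \<noteq> 0" using det_nz_iff_inj[OF K] by simp
  moreover have "map K std_basis4 = [b0, b1, b2, b3]" by (simp add: std_basis4_def K_def axis_def)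
  ultimately have nz: "dx [0, 1, 2, 3] [b0, b1, b2, b3] \<noteq> 0" by (simp add: det_eq_dx)
  have neg: "dx [0, 1, 2, 3] [- b0, b1, b2, b3] = - dx [0, 1, 2, 3] [b0, b1, b2, b3]"
    using linear_neg[OF alternating4D(1)[OF dx_alternating4]] by fastforce
  \<comment> \<open>If the orthonormal frame has the wrong orientation, the sign of one vector is changed.\<close>
  show ?thesis
  proof (cases "dx [0, 1, 2, 3] [b0, b1, b2, b3] > 0")
    case True
    then have "oriented_onb (\<lambda>x y. J x \<bullet> J y) [b0, b1, b2, b3]"
      unfolding oriented_onb_def less_4_iff using o by (auto simp: inner_commute)
    then show ?thesis by blast
  next
    case False
    then have "oriented_onb (\<lambda>x y. J x \<bullet> J y) [- b0, b1, b2, b3]"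
      unfolding oriented_onb_def less_4_iff using o nz neg by (auto simp: inner_commute linear_neg[OF J(1)])
    then show ?thesis by blast
  qed
qed

text \<open>The star operator refers to a chosen frame, which enters as a hypothesis so that its vectors can be
  named.\<close>

lemma hodge2_frame:
  fixes F :: "(real ^ 4) list \<Rightarrow> 'b::real_vector"
  assumes F: "alternating 2 F" and b: "(SOME b. oriented_onb h b) = [b0, b1, b2, b3]"
  defines "\<delta> \<equiv> dx [0, 1, 2, 3]"
  shows "hodge2 h F [x, y] = (1 / \<delta> [b0, b1, b2, b3]) *\<^sub>R
    (\<delta> [b0, b1, x, y] *\<^sub>R F [b0, b1] + \<delta> [b0, b2, x, y] *\<^sub>R F [b0, b2] + \<delta> [b0, b3, x, y] *\<^sub>R F [b0, b3]
     + \<delta> [b1, b2, x, y] *\<^sub>R F [b1, b2] + \<delta> [b1, b3, x, y] *\<^sub>R F [b1, b3] + \<delta> [b2, b3, x, y] *\<^sub>R F [b2, b3])"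
proof -
  have \<delta>: "alternating 4 \<delta>" unfolding \<delta>_def by (rule dx_alternating4)
  note z = alternating4D(5)[OF \<delta>] and sw = alternating4_swap(1)[OF \<delta>]
  have s: "\<delta> [b1, b0, x, y] = - \<delta> [b0, b1, x, y]" "\<delta> [b2, b0, x, y] = - \<delta> [b0, b2, x, y]"
    "\<delta> [b3, b0, x, y] = - \<delta> [b0, b3, x, y]" "\<delta> [b2, b1, x, y] = - \<delta> [b1, b2, x, y]"
    "\<delta> [b3, b1, x, y] = - \<delta> [b1, b3, x, y]" "\<delta> [b3, b2, x, y] = - \<delta> [b2, b3, x, y]"
    by (rule sw)+
  have sF: "F [b1, b0] = - F [b0, b1]" "F [b2, b0] = - F [b0, b2]" "F [b3, b0] = - F [b0, b3]"
    "F [b2, b1] = - F [b1, b2]" "F [b3, b1] = - F [b1, b3]" "F [b3, b2] = - F [b2, b3]"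
    by (rule alternating2_swap[OF F])+
  have half: "(1 / 2) *\<^sub>R (u + u) = u" for u :: 'b by (simp flip: scaleR_2)
  have "{..<4::nat} = {0, 1, 2, 3}" by auto
  then have "hodge2 h F [x, y] = (1 / 2) *\<^sub>R
    (let S = (\<delta> [b0, b1, x, y] / \<delta> [b0, b1, b2, b3]) *\<^sub>R F [b0, b1] + (\<delta> [b0, b2, x, y] / \<delta> [b0, b1, b2, b3]) *\<^sub>R F [b0, b2]
     + (\<delta> [b0, b3, x, y] / \<delta> [b0, b1, b2, b3]) *\<^sub>R F [b0, b3] + (\<delta> [b1, b2, x, y] / \<delta> [b0, b1, b2, b3]) *\<^sub>R F [b1, b2]
     + (\<delta> [b1, b3, x, y] / \<delta> [b0, b1, b2, b3]) *\<^sub>R F [b1, b3] + (\<delta> [b2, b3, x, y] / \<delta> [b0, b1, b2, b3]) *\<^sub>R F [b2, b3]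
     in S + S)"
    unfolding hodge2_def b Let_def \<delta>_def[symmetric] by (simp add: z s sF ac_simps)
  then show ?thesis unfolding Let_def half by (simp add: scaleR_add_right)
qed

lemma self_dual_part_eq_0_iff:
  fixes F :: "(real ^ 4) list \<Rightarrow> 'b::real_vector"
  assumes F: "alternating 2 F" and b: "(SOME b. oriented_onb h b) = [b0, b1, b2, b3]"
    and on: "oriented_onb h [b0, b1, b2, b3]"
  shows "(\<forall>us. length us = 2 \<longrightarrow> self_dual_part h F us = 0) \<longleftrightarrow>
    F [b0, b1] + F [b2, b3] = 0 \<and> F [b0, b2] + F [b3, b1] = 0 \<and> F [b0, b3] + F [b1, b2] = 0"
    (is "?L \<longleftrightarrow> ?R")
proof -
  define \<delta> :: "(real ^ 4) list \<Rightarrow> real" where "\<delta> = dx [0, 1, 2, 3]"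
  have \<delta>: "alternating 4 \<delta>" unfolding \<delta>_def by (rule dx_alternating4)
  have pos: "\<delta> [b0, b1, b2, b3] > 0" using on by (simp add: oriented_onb_def \<delta>_def)
  note z = alternating4D(5-10)[OF \<delta>] and l = alternating4D(1-4)[OF \<delta>] and sw = alternating4_swap[OF \<delta>]
  note H = hodge2_frame[OF F b, folded \<delta>_def]
  have perm: "\<delta> [b0, b2, b1, b3] = - \<delta> [b0, b1, b2, b3]" "\<delta> [b1, b2, b0, b3] = \<delta> [b0, b1, b2, b3]"
    "\<delta> [b0, b3, b1, b2] = \<delta> [b0, b1, b2, b3]" "\<delta> [b1, b3, b0, b2] = - \<delta> [b0, b1, b2, b3]"
    "\<delta> [b2, b3, b0, b1] = \<delta> [b0, b1, b2, b3]"
    using sw(2)[of b0 b2 b1 b3] sw(2)[of b1 b2 b0 b3] sw(1)[of b1 b0 b2 b3]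
      sw(2)[of b0 b3 b1 b2] sw(3)[of b0 b1 b3 b2] sw(2)[of b1 b3 b0 b2] sw(1)[of b1 b0 b3 b2]
      sw(2)[of b2 b3 b0 b1] sw(1)[of b2 b0 b3 b1] sw(3)[of b0 b2 b3 b1]  sw(1)[of b3 b0 b2 b1]
    by (simp_all add: sw(2)[of b0 b2 b1 b3] sw(2)[of b0 b3 b1 b2] sw(3)[of b0 b2 b3 b1])
  have sF: "F [b3, b1] = - F [b1, b3]" "F [b2, b1] = - F [b1, b2]" by (rule alternating2_swap[OF F])+
  have fr: "self_dual_part h F [b0, b1] = (1 / 2) *\<^sub>R (F [b0, b1] + F [b2, b3])"
    "self_dual_part h F [b2, b3] = (1 / 2) *\<^sub>R (F [b0, b1] + F [b2, b3])"
    "self_dual_part h F [b0, b2] = (1 / 2) *\<^sub>R (F [b0, b2] + F [b3, b1])"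
    "self_dual_part h F [b1, b3] = - (1 / 2) *\<^sub>R (F [b0, b2] + F [b3, b1])"
    "self_dual_part h F [b0, b3] = (1 / 2) *\<^sub>R (F [b0, b3] + F [b1, b2])"
    "self_dual_part h F [b1, b2] = (1 / 2) *\<^sub>R (F [b0, b3] + F [b1, b2])"
    using pos by (simp_all add: self_dual_part_def H z perm sF algebra_simps)
  show ?thesis
  proof
    assume ?L
    then have "self_dual_part h F [b0, b1] = 0" "self_dual_part h F [b0, b2] = 0" "self_dual_part h F [b0, b3] = 0"
      by auto
    then show ?R unfolding fr by simp
  next
    assume R: ?R
    have Fl: "linear (\<lambda>X. F [X, a])" "linear (\<lambda>X. F [a, X])" "F [a, a] = 0" for a
      using F by (auto simp: alternating2_iff)
    have alt: "alternating 2 (self_dual_part h F)"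
    proof -
      have "self_dual_part h F [x, y] = (1 / 2) *\<^sub>R (F [x, y] + (1 / \<delta> [b0, b1, b2, b3]) *\<^sub>R
        (\<delta> [b0, b1, x, y] *\<^sub>R F [b0, b1] + \<delta> [b0, b2, x, y] *\<^sub>R F [b0, b2] + \<delta> [b0, b3, x, y] *\<^sub>R F [b0, b3]
         + \<delta> [b1, b2, x, y] *\<^sub>R F [b1, b2] + \<delta> [b1, b3, x, y] *\<^sub>R F [b1, b3] + \<delta> [b2, b3, x, y] *\<^sub>R F [b2, b3]))"
        for x y by (simp only: self_dual_part_def H)
      then show ?thesis
        by (simp only: alternating2_iff) (simp add: scaleR_linear linear_compose_add Fl l z)
    qed
    have S: "linear (\<lambda>X. self_dual_part h F [X, a])" "linear (\<lambda>X. self_dual_part h F [a, X])"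
      "self_dual_part h F [a, a] = 0" for a
      using alt by (auto simp: alternating2_iff)
    have nz: "dx [0, 1, 2, 3] [b0, b1, b2, b3] \<noteq> 0" using pos by (simp add: \<delta>_def)
    have 0: "self_dual_part h F [b0, b1] = 0" "self_dual_part h F [b2, b3] = 0" "self_dual_part h F [b0, b2] = 0"
      "self_dual_part h F [b1, b3] = 0" "self_dual_part h F [b0, b3] = 0" "self_dual_part h F [b1, b2] = 0"
      unfolding fr using R by simp_all
    have 1: "self_dual_part h F [b1, b0] = 0" "self_dual_part h F [b3, b2] = 0" "self_dual_part h F [b2, b0] = 0"
      "self_dual_part h F [b3, b1] = 0" "self_dual_part h F [b3, b0] = 0" "self_dual_part h F [b2, b1] = 0"
      using 0 alternating2_swap[OF alt] by (metis neg_equal_0_iff_equal)+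
    have "self_dual_part h F [c, y] = 0"
      if "self_dual_part h F [c, b0] = 0" "self_dual_part h F [c, b1] = 0"
        "self_dual_part h F [c, b2] = 0" "self_dual_part h F [c, b3] = 0" for c y
      by (rule dx_frame_linear_zero[OF nz S(2) that])
    then have "self_dual_part h F [b0, y] = 0" "self_dual_part h F [b1, y] = 0"
      "self_dual_part h F [b2, y] = 0" "self_dual_part h F [b3, y] = 0" for y
      using 0 1 S(3) by simp_all
    then have "self_dual_part h F [x, y] = 0" for x y
      by (rule dx_frame_linear_zero[OF nz S(1)])
    then show ?L by (auto simp: length_2_iff)
  qed
qed


lemma alternating_contract: "alternating 3 \<alpha> \<Longrightarrow> alternating 2 (\<lambda>vs. \<alpha> (u # vs))"
  unfolding alternating2_iff using alternating3D by blast

text \<open>Here \<open>J\<close> is the differential of the immersion followed by adapted coordinates, so that its image is the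
  tangent four-plane as a subspace of the model space. For the direction from right to left, \<open>u\<close> runs through
  the three normal vectors \<open>w 0 \<times> w i\<close>, which isolate the three self-dual components of \<open>F\<close>.\<close>

lemma self_dual_part_eq_0_iff_wedge:
  fixes J :: "real ^ 4 \<Rightarrow> real ^ 7" and F :: "(real ^ 4) list \<Rightarrow> 'b::real_vector"
  assumes J: "linear J" "inj J" and F: "alternating 2 F"
    and co: "\<And>a b c. G2_form [J a, J b, J c] = 0"
    and cal: "G2_dual_form (map J std_basis4) > 0"
  shows "(\<forall>us. length us = 2 \<longrightarrow> self_dual_part (\<lambda>a b. J a \<bullet> J b) F us = 0) \<longleftrightarrow>
    (\<forall>u vs. length vs = 4 \<longrightarrow> wedge 2 2 (\<lambda>vs. G2_form (u # map J vs)) F vs = 0)"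
proof -
  let ?h = "\<lambda>a b. J a \<bullet> J b"
  let ?\<alpha> = "\<lambda>u vs. G2_form (u # map J vs)"
  obtain b0 b1 b2 b3 where b: "(SOME b. oriented_onb ?h b) = [b0, b1, b2, b3]"
    and on: "oriented_onb ?h [b0, b1, b2, b3]"
  proof -
    have "oriented_onb ?h (SOME b. oriented_onb ?h b)" by (rule someI_ex[OF oriented_onb_exists[OF J]])
    moreover from this have "length (SOME b. oriented_onb ?h b) = 4" by (simp add: oriented_onb_def)
    ultimately show ?thesis using that by (metis length_4_iff)
  qed
  have pos: "dx [0, 1, 2, 3] [b0, b1, b2, b3] > 0" using on by (simp add: oriented_onb_def)
  define w where "w i = J ([b0, b1, b2, b3] ! i)" for i
  have ww: "w i \<bullet> w j = (if i = j then 1 else 0)" if "i < 4" "j < 4" for i j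
    using on that by (simp add: oriented_onb_def w_def)
  have wco: "G2_form [w i, w j, w k] = 0" for i j k unfolding w_def by (rule co)
  have w: "J b0 = w 0" "J b1 = w 1" "J b2 = w 2" "J b3 = w 3" by (simp_all add: w_def)
  have "G2_dual_form (map J [b0, b1, b2, b3]) =
      dx [0, 1, 2, 3] [b0, b1, b2, b3] *\<^sub>R G2_dual_form (map J std_basis4)"
    by (rule top_form_eq[OF alternating_map_linear[OF G2_dual_form_alternating J(1)]]) simp
  then have p1: "G2_dual_form [w 0, w 1, w 2, w 3] > 0" using pos cal by (simp add: w)
  note sw = alternating4_swap[OF G2_dual_form_alternating]
  \<comment> \<open>Even permutations of the last three vectors keep the orientation.\<close>
  have p2: "G2_dual_form [w 0, w 2, w 3, w 1] > 0" and p3: "G2_dual_form [w 0, w 3, w 1, w 2] > 0"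
    using p1 sw(3)[of "w 0" "w 2" "w 3" "w 1"] sw(2)[of "w 0" "w 2" "w 1" "w 3"]
      sw(2)[of "w 0" "w 3" "w 1" "w 2"] sw(3)[of "w 0" "w 1" "w 3" "w 2"] by simp_all
  have n1: "cross7 (w 2) (w 3) = cross7 (w 0) (w 1)"
    using coassociative_cross7_eq[of w] ww wco p1 by simp
  have n2: "cross7 (w 3) (w 1) = cross7 (w 0) (w 2)"
  proof -
    let ?u = "\<lambda>i. w ([0, 2, 3, 1] ! i)"
    have "cross7 (?u 0) (?u 1) = cross7 (?u 2) (?u 3)"
    proof (rule coassociative_cross7_eq)
      show "?u i \<bullet> ?u j = (if i = j then 1 else 0)" if "i < 4" "j < 4" for i j
        using that unfolding less_4_iff by (auto simp: ww)
    qed (use wco p2 in simp_all)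
    then show ?thesis by simp
  qed
  have n3: "cross7 (w 1) (w 2) = cross7 (w 0) (w 3)"
  proof -
    let ?u = "\<lambda>i. w ([0, 3, 1, 2] ! i)"
    have "cross7 (?u 0) (?u 1) = cross7 (?u 2) (?u 3)"
    proof (rule coassociative_cross7_eq)
      show "?u i \<bullet> ?u j = (if i = j then 1 else 0)" if "i < 4" "j < 4" for i j
        using that unfolding less_4_iff by (auto simp: ww)
    qed (use wco p3 in simp_all)
    then show ?thesis by simp
  qed
  have alt: "alternating 2 (?\<alpha> u)" for u
    by (rule alternating_map_linear[OF alternating_contract[OF G2_form_alternating] J(1)])
  have W: "alternating 4 (wedge 2 2 (?\<alpha> u) F)" for u by (rule wedge22_alternating[OF alt F])
  have wb: "wedge 2 2 (?\<alpha> u) F [b0, b1, b2, b3] = (u \<bullet> cross7 (w 0) (w 1)) *\<^sub>R (F [b0, b1] + F [b2, b3])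
     + (u \<bullet> cross7 (w 0) (w 2)) *\<^sub>R (F [b0, b2] + F [b3, b1])
     + (u \<bullet> cross7 (w 0) (w 3)) *\<^sub>R (F [b0, b3] + F [b1, b2])" for u
  proof -
    have "?\<alpha> u [b1, b3] = - (u \<bullet> cross7 (w 0) (w 2))"
      by (simp del: One_nat_def add: w inner_cross7[symmetric] cross7_antisym[of "w 1" "w 3"] n2)
    moreover have "F [b1, b3] = - F [b3, b1]" by (rule alternating2_swap[OF F])
    ultimately show ?thesis
      by (simp del: One_nat_def add: wedge22_list[OF alt F] w inner_cross7[symmetric] n1 n3 algebra_simps)
  qed
  have nn: "cross7 (w 0) (w 1) \<bullet> cross7 (w 0) (w 1) = 1" "cross7 (w 0) (w 2) \<bullet> cross7 (w 0) (w 2) = 1"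
    "cross7 (w 0) (w 3) \<bullet> cross7 (w 0) (w 3) = 1" "cross7 (w 0) (w 1) \<bullet> cross7 (w 0) (w 2) = 0"
    "cross7 (w 0) (w 1) \<bullet> cross7 (w 0) (w 3) = 0" "cross7 (w 0) (w 2) \<bullet> cross7 (w 0) (w 3) = 0"
    by (simp_all add: inner_cross7_cross7 ww alternating4D(5-10)[OF G2_dual_form_alternating])
  have R: "(\<forall>u vs. length vs = 4 \<longrightarrow> wedge 2 2 (?\<alpha> u) F vs = 0) \<longleftrightarrow>
      (\<forall>u. wedge 2 2 (?\<alpha> u) F [b0, b1, b2, b3] = 0)" (is "?L \<longleftrightarrow> ?R")
  proof
    assume R: ?R
    have "wedge 2 2 (?\<alpha> u) F std_basis4 = 0" for u
      using R top_form_eq[OF W, of "[b0, b1, b2, b3]" u] pos by simp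
    then show ?L using top_form_eq[OF W] by (metis scaleR_zero_right)
  qed simp
  show ?thesis unfolding self_dual_part_eq_0_iff[OF F b on] R wb
  proof
    assume *: "\<forall>u. (u \<bullet> cross7 (w 0) (w 1)) *\<^sub>R (F [b0, b1] + F [b2, b3])
       + (u \<bullet> cross7 (w 0) (w 2)) *\<^sub>R (F [b0, b2] + F [b3, b1])
       + (u \<bullet> cross7 (w 0) (w 3)) *\<^sub>R (F [b0, b3] + F [b1, b2]) = 0"
    show "F [b0, b1] + F [b2, b3] = 0 \<and> F [b0, b2] + F [b3, b1] = 0 \<and> F [b0, b3] + F [b1, b2] = 0"
      using spec[OF *, of "cross7 (w 0) (w 1)"] spec[OF *, of "cross7 (w 0) (w 2)"] spec[OF *, of "cross7 (w 0) (w 3)"]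
      by (simp del: One_nat_def add: nn inner_commute[of "cross7 (w 0) (w 2)" "cross7 (w 0) (w 1)"]
          inner_commute[of "cross7 (w 0) (w 3)" "cross7 (w 0) (w 1)"]
          inner_commute[of "cross7 (w 0) (w 3)" "cross7 (w 0) (w 2)"])
  qed simp
qed

section \<open>Compactly supported variations\<close>

lemma alternating_add:
  "alternating k \<alpha> \<Longrightarrow> alternating k \<beta> \<Longrightarrow> alternating k (\<lambda>vs. \<alpha> vs + \<beta> vs)"
  unfolding alternating_def by (auto intro: linear_compose_add)

lemma alternating1_iff: "alternating 1 \<beta> \<longleftrightarrow> linear (\<lambda>X. \<beta> [X])"
proof -
  have "length vs = 1 \<longleftrightarrow> (\<exists>a. vs = [a])" for vs :: "'a list" by (auto simp: length_Suc_conv)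
  then show ?thesis by (auto simp: alternating_def)
qed

lemma alternating3_expand:
  fixes \<alpha> :: "'e::euclidean_space list \<Rightarrow> 'b::real_vector"
  assumes "alternating 3 \<alpha>"
  shows "\<alpha> [a, b, c] = (\<Sum>i\<in>Basis. (a \<bullet> i) *\<^sub>R (\<Sum>j\<in>Basis. (b \<bullet> j) *\<^sub>R (\<Sum>k\<in>Basis. (c \<bullet> k) *\<^sub>R \<alpha> [i, j, k])))"
proof -
  note l = alternating3D(1-3)[OF assms]
  have "\<alpha> [a, b, c] = (\<Sum>i\<in>Basis. (a \<bullet> i) *\<^sub>R \<alpha> [i, b, c])" by (rule linear_basis_expand[OF l(1)])
  also have "\<dots> = (\<Sum>i\<in>Basis. (a \<bullet> i) *\<^sub>R (\<Sum>j\<in>Basis. (b \<bullet> j) *\<^sub>R \<alpha> [i, j, c]))"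
    by (intro sum.cong refl arg_cong2[where f = scaleR] linear_basis_expand[OF l(2)])
  also have "\<dots> = (\<Sum>i\<in>Basis. (a \<bullet> i) *\<^sub>R (\<Sum>j\<in>Basis. (b \<bullet> j) *\<^sub>R (\<Sum>k\<in>Basis. (c \<bullet> k) *\<^sub>R \<alpha> [i, j, k])))"
    by (intro sum.cong refl arg_cong2[where f = scaleR] linear_basis_expand[OF l(3)])
  finally show ?thesis .
qed

lemma form_integral_zero:
  assumes "\<And>x vs. length vs = 4 \<Longrightarrow> \<omega> x vs = 0"
  shows "form_integral A \<omega> = 0"
proof -
  have "coord_form A \<omega> c y std_basis4 = 0" for c y
    unfolding coord_form_def by (rule assms) (simp add: std_basis4_def)
  then show ?thesis unfolding form_integral_def by (simp add: Let_def split: prod.split)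
qed

text \<open>The function \<open>\<phi>\<close> of the coordinates in the chart \<open>c\<close>, carried over to the manifold and extended by
  zero, is smooth with support in the compact subset \<open>K\<close> of \<open>N\<close>; smoothness of the extension needs \<open>N\<close> to lie
  in the domain of \<open>c\<close>, which is arranged where the notion is used.\<close>

definition is_bump ::
  "('c::topological_space, 'e::euclidean_space) chart \<Rightarrow> 'c set \<Rightarrow> ('e \<Rightarrow> real) \<Rightarrow> 'c set \<Rightarrow> bool" where
  "is_bump c N \<phi> K \<longleftrightarrow> smooth_on \<phi> UNIV \<and> compact K \<and> K \<subseteq> N \<and> (\<forall>x\<in>fst c. x \<notin> K \<longrightarrow> \<phi> (snd c x) = 0)"

text \<open>For a function \<open>G\<close> of the coordinates that is continuous and nonzero at a point there is a bump function
  \<open>\<phi>\<close> such that every top form with coordinate expression \<open>\<phi> G\<close>, extended by zero, has nonzero integral.\<close>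

lemma bump_form_integral_nonzero:
  fixes A :: "('c::{t2_space, second_countable_topology}, real ^ 4) chart set"
    and G :: "real ^ 4 \<Rightarrow> complex"
  assumes A: "oriented_atlas A" and c: "c \<in> A" and V: "open V" "w0 \<in> V" "V \<subseteq> snd c ` fst c"
    and G: "continuous_on V G" "G w0 \<noteq> 0"
  obtains \<phi> K where "is_bump c (chart_inv c ` V) \<phi> K"
    "\<And>\<omega>. (\<And>x. alternating 4 (\<omega> x)) \<Longrightarrow> (\<And>x vs. x \<notin> fst c \<Longrightarrow> length vs = 4 \<Longrightarrow> \<omega> x vs = 0) \<Longrightarrow>
      (\<And>x. x \<in> fst c \<Longrightarrow> coord_form A \<omega> c (snd c x) std_basis4 = \<phi> (snd c x) *\<^sub>R G (snd c x)) \<Longrightarrow>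
      form_integral A \<omega> \<noteq> 0"
proof -
  have SA: "smooth_atlas A" using A by (simp add: oriented_atlas_def)
  obtain r where r: "r > 0" "cball w0 r \<subseteq> V" and
    I: "\<And>\<phi> U. continuous_on UNIV \<phi> \<Longrightarrow> (\<And>y. \<phi> y \<ge> 0) \<Longrightarrow> (\<And>y. \<phi> y > 0 \<longleftrightarrow> y \<in> ball w0 r) \<Longrightarrow> V \<subseteq> U \<Longrightarrow>
      set_integrable lborel U (\<lambda>y. \<phi> y *\<^sub>R G y) \<and> (LINT y:U|lborel. \<phi> y *\<^sub>R G y) \<noteq> 0"
  proof (rule bump_integral_nonzero[OF V(1,2) G])
    fix r
    assume a: "r > 0" "cball w0 r \<subseteq> V"
      and b: "\<And>\<phi> U. continuous_on UNIV \<phi> \<Longrightarrow> (\<And>y. \<phi> y \<ge> 0) \<Longrightarrow> (\<And>y. \<phi> y > 0 \<longleftrightarrow> y \<in> ball w0 r) \<Longrightarrow> V \<subseteq> U \<Longrightarrow>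
        set_integrable lborel U (\<lambda>y. \<phi> y *\<^sub>R G y) \<and> (LINT y:U|lborel. \<phi> y *\<^sub>R G y) \<noteq> 0"
    show thesis by (rule that[OF a b])
  qed
  obtain \<phi> where \<phi>: "smooth_on \<phi> UNIV" "\<And>y. \<phi> y \<ge> (0::real)" "\<And>y. \<phi> y > 0 \<longleftrightarrow> y \<in> ball w0 r"
    by (rule smooth_bump[OF r(1), of w0], rule that)
  let ?V = "snd c ` fst c"
  note I = I[OF smooth_on_imp_continuous[OF \<phi>(1)] \<phi>(2,3) V(3)]
  show thesis
  proof
    have "compact (chart_inv c ` cball w0 r)"
      by (rule compact_continuous_image[OF continuous_on_subset[OF chart_inv_cont[OF SA c]]])
        (use r V in auto)
    moreover have "\<phi> (snd c x) = 0" if x: "x \<in> fst c" "x \<notin> chart_inv c ` cball w0 r" for x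
    proof (rule ccontr)
      assume "\<phi> (snd c x) \<noteq> 0"
      then have "\<phi> (snd c x) > 0" using \<phi>(2)[of "snd c x"] by simp
      then have "snd c x \<in> cball w0 r" using \<phi>(3)[of "snd c x"] by auto
      then show False using x chart_inv_left[OF SA c x(1)] by (metis imageI)
    qed
    ultimately show "is_bump c (chart_inv c ` V) \<phi> (chart_inv c ` cball w0 r)"
      using \<phi>(1) r(2) by (auto simp: is_bump_def)
  next
    fix \<omega> :: "'c \<Rightarrow> (real ^ 4) list \<Rightarrow> complex"
    assume alt: "\<And>x. alternating 4 (\<omega> x)"
      and supp: "\<And>x vs. x \<notin> fst c \<Longrightarrow> length vs = 4 \<Longrightarrow> \<omega> x vs = 0"
      and eq: "\<And>x. x \<in> fst c \<Longrightarrow> coord_form A \<omega> c (snd c x) std_basis4 = \<phi> (snd c x) *\<^sub>R G (snd c x)"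
    have e: "indicat_real ?V y *\<^sub>R coord_form A \<omega> c y std_basis4 = indicat_real ?V y *\<^sub>R (\<phi> y *\<^sub>R G y)" for y
      using eq by (auto simp: indicator_def)
    have "set_integrable lborel ?V (\<lambda>y. coord_form A \<omega> c y std_basis4)"
      using I unfolding set_integrable_def e by blast
    from form_integral_chart[OF A c alt supp this]
    have "form_integral A \<omega> = (LINT y:?V|lborel. \<phi> y *\<^sub>R G y)"
      unfolding set_lebesgue_integral_def e by simp
    then show "form_integral A \<omega> \<noteq> 0" using I by simp
  qed
qed

text \<open>Used to extend locally defined sections by zero.\<close>

lemma smooth_on_glue:
  assumes "open S1" "open S2" "S = S1 \<union> S2" "smooth_on g S1" "\<And>w. w \<in> S1 \<Longrightarrow> h w = g w" "\<And>w. w \<in> S2 \<Longrightarrow> h w = 0"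
  shows "smooth_on h S"
proof -
  have "smooth_on h S1" by (rule smooth_on_cong[OF assms(1) _ assms(4)]) (simp add: assms(5))
  moreover have "smooth_on h S2" by (rule smooth_on_cong[OF assms(2) _ smooth_on_const[of 0]]) (simp add: assms(6))
  ultimately show ?thesis using smooth_on_Un[OF assms(1,2)] assms(3) by simp
qed

lemma std_basis4_list: "std_basis4 = [axis 0 1, axis 1 1, axis 2 1, axis 3 1]"
  by (simp add: std_basis4_def)

lemma wedge_zero_left: "(\<And>vs. length vs = k \<Longrightarrow> \<alpha> vs = 0) \<Longrightarrow> wedge k l \<alpha> \<beta> vs = 0"
  by (simp add: wedge_def)

lemma wedge_zero_right: "(\<And>vs. length vs = l \<Longrightarrow> \<beta> vs = 0) \<Longrightarrow> wedge k l \<alpha> \<beta> vs = 0"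
  by (simp add: wedge_def)

text \<open>The coordinates, in the chart \<open>c\<close> of the domain, of the points that \<open>f\<close> maps into the chart \<open>d\<close>.\<close>

definition overlap :: "('c \<Rightarrow> 'm) \<Rightarrow> ('c, 'd) chart \<Rightarrow> ('m, 'e) chart \<Rightarrow> 'd set" where
  "overlap f c d = snd c ` (fst c \<inter> f -` fst d)"

text \<open>The derivative of the coordinate expression of \<open>f\<close>.\<close>

definition local_deriv ::
  "('c \<Rightarrow> 'm) \<Rightarrow> ('c, 'd::euclidean_space) chart \<Rightarrow> ('m, 'e::euclidean_space) chart \<Rightarrow> 'd \<Rightarrow> 'd \<Rightarrow> 'e" where
  "local_deriv f c d w = frechet_derivative (snd d \<circ> f \<circ> chart_inv c) (at w)"

text \<open>The form \<open>f\<^sup>*\<Omega>\<close> in the chart \<open>c\<close>.\<close>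

definition pull_coord ::
  "('m, 'e::euclidean_space) chart set \<Rightarrow> ('m \<Rightarrow> 'e list \<Rightarrow> 'b) \<Rightarrow> ('c, 'd::euclidean_space) chart set \<Rightarrow>
   ('c \<Rightarrow> 'm) \<Rightarrow> ('c, 'd) chart \<Rightarrow> 'd \<Rightarrow> 'd list \<Rightarrow> 'b" where
  "pull_coord AM \<Omega> AC f c w = coord_form AC (pullback AC AM f \<Omega>) c w"

text \<open>The form \<open>f\<^sup>*(\<iota>\<^sub>u\<Omega>)\<close> in the chart \<open>c\<close>, for the vector field along \<open>f\<close> with constant components \<open>u\<close>
  in the chart \<open>d\<close>.\<close>

definition contract_coord ::
  "('m, 'e::euclidean_space) chart set \<Rightarrow> ('m \<Rightarrow> 'e list \<Rightarrow> 'b) \<Rightarrow> ('c, 'd::euclidean_space) chart set \<Rightarrow>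
   ('c \<Rightarrow> 'm) \<Rightarrow> ('c, 'd) chart \<Rightarrow> ('m, 'e) chart \<Rightarrow> 'e \<Rightarrow> 'd \<Rightarrow> 'd list \<Rightarrow> 'b" where
  "contract_coord AM \<Omega> AC f c d u w =
     coord_form AC (pullback_contract AC AM f (\<lambda>x. coord_vec AM d (f x) u) \<Omega>) c w"

text \<open>The imaginary one-form \<open>\<i> \<phi> dx\<^sub>j\<close> in the chart \<open>c\<close>, extended by zero.\<close>

definition bump_one_form ::
  "('c, real ^ 4) chart set \<Rightarrow> ('c, real ^ 4) chart \<Rightarrow> (real ^ 4 \<Rightarrow> real) \<Rightarrow> 4 \<Rightarrow>
   'c \<Rightarrow> (real ^ 4) list \<Rightarrow> complex" where
  "bump_one_form AC c \<phi> j x Xs =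
     (if x \<in> fst c then \<phi> (snd c x) *\<^sub>R (\<i> * of_real (vec_coord AC c x (hd Xs) $ j)) else 0)"

text \<open>The vector field along \<open>f\<close> with components \<open>\<phi> u\<close> in the chart \<open>d\<close>, extended by zero; \<open>\<phi>\<close> is a function of
  the coordinates in the chart \<open>c\<close>.\<close>

definition bump_field ::
  "('m, 'e::euclidean_space) chart set \<Rightarrow> ('c \<Rightarrow> 'm) \<Rightarrow> ('c, 'd) chart \<Rightarrow> ('m, 'e) chart \<Rightarrow>
   ('d \<Rightarrow> real) \<Rightarrow> 'e \<Rightarrow> 'c \<Rightarrow> 'e" where
  "bump_field AM f c d \<phi> u x =
     (if x \<in> fst c \<inter> f -` fst d then \<phi> (snd c x) *\<^sub>R coord_vec AM d (f x) u else 0)"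

context
  fixes AM :: "('m::{t2_space, second_countable_topology}, real ^ 7) chart set"
    and \<Omega> :: "'m \<Rightarrow> (real ^ 7) list \<Rightarrow> real"
    and AC :: "('c::{t2_space, second_countable_topology}, real ^ 4) chart set"
    and f :: "'c \<Rightarrow> 'm"
  assumes M: "almost_G2_manifold AM \<Omega>" and C: "oriented_atlas AC" and f: "immersion AC AM f"
begin

lemma dom_atlas: "smooth_atlas AC" using C by (simp add: oriented_atlas_def)
lemma cod_atlas: "smooth_atlas AM" using M by (simp add: almost_G2_manifold_def)
lemma f_smooth: "smooth_map AC AM f" using f by (simp add: immersion_def)
lemma f_cont: "continuous_on UNIV f" using f_smooth by (simp add: smooth_map_def)
lemma form_alternating: "alternating 3 (\<Omega> p)" using M by (simp add: almost_G2_manifold_def smooth_form_def)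
lemma df_linear: "linear (map_deriv AC AM f x)" by (rule map_deriv_linear[OF dom_atlas cod_atlas f_smooth])

lemma pullback_alt: "alternating 3 (pullback AC AM f \<Omega> x)"
  using alternating_map_linear[OF form_alternating df_linear] by (simp add: pullback_def[abs_def])

lemma pullback_contract_alt: "alternating 2 (pullback_contract AC AM f v \<Omega> x)"
  using alternating_map_linear[OF alternating_contract[OF form_alternating] df_linear]
  by (simp add: pullback_contract_def[abs_def])

lemma coord_form_continuous:
  assumes d: "d \<in> AM" and y: "continuous_on V y" "y ` V \<subseteq> snd d ` fst d"
    and abc: "continuous_on V a" "continuous_on V b" "continuous_on V c"
  shows "continuous_on V (\<lambda>w. coord_form AM \<Omega> d (y w) [a w, b w, c w])"
proof -
  have s: "continuous_on (snd d ` fst d) (\<lambda>y. coord_form AM \<Omega> d y [i, j, k])" for i j k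
    using M d by (intro smooth_on_imp_continuous) (simp add: almost_G2_manifold_def smooth_form_def)
  have "continuous_on V (\<lambda>w. coord_form AM \<Omega> d (y w) [i, j, k])" for i j k
    by (rule continuous_on_compose2[OF s y])
  then have "continuous_on V (\<lambda>w. \<Sum>i\<in>Basis. (a w \<bullet> i) *\<^sub>R (\<Sum>j\<in>Basis. (b w \<bullet> j) *\<^sub>R
      (\<Sum>k\<in>Basis. (c w \<bullet> k) *\<^sub>R coord_form AM \<Omega> d (y w) [i, j, k])))"
    by (intro continuous_intros abc)
  moreover have "coord_form AM \<Omega> d (y w) [a w, b w, c w] = (\<Sum>i\<in>Basis. (a w \<bullet> i) *\<^sub>R (\<Sum>j\<in>Basis. (b w \<bullet> j) *\<^sub>R
      (\<Sum>k\<in>Basis. (c w \<bullet> k) *\<^sub>R coord_form AM \<Omega> d (y w) [i, j, k])))" if "w \<in> V" for w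
  proof -
    have x: "chart_inv d (y w) \<in> fst d" using that y(2) chart_inv_left[OF cod_atlas d] by auto
    have "alternating 3 (coord_form AM \<Omega> d (y w))"
      using alternating_map_linear[OF form_alternating coord_vec_linear[OF cod_atlas d x]] by (simp add: coord_form_def[abs_def])
    then show ?thesis by (rule alternating3_expand)
  qed
  ultimately show ?thesis by (simp cong: continuous_on_cong)
qed

context
  fixes c :: "('c, real ^ 4) chart" and d :: "('m, real ^ 7) chart"
  assumes c: "c \<in> AC" and d: "d \<in> AM"
begin

lemma preimage_open: "open (f -` fst d)"
  using open_vimage[OF chart_dom_open[OF cod_atlas d] f_cont] .

lemma overlap_open: "open (overlap f c d)"
  unfolding overlap_def by (rule chart_image_open[OF dom_atlas c preimage_open])

lemma local_map_smooth: "smooth_on (snd d \<circ> f \<circ> chart_inv c) (overlap f c d)"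
  using f_smooth c d by (simp add: smooth_map_def overlap_def)

lemma local_deriv_continuous: "continuous_on (overlap f c d) (\<lambda>w. local_deriv f c d w X)"
  unfolding local_deriv_def by (rule smooth_on_imp_continuous[OF smooth_on_deriv[OF local_map_smooth]])

lemma form_local:
  assumes x: "x \<in> fst c" "f x \<in> fst d"
  shows "\<Omega> (f x) [coord_vec AM d (f x) u, coord_vec AM d (f x) v, coord_vec AM d (f x) w] =
    coord_form AM \<Omega> d ((snd d \<circ> f \<circ> chart_inv c) (snd c x)) [u, v, w]"
  by (simp add: coord_form_def chart_inv_left[OF dom_atlas c x(1)] chart_inv_left[OF cod_atlas d x(2)])

lemma df_local:
  assumes x: "x \<in> fst c" "f x \<in> fst d"
  shows "map_deriv AC AM f x (coord_vec AC c x X) = coord_vec AM d (f x) (local_deriv f c d (snd c x) X)"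
  unfolding local_deriv_def by (rule map_deriv_coord_vec[OF dom_atlas cod_atlas f_smooth c x(1) d x(2)])

lemma local_form_continuous:
  assumes "continuous_on (overlap f c d) a" "continuous_on (overlap f c d) b" "continuous_on (overlap f c d) e"
  shows "continuous_on (overlap f c d) (\<lambda>w. coord_form AM \<Omega> d ((snd d \<circ> f \<circ> chart_inv c) w) [a w, b w, e w])"
proof (rule coord_form_continuous[OF d smooth_on_imp_continuous[OF local_map_smooth] _ assms])
  show "(snd d \<circ> f \<circ> chart_inv c) ` (overlap f c d) \<subseteq> snd d ` fst d"
    using chart_inv_left[OF dom_atlas c] by (auto simp: overlap_def)
qed

lemma vec_coord_coord_vec_self: "x \<in> fst c \<Longrightarrow> vec_coord AC c x (coord_vec AC c x X) = X"
  using vec_coord_coord_vec[OF dom_atlas c c] jac_refl[OF dom_atlas c] by simp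

lemma overlapE:
  assumes "w \<in> (overlap f c d)"
  obtains x where "x \<in> fst c" "f x \<in> fst d" "w = snd c x" "chart_inv c w = x"
  using assms chart_inv_left[OF dom_atlas c] by (auto simp: overlap_def)

lemma pull_coord_alt: "x \<in> fst c \<Longrightarrow> alternating 3 (pull_coord AM \<Omega> AC f c (snd c x))"
  unfolding pull_coord_def coord_form_def[abs_def] chart_inv_left[OF dom_atlas c]
  by (rule alternating_map_linear[OF pullback_alt coord_vec_linear[OF dom_atlas c]])

lemma contract_coord_alt: "x \<in> fst c \<Longrightarrow> alternating 2 (contract_coord AM \<Omega> AC f c d u (snd c x))"
  unfolding contract_coord_def coord_form_def[abs_def] chart_inv_left[OF dom_atlas c]
  by (rule alternating_map_linear[OF pullback_contract_alt coord_vec_linear[OF dom_atlas c]])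

lemma pull_coord_continuous: "continuous_on (overlap f c d) (\<lambda>w. pull_coord AM \<Omega> AC f c w [X, Y, Z])"
proof -
  have "continuous_on (overlap f c d) (\<lambda>w. coord_form AM \<Omega> d ((snd d \<circ> f \<circ> chart_inv c) w)
      [local_deriv f c d w X, local_deriv f c d w Y, local_deriv f c d w Z])"
    by (intro local_form_continuous local_deriv_continuous)
  moreover have "coord_form AM \<Omega> d ((snd d \<circ> f \<circ> chart_inv c) w) [local_deriv f c d w X, local_deriv f c d w Y, local_deriv f c d w Z]
      = pull_coord AM \<Omega> AC f c w [X, Y, Z]" if w: "w \<in> (overlap f c d)" for w
  proof -
    obtain x where x: "x \<in> fst c" "f x \<in> fst d" "w = snd c x" "chart_inv c w = x" using overlapE[OF w] .
    have "pull_coord AM \<Omega> AC f c w [X, Y, Z] = \<Omega> (f x) [map_deriv AC AM f x (coord_vec AC c x X),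
        map_deriv AC AM f x (coord_vec AC c x Y), map_deriv AC AM f x (coord_vec AC c x Z)]"
      by (simp add: pull_coord_def coord_form_def pullback_def x(4))
    then show ?thesis by (simp only: df_local[OF x(1,2)] form_local[OF x(1,2)] x(3))
  qed
  ultimately show ?thesis by (simp cong: continuous_on_cong)
qed

lemma contract_coord_continuous: "continuous_on (overlap f c d) (\<lambda>w. contract_coord AM \<Omega> AC f c d u w [X, Y])"
proof -
  have "continuous_on (overlap f c d) (\<lambda>w. coord_form AM \<Omega> d ((snd d \<circ> f \<circ> chart_inv c) w)
      [u, local_deriv f c d w X, local_deriv f c d w Y])"
    by (intro local_form_continuous local_deriv_continuous continuous_on_const)
  moreover have "coord_form AM \<Omega> d ((snd d \<circ> f \<circ> chart_inv c) w) [u, local_deriv f c d w X, local_deriv f c d w Y]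
      = contract_coord AM \<Omega> AC f c d u w [X, Y]" if w: "w \<in> (overlap f c d)" for w
  proof -
    obtain x where x: "x \<in> fst c" "f x \<in> fst d" "w = snd c x" "chart_inv c w = x" using overlapE[OF w] .
    have "contract_coord AM \<Omega> AC f c d u w [X, Y] = \<Omega> (f x) [coord_vec AM d (f x) u,
        map_deriv AC AM f x (coord_vec AC c x X), map_deriv AC AM f x (coord_vec AC c x Y)]"
      by (simp add: contract_coord_def coord_form_def pullback_contract_def x(4))
    then show ?thesis by (simp only: df_local[OF x(1,2)] form_local[OF x(1,2)] x(3))
  qed
  ultimately show ?thesis by (simp cong: continuous_on_cong)
qed

lemma zero_one_form: "(\<lambda>_ _. 0) \<in> ad_one_forms AC"
  unfolding ad_one_forms_def smooth_form_def alternating1_iff coord_form_def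
  by (simp add: smooth_on_const linear_zero)

lemma zero_field: "(\<lambda>_. 0) \<in> pullback_sections AC AM f"
  unfolding pullback_sections_def
proof (intro CollectI ballI)
  fix c' d' assume c': "c' \<in> AC" and d': "d' \<in> AM"
  have o: "open (snd c' ` (fst c' \<inter> f -` fst d'))"
    using chart_image_open[OF dom_atlas c' open_vimage[OF chart_dom_open[OF cod_atlas d'] f_cont]] .
  show "smooth_on ((\<lambda>x. vec_coord AM d' (f x) 0) \<circ> chart_inv c') (snd c' ` (fst c' \<inter> f -` fst d'))"
  proof (rule smooth_on_cong[OF o _ smooth_on_const[of 0]])
    show "0 = ((\<lambda>x. vec_coord AM d' (f x) 0) \<circ> chart_inv c') w" if "w \<in> snd c' ` (fst c' \<inter> f -` fst d')" for w
      using that linear_0[OF vec_coord_linear[OF cod_atlas d']] chart_inv_left[OF dom_atlas c'] by auto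
  qed
qed

context
  fixes \<phi> :: "real ^ 4 \<Rightarrow> real" and K :: "'c set"
  assumes bump: "is_bump c (fst c \<inter> f -` fst d) \<phi> K"
begin

lemma bump_parts:
  shows bump_function_smooth: "smooth_on \<phi> UNIV" and bump_support: "compact K" "K \<subseteq> fst c \<inter> f -` fst d"
    and bump_zero: "x \<in> fst c \<Longrightarrow> x \<notin> K \<Longrightarrow> \<phi> (snd c x) = 0"
  using bump by (auto simp: is_bump_def)

lemma bump_smooth:
  assumes c': "c' \<in> AC"
  shows "smooth_on (\<lambda>w. \<phi> ((snd c \<circ> chart_inv c') w)) (snd c' ` (fst c' \<inter> fst c))"
  by (rule smooth_on_compose[OF _ open_UNIV _ bump_function_smooth transition_smooth[OF dom_atlas c' c]])
    (use chart_image_open[OF dom_atlas c' chart_dom_open[OF dom_atlas c]] in auto)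

lemma complement_open: "c' \<in> AC \<Longrightarrow> open U \<Longrightarrow> open (snd c' ` (fst c' \<inter> (U \<inter> - K)))"
  by (intro chart_image_open[OF dom_atlas]) (auto intro: compact_imp_closed bump_support)

lemma bump_one_form_ad: "bump_one_form AC c \<phi> j \<in> ad_one_forms AC"
proof -
  have alt: "alternating 1 (bump_one_form AC c \<phi> j x)" for x
  proof (cases "x \<in> fst c")
    case True
    note l = vec_coord_linear[OF dom_atlas c True]
    show ?thesis unfolding alternating1_iff using True
      by (auto simp: bump_one_form_def linear_add[OF l] linear_scale[OF l]
          complex_eq_iff algebra_simps intro!: linearI)
  next
    case False
    then show ?thesis unfolding alternating1_iff by (simp add: bump_one_form_def linear_zero)
  qed
  have sm: "smooth_on (\<lambda>w. coord_form AC (bump_one_form AC c \<phi> j) c' w Xs) (snd c' ` fst c')"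
    if c': "c' \<in> AC" and Xs: "length Xs = 1" for c' Xs
  proof -
    obtain X where X: "Xs = [X]" using Xs by (auto simp: length_Suc_conv)
    let ?S1 = "snd c' ` (fst c' \<inter> fst c)" and ?S2 = "snd c' ` (fst c' \<inter> (UNIV \<inter> - K))"
    have o1: "open ?S1" using chart_image_open[OF dom_atlas c' chart_dom_open[OF dom_atlas c]] .
    have "bounded_linear (\<lambda>Z :: real ^ 4. \<i> * complex_of_real (Z $ j))"
      by (rule linear_conv_bounded_linear[THEN iffD1]) (auto intro!: linearI simp: complex_eq_iff algebra_simps)
    then have "smooth_on (\<lambda>w. \<i> * complex_of_real (jac c' c (chart_inv c' w) X $ j)) ?S1"
      using smooth_on_compose[OF o1 open_UNIV _ smooth_on_bounded_linear[OF _ open_UNIV] jac_smooth[OF dom_atlas c' c, of X]] by auto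
    then have g: "smooth_on (\<lambda>w. \<phi> ((snd c \<circ> chart_inv c') w) *\<^sub>R (\<i> * complex_of_real (jac c' c (chart_inv c' w) X $ j))) ?S1"
      by (rule smooth_on_bilinear[OF bounded_bilinear_scaleR o1 bump_smooth[OF c']])
    show ?thesis
    proof (rule smooth_on_glue[OF o1 complement_open[OF c' open_UNIV] _ g])
      show "snd c' ` fst c' = ?S1 \<union> ?S2" using bump_support by auto
      show "coord_form AC (bump_one_form AC c \<phi> j) c' w Xs =
          \<phi> ((snd c \<circ> chart_inv c') w) *\<^sub>R (\<i> * complex_of_real (jac c' c (chart_inv c' w) X $ j))"
        if "w \<in> ?S1" for w
        using that vec_coord_coord_vec[OF dom_atlas c' c] chart_inv_left[OF dom_atlas c']
        by (auto simp: coord_form_def bump_one_form_def X)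
      show "coord_form AC (bump_one_form AC c \<phi> j) c' w Xs = 0" if "w \<in> ?S2" for w
        using that bump_zero chart_inv_left[OF dom_atlas c'] by (auto simp: coord_form_def bump_one_form_def)
    qed
  qed
  have "Re (bump_one_form AC c \<phi> j x [X]) = 0" for x X by (simp add: bump_one_form_def)
  then show ?thesis using alt sm by (simp add: ad_one_forms_def smooth_form_def)
qed

lemma bump_field_section: "bump_field AM f c d \<phi> u \<in> pullback_sections AC AM f"
  unfolding pullback_sections_def
proof (intro CollectI ballI)
  fix c' d' assume c': "c' \<in> AC" and d': "d' \<in> AM"
  let ?U = "f -` fst d'"
  let ?S1 = "snd c' ` (fst c' \<inter> (?U \<inter> (fst c \<inter> f -` fst d)))" and ?S2 = "snd c' ` (fst c' \<inter> (?U \<inter> - K))"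
  have U: "open ?U" using open_vimage[OF chart_dom_open[OF cod_atlas d'] f_cont] .
  have o1: "open ?S1"
    by (rule chart_image_open[OF dom_atlas c']) (intro open_Int U preimage_open chart_dom_open[OF dom_atlas c])
  have inv: "chart_inv c' (snd c' x) = x" if "x \<in> fst c'" for x using chart_inv_left[OF dom_atlas c' that] .
  have s1: "smooth_on (snd d \<circ> f \<circ> chart_inv c') ?S1"
    by (rule smooth_on_subset[of _ "snd c' ` (fst c' \<inter> f -` fst d)"])
      (use f_smooth c' d in \<open>auto simp: smooth_map_def\<close>)
  have s2: "(snd d \<circ> f \<circ> chart_inv c') ` ?S1 \<subseteq> snd d ` (fst d \<inter> fst d')" using inv by auto
  have "smooth_on (\<lambda>w. jac d d' (chart_inv d ((snd d \<circ> f \<circ> chart_inv c') w)) u) ?S1"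
    by (rule smooth_on_compose[OF o1 chart_image_open[OF cod_atlas d chart_dom_open[OF cod_atlas d']] s2 jac_smooth[OF cod_atlas d d'] s1])
  moreover have "smooth_on (\<lambda>w. \<phi> ((snd c \<circ> chart_inv c') w)) ?S1"
    by (rule smooth_on_subset[OF bump_smooth[OF c']]) auto
  ultimately have g: "smooth_on (\<lambda>w. \<phi> ((snd c \<circ> chart_inv c') w) *\<^sub>R
      jac d d' (chart_inv d ((snd d \<circ> f \<circ> chart_inv c') w)) u) ?S1"
    by (intro smooth_on_bilinear[OF bounded_bilinear_scaleR o1])
  show "smooth_on ((\<lambda>x. vec_coord AM d' (f x) (bump_field AM f c d \<phi> u x)) \<circ> chart_inv c') (snd c' ` (fst c' \<inter> ?U))"
  proof (rule smooth_on_glue[OF o1 complement_open[OF c' U] _ g])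
    show "snd c' ` (fst c' \<inter> ?U) = ?S1 \<union> ?S2"
      unfolding image_Un[symmetric] using bump_support(2) by (intro arg_cong[where f = "image (snd c')"]) blast
    fix w
    show "((\<lambda>x. vec_coord AM d' (f x) (bump_field AM f c d \<phi> u x)) \<circ> chart_inv c') w = \<phi> ((snd c \<circ> chart_inv c') w) *\<^sub>R
      jac d d' (chart_inv d ((snd d \<circ> f \<circ> chart_inv c') w)) u" if w: "w \<in> ?S1"
    proof -
      obtain x where x: "x \<in> fst c'" "f x \<in> fst d'" "x \<in> fst c" "f x \<in> fst d" "w = snd c' x" using w by auto
      show ?thesis
        using linear_scale[OF vec_coord_linear[OF cod_atlas d' x(2)]] vec_coord_coord_vec[OF cod_atlas d d' x(4,2)]
        by (simp add: x inv bump_field_def chart_inv_left[OF cod_atlas d])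
    qed
    show "((\<lambda>x. vec_coord AM d' (f x) (bump_field AM f c d \<phi> u x)) \<circ> chart_inv c') w = 0" if w: "w \<in> ?S2"
    proof -
      obtain x where x: "x \<in> fst c'" "f x \<in> fst d'" "x \<notin> K" "w = snd c' x" using w by auto
      have "bump_field AM f c d \<phi> u x = 0" using bump_zero[of x] x(3) by (auto simp: bump_field_def)
      then show ?thesis using linear_0[OF vec_coord_linear[OF cod_atlas d' x(2)]] by (simp add: x inv)
    qed
  qed
qed

lemma bump_one_form_tangent: "((\<lambda>_. 0), bump_one_form AC c \<phi> j) \<in> configuration_tangent AC AM f"
  unfolding configuration_tangent_def
  using zero_field bump_one_form_ad[of j] bump_support(1) bump_zero by (auto simp: bump_one_form_def intro!: exI[of _ K])

lemma bump_field_tangent: "(bump_field AM f c d \<phi> u, (\<lambda>_ _. 0)) \<in> configuration_tangent AC AM f"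
  unfolding configuration_tangent_def
  using zero_one_form bump_field_section[of u] bump_support(1) bump_zero by (auto simp: bump_field_def intro!: exI[of _ K])

end

lemma overlap_sub: "overlap f c d \<subseteq> snd c ` fst c"
  by (auto simp: overlap_def)

lemma overlap_inv: "chart_inv c ` overlap f c d \<subseteq> fst c \<inter> f -` fst d"
  using chart_inv_left[OF dom_atlas c] by (auto simp: overlap_def)

context
  fixes E :: "('c, 'l) line_bundle" and D :: "('c \<Rightarrow> 'l) \<Rightarrow> 'c \<Rightarrow> real ^ 4 \<Rightarrow> 'l"
  assumes E: "hermitian_line_bundle AC E" and D: "D \<in> hermitian_connections AC E"
begin

abbreviation (input) "F \<equiv> curvature AC E D"

abbreviation (input) "integrand v \<beta> x vs \<equiv>
  wedge 2 2 (pullback_contract AC AM f v \<Omega> x) (F x) vs + wedge 3 1 (pullback AC AM f \<Omega> x) (\<beta> x) vs"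

lemma Phi0_eq: "Phi0 AC AM \<Omega> E (f, D) (v, \<beta>) = form_integral AC (integrand v \<beta>)"
  by (simp add: Phi0_def)

lemma F_alt: "alternating 2 (F x)"
  by (rule curvature_alternating[OF dom_atlas E D])

lemma integrand_alternating: "alternating 1 (\<beta> x) \<Longrightarrow> alternating 4 (integrand v \<beta> x)"
  by (intro alternating_add wedge22_alternating wedge31_alternating pullback_contract_alt F_alt pullback_alt)

text \<open>Lists of other lengths are excluded, because the values of the form on them are arbitrary.\<close>

lemma pullback_contract_zero: "v x = 0 \<Longrightarrow> length vs = 2 \<Longrightarrow> pullback_contract AC AM f v \<Omega> x vs = 0"
  using linear_0[OF alternating3D(1)[OF form_alternating]]
  by (auto simp: pullback_contract_def length_2_iff)

text \<open>The variation may be built after the bump function is known, so it is a function of \<open>\<phi>\<close>; \<open>G\<close> is the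
  coordinate expression of the integrand before the cut-off.\<close>

lemma Phi0_localized_nonzero:
  assumes G: "continuous_on (overlap f c d) G" "w0 \<in> overlap f c d" "G w0 \<noteq> 0"
    and t: "\<And>\<phi> K. is_bump c (fst c \<inter> f -` fst d) \<phi> K \<Longrightarrow> (v \<phi>, \<beta> \<phi>) \<in> configuration_tangent AC AM f"
    and supp: "\<And>\<phi> x X. x \<notin> fst c \<Longrightarrow> v \<phi> x = 0 \<and> \<beta> \<phi> x [X] = 0"
    and loc: "\<And>\<phi> K x. is_bump c (fst c \<inter> f -` fst d) \<phi> K \<Longrightarrow> x \<in> fst c \<Longrightarrow>
      integrand (v \<phi>) (\<beta> \<phi>) x (map (coord_vec AC c x) std_basis4) = \<phi> (snd c x) *\<^sub>R G (snd c x)"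
  shows "\<exists>t\<in>configuration_tangent AC AM f. Phi0 AC AM \<Omega> E (f, D) t \<noteq> 0"
proof (rule bump_form_integral_nonzero[OF C c overlap_open G(2) overlap_sub G(1,3)])
  fix \<phi> K
  assume bump: "is_bump c (chart_inv c ` overlap f c d) \<phi> K"
    and I: "\<And>\<omega>. (\<And>x. alternating 4 (\<omega> x)) \<Longrightarrow>
      (\<And>x vs. x \<notin> fst c \<Longrightarrow> length vs = 4 \<Longrightarrow> \<omega> x vs = 0) \<Longrightarrow>
      (\<And>x. x \<in> fst c \<Longrightarrow> coord_form AC \<omega> c (snd c x) std_basis4 = \<phi> (snd c x) *\<^sub>R G (snd c x)) \<Longrightarrow>
      form_integral AC \<omega> \<noteq> 0"
  have bump: "is_bump c (fst c \<inter> f -` fst d) \<phi> K"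
    using bump overlap_inv by (auto simp: is_bump_def)
  have "alternating 1 (\<beta> \<phi> x)" for x
    using t[OF bump] by (auto simp: configuration_tangent_def ad_one_forms_def smooth_form_def)
  then have "form_integral AC (integrand (v \<phi>) (\<beta> \<phi>)) \<noteq> 0"
  proof (intro I integrand_alternating)
    fix x and vs :: "(real ^ 4) list" assume x: "x \<notin> fst c"
    have "\<beta> \<phi> x Xs = 0" if "length Xs = 1" for Xs
      using supp[OF x] that by (auto simp: length_Suc_conv)
    then show "integrand (v \<phi>) (\<beta> \<phi>) x vs = 0"
      using supp[OF x] by (simp add: wedge_zero_left wedge_zero_right pullback_contract_zero)
  next
    fix x assume x: "x \<in> fst c"
    show "coord_form AC (integrand (v \<phi>) (\<beta> \<phi>)) c (snd c x) std_basis4 = \<phi> (snd c x) *\<^sub>R G (snd c x)"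
      unfolding coord_form_def chart_inv_left[OF dom_atlas c x] by (rule loc[OF bump x])
  qed
  then have "Phi0 AC AM \<Omega> E (f, D) (v \<phi>, \<beta> \<phi>) \<noteq> 0" by (simp only: Phi0_eq not_False_eq_True)
  then show ?thesis by (rule bexI[OF _ t[OF bump]])
qed

text \<open>If \<open>f\<^sup>*\<Omega> \<and> \<i> dx\<^sub>j\<close> is nonzero at a point, a variation of the connection detects it.\<close>

lemma Phi0_one_form_nonzero:
  assumes w0: "w0 \<in> overlap f c d"
    and nz: "wedge 3 1 (pull_coord AM \<Omega> AC f c w0) (\<lambda>Xs. \<i> * of_real (hd Xs $ j)) std_basis4 \<noteq> 0"
  shows "\<exists>t\<in>configuration_tangent AC AM f. Phi0 AC AM \<Omega> E (f, D) t \<noteq> 0"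
proof -
  let ?\<gamma> = "\<lambda>Xs. \<i> * complex_of_real (hd Xs $ j)"
  let ?v = "\<lambda>\<phi> :: real ^ 4 \<Rightarrow> real. \<lambda>_ :: 'c. 0 :: real ^ 7" and ?\<beta> = "\<lambda>\<phi>. bump_one_form AC c \<phi> j"
  let ?G = "\<lambda>w. wedge 3 1 (pull_coord AM \<Omega> AC f c w) ?\<gamma> std_basis4"
  have cont: "continuous_on (overlap f c d) ?G"
  proof -
    let ?p = "\<lambda>w a b e. pull_coord AM \<Omega> AC f c w [axis a 1, axis b 1, axis e 1] :: real"
    have "continuous_on (overlap f c d) (\<lambda>w. ?p w 0 1 2 *\<^sub>R ?\<gamma> [axis 3 1] - ?p w 0 1 3 *\<^sub>R ?\<gamma> [axis 2 1]
       + ?p w 0 2 3 *\<^sub>R ?\<gamma> [axis 1 1] - ?p w 1 2 3 *\<^sub>R ?\<gamma> [axis 0 1])"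
      by (intro continuous_intros pull_coord_continuous)
    moreover have "?p w 0 1 2 *\<^sub>R ?\<gamma> [axis 3 1] - ?p w 0 1 3 *\<^sub>R ?\<gamma> [axis 2 1]
       + ?p w 0 2 3 *\<^sub>R ?\<gamma> [axis 1 1] - ?p w 1 2 3 *\<^sub>R ?\<gamma> [axis 0 1] = ?G w" if w: "w \<in> overlap f c d" for w
    proof -
      obtain x where x: "x \<in> fst c" "w = snd c x" using overlapE[OF w] by metis
      show ?thesis unfolding std_basis4_list x(2) wedge31_list[OF pull_coord_alt[OF x(1)]] ..
    qed
    ultimately show ?thesis by (simp cong: continuous_on_cong)
  qed
  show ?thesis
  proof (rule Phi0_localized_nonzero[where G = ?G and v = ?v and \<beta> = ?\<beta>, OF cont w0 nz])
    fix \<phi> K assume bump: "is_bump c (fst c \<inter> f -` fst d) \<phi> K"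
    show "(?v \<phi>, ?\<beta> \<phi>) \<in> configuration_tangent AC AM f" by (rule bump_one_form_tangent[OF bump])
    fix x assume x: "x \<in> fst c"
    have p: "pullback AC AM f \<Omega> x [coord_vec AC c x X, coord_vec AC c x Y, coord_vec AC c x Z]
      = pull_coord AM \<Omega> AC f c (snd c x) [X, Y, Z]" for X Y Z
      by (simp add: pull_coord_def coord_form_def chart_inv_left[OF dom_atlas c x])
    have b: "?\<beta> \<phi> x [coord_vec AC c x X] = \<phi> (snd c x) *\<^sub>R ?\<gamma> [X]" for X
      using x by (simp add: bump_one_form_def vec_coord_coord_vec_self)
    have "wedge 2 2 (pullback_contract AC AM f (\<lambda>_. 0) \<Omega> x) (F x) vs = 0" for vs
      by (rule wedge_zero_left) (simp add: pullback_contract_zero)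
    then show "integrand (?v \<phi>) (?\<beta> \<phi>) x (map (coord_vec AC c x) std_basis4) = \<phi> (snd c x) *\<^sub>R ?G (snd c x)"
      unfolding std_basis4_list list.map wedge31_list[OF pullback_alt] wedge31_list[OF pull_coord_alt[OF x]] p b
      by (simp add: scaleR_add_right scaleR_diff_right mult.commute)
  qed (simp add: bump_one_form_def)
qed

text \<open>If \<open>f\<^sup>*(\<iota>\<^sub>u\<Omega>) \<and> F\<close> is nonzero at a point, a variation of the map detects it.\<close>

lemma Phi0_field_nonzero:
  assumes w0: "w0 \<in> overlap f c d"
    and nz: "wedge 2 2 (contract_coord AM \<Omega> AC f c d u w0) (coord_form AC F c w0) std_basis4 \<noteq> 0"
  shows "\<exists>t\<in>configuration_tangent AC AM f. Phi0 AC AM \<Omega> E (f, D) t \<noteq> 0"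
proof -
  let ?v = "\<lambda>\<phi>. bump_field AM f c d \<phi> u"
    and ?\<beta> = "\<lambda>\<phi> :: real ^ 4 \<Rightarrow> real. \<lambda>(_ :: 'c) (_ :: (real ^ 4) list). 0 :: complex"
  let ?G = "\<lambda>w. wedge 2 2 (contract_coord AM \<Omega> AC f c d u w) (coord_form AC F c w) std_basis4"
  have Falt: "alternating 2 (coord_form AC F c (snd c x))" if "x \<in> fst c" for x
    unfolding coord_form_def[abs_def] chart_inv_left[OF dom_atlas c that]
    by (rule alternating_map_linear[OF F_alt coord_vec_linear[OF dom_atlas c that]])
  have cont: "continuous_on (overlap f c d) ?G"
  proof -
    let ?p = "\<lambda>w a b. contract_coord AM \<Omega> AC f c d u w [axis a 1, axis b 1] :: real"
    let ?q = "\<lambda>w a b. coord_form AC F c w [axis a 1, axis b 1]"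
    have q: "continuous_on (overlap f c d) (\<lambda>w. ?q w a b)" for a b
      by (rule continuous_on_subset[OF curvature_coord_continuous[OF dom_atlas E D c] overlap_sub])
    have "continuous_on (overlap f c d) (\<lambda>w. ?p w 0 1 *\<^sub>R ?q w 2 3 - ?p w 0 2 *\<^sub>R ?q w 1 3
       + ?p w 0 3 *\<^sub>R ?q w 1 2 + ?p w 1 2 *\<^sub>R ?q w 0 3 - ?p w 1 3 *\<^sub>R ?q w 0 2 + ?p w 2 3 *\<^sub>R ?q w 0 1)"
      by (intro continuous_on_add continuous_on_diff continuous_on_scaleR contract_coord_continuous q)
    moreover have "?p w 0 1 *\<^sub>R ?q w 2 3 - ?p w 0 2 *\<^sub>R ?q w 1 3
       + ?p w 0 3 *\<^sub>R ?q w 1 2 + ?p w 1 2 *\<^sub>R ?q w 0 3 - ?p w 1 3 *\<^sub>R ?q w 0 2 + ?p w 2 3 *\<^sub>R ?q w 0 1 = ?G w"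
      if w: "w \<in> overlap f c d" for w
    proof -
      obtain x where x: "x \<in> fst c" "w = snd c x" using overlapE[OF w] by metis
      show ?thesis unfolding std_basis4_list x(2) wedge22_list[OF contract_coord_alt[OF x(1)] Falt[OF x(1)]] ..
    qed
    ultimately show ?thesis by (simp cong: continuous_on_cong)
  qed
  show ?thesis
  proof (rule Phi0_localized_nonzero[where G = ?G and v = ?v and \<beta> = ?\<beta>, OF cont w0 nz])
    fix \<phi> K assume bump: "is_bump c (fst c \<inter> f -` fst d) \<phi> K"
    show "(?v \<phi>, ?\<beta> \<phi>) \<in> configuration_tangent AC AM f" by (rule bump_field_tangent[OF bump])
    fix x assume x: "x \<in> fst c"
    have p: "pullback_contract AC AM f (?v \<phi>) \<Omega> x [coord_vec AC c x X, coord_vec AC c x Y]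
      = \<phi> (snd c x) * contract_coord AM \<Omega> AC f c d u (snd c x) [X, Y]" for X Y
    proof (cases "f x \<in> fst d")
      case True
      then show ?thesis using x linear_scale[OF alternating3D(1)[OF form_alternating]]
        by (simp add: contract_coord_def coord_form_def chart_inv_left[OF dom_atlas c x] pullback_contract_def bump_field_def)
    next
      case False
      then have "?v \<phi> x = 0" "\<phi> (snd c x) = 0" using bump x by (auto simp: bump_field_def is_bump_def)
      then show ?thesis by (simp add: pullback_contract_zero)
    qed
    have q: "F x [coord_vec AC c x X, coord_vec AC c x Y] = coord_form AC F c (snd c x) [X, Y]" for X Y
      by (simp add: coord_form_def chart_inv_left[OF dom_atlas c x])
    have "wedge 3 1 (pullback AC AM f \<Omega> x) (\<lambda>_. 0 :: complex) vs = 0" for vs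
      by (rule wedge_zero_right) simp
    then show "integrand (?v \<phi>) (?\<beta> \<phi>) x (map (coord_vec AC c x) std_basis4) = \<phi> (snd c x) *\<^sub>R ?G (snd c x)"
      unfolding std_basis4_list list.map wedge22_list[OF pullback_contract_alt F_alt]
        wedge22_list[OF contract_coord_alt[OF x] Falt[OF x]] p q
      by (simp add: scaleR_add_right scaleR_diff_right)
  qed (simp add: bump_field_def)
qed

end

end

end

section \<open>Zeros of the one-form\<close>

lemma adapted_coords:
  assumes "positive_form \<phi>"
  shows "linear (adapted_coords \<phi>)" "bij (adapted_coords \<phi>)"
    "length vs = 3 \<Longrightarrow> \<phi> vs = G2_form (map (adapted_coords \<phi>) vs)"
proof -
  have "adapted \<phi> (adapted_coords \<phi>)"
    using assms unfolding positive_form_def adapted_coords_def by (rule someI_ex)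
  then show "linear (adapted_coords \<phi>)" "bij (adapted_coords \<phi>)"
    "length vs = 3 \<Longrightarrow> \<phi> vs = G2_form (map (adapted_coords \<phi>) vs)"
    by (auto simp: adapted_def)
qed

lemma self_dual_part_pullback_iff:
  fixes AM :: "('m::{t2_space, second_countable_topology}, real ^ 7) chart set"
    and AC :: "('c::{t2_space, second_countable_topology}, real ^ 4) chart set"
    and F :: "(real ^ 4) list \<Rightarrow> 'b::real_vector"
  assumes M: "almost_G2_manifold AM \<Omega>" and C: "oriented_atlas AC" and f: "immersion AC AM f"
    and co: "coassociative AC AM \<Omega> f" and cal: "calibrated_orientation AC AM \<Omega> f"
    and F: "alternating 2 F"
  shows "(\<forall>us. length us = 2 \<longrightarrow> self_dual_part (pullback_metric AC AM \<Omega> f x) F us = 0) \<longleftrightarrow>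
    (\<forall>v vs. length vs = 4 \<longrightarrow> wedge 2 2 (pullback_contract AC AM f v \<Omega> x) F vs = 0)"
proof -
  let ?L = "adapted_coords (\<Omega> (f x))"
  \<comment> \<open>The same adapted coordinates compute the three-form, the metric and the dual form.\<close>
  define J where "J = ?L \<circ> map_deriv AC AM f x"
  have pos: "positive_form (\<Omega> (f x))" using M by (simp add: almost_G2_manifold_def)
  note L = adapted_coords[OF pos]
  have J: "linear J" unfolding J_def by (rule linear_compose[OF df_linear[OF M C f] L(1)])
  have injJ: "inj J"
    unfolding J_def using f L(2) by (intro inj_compose) (auto simp: immersion_def bij_def)
  have J_eq: "?L (map_deriv AC AM f x a) = J a" for a by (simp add: J_def)
  have coJ: "G2_form [J a, J b, J c] = 0" for a b c
    using co L(3)[of "map (map_deriv AC AM f x) [a, b, c]"] J_eq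
    by (auto simp: coassociative_def pullback_def dest!: spec[of _ x] spec[of _ "[a, b, c]"])
  have calJ: "G2_dual_form (map J std_basis4) > 0"
    using cal by (simp add: calibrated_orientation_def pullback_def G2_dual_def J_def comp_assoc)
  have metric: "pullback_metric AC AM \<Omega> f x = (\<lambda>a b. J a \<bullet> J b)"
    by (intro ext) (simp add: pullback_metric_def G2_metric_def J_eq)
  have con: "wedge 2 2 (pullback_contract AC AM f v \<Omega> x) F vs = wedge 2 2 (\<lambda>vs. G2_form (?L (v x) # map J vs)) F vs" for v vs
    unfolding wedge_def by (simp add: pullback_contract_def L(3) J_eq o_def)
  have "(\<forall>v vs. length vs = 4 \<longrightarrow> wedge 2 2 (pullback_contract AC AM f v \<Omega> x) F vs = 0) \<longleftrightarrow>
      (\<forall>u vs. length vs = 4 \<longrightarrow> wedge 2 2 (\<lambda>vs. G2_form (u # map J vs)) F vs = 0)" (is "?A \<longleftrightarrow> ?B")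
  proof
    assume A: ?A
    show ?B
    proof (intro allI impI)
      fix u vs assume vs: "length (vs :: (real ^ 4) list) = 4"
      obtain v where "?L v = u" using L(2) by (metis bij_pointE)
      then show "wedge 2 2 (\<lambda>vs. G2_form (u # map J vs)) F vs = 0"
        using A vs con[of "\<lambda>_. v" vs] by simp
    qed
  qed (simp add: con)
  then show ?thesis
    unfolding metric using self_dual_part_eq_0_iff_wedge[OF J injJ F coJ calJ] by simp
qed

lemma alternating4_coord_eq_0:
  fixes A :: "('c::{t2_space, second_countable_topology}, real ^ 4) chart set" and \<omega> :: "(real ^ 4) list \<Rightarrow> 'b::real_vector"
  assumes A: "smooth_atlas A" and c: "c \<in> A" "x \<in> fst c" and \<omega>: "alternating 4 \<omega>"
    and 0: "\<omega> (map (coord_vec A c x) std_basis4) = 0" and vs: "length vs = 4"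
  shows "\<omega> vs = 0"
proof -
  let ?us = "map (vec_coord A c x) vs"
  have "vs = map (coord_vec A c x) ?us" by (simp add: o_def coord_vec_vec_coord[OF A c])
  moreover have "\<omega> (map (coord_vec A c x) ?us) = dx [0, 1, 2, 3] ?us *\<^sub>R \<omega> (map (coord_vec A c x) std_basis4)"
    by (rule top_form_eq[OF alternating_map_linear[OF \<omega> coord_vec_linear[OF A c]]]) (simp add: vs)
  ultimately show ?thesis using 0 by simp
qed

lemma zeros_imp_coassociative:
  fixes AM :: "('m::{t2_space, second_countable_topology}, real ^ 7) chart set"
    and AC :: "('c::{t2_space, second_countable_topology}, real ^ 4) chart set"
  assumes M: "almost_G2_manifold AM \<Omega>" and C: "oriented_atlas AC" and f: "immersion AC AM f"
    and E: "hermitian_line_bundle AC E" and D: "D \<in> hermitian_connections AC E"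
    and 0: "\<forall>t \<in> configuration_tangent AC AM f. Phi0 AC AM \<Omega> E (f, D) t = 0"
  shows "coassociative AC AM \<Omega> f"
  unfolding coassociative_def
proof (intro allI impI)
  fix x and vs :: "(real ^ 4) list" assume vs: "length vs = 3"
  note dom_atlas = dom_atlas[OF M C f] and cod_atlas = cod_atlas[OF M C f]
  let ?c = "chart_at AC x" and ?d = "chart_at AM (f x)"
  note c = chart_at_in[OF dom_atlas, of x] and d = chart_at_in[OF cod_atlas, of "f x"]
  let ?p = "pull_coord AM \<Omega> AC f ?c (snd ?c x)"
  let ?\<gamma> = "\<lambda>j Xs. \<i> * complex_of_real (hd Xs $ j)"
  have w: "snd ?c x \<in> overlap f ?c ?d" using c d by (auto simp: overlap_def)
  have p: "alternating 3 ?p" by (rule pull_coord_alt[OF M C f c(1) d(1) c(2)])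
  \<comment> \<open>The coordinate one-form with index \<open>j\<close> picks out the component of \<open>f\<^sup>*\<Omega>\<close> with the other three indices.\<close>
  have z: "wedge 3 1 ?p (?\<gamma> j) std_basis4 = 0" for j
    using Phi0_one_form_nonzero[OF M C f c(1) d(1) E D w] 0 by blast
  have "?p [axis 0 1, axis 1 1, axis 2 1] = 0" "?p [axis 0 1, axis 1 1, axis 3 1] = 0"
    "?p [axis 0 1, axis 2 1, axis 3 1] = 0" "?p [axis 1 1, axis 2 1, axis 3 1] = 0"
    using z[of 3] z[of 2] z[of 1] z[of 0]
    unfolding std_basis4_list wedge31_list[OF p] by (simp_all add: axis_def)
  then have "?p [a, b, e] = 0" for a b e by (rule alternating3_eq_0[OF p])
  then have "?p vs = 0" using vs by (auto simp: length_3_iff)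
  moreover have "coord_vec AC ?c x = id" by (simp add: fun_eq_iff coord_vec_chart_at[OF dom_atlas])
  ultimately show "pullback AC AM f \<Omega> x vs = 0"
    by (simp add: pull_coord_def coord_form_def chart_inv_left[OF dom_atlas c])
qed

theorem lemma8:
  fixes AM :: "('m::{t2_space, second_countable_topology}, real ^ 7) chart set"
    and \<Omega> :: "'m \<Rightarrow> (real ^ 7) list \<Rightarrow> real"
    and AC :: "('c::{t2_space, second_countable_topology}, real ^ 4) chart set"
    and E :: "('c, 'l) line_bundle"
    and f :: "'c \<Rightarrow> 'm"
    and D :: "('c \<Rightarrow> 'l) \<Rightarrow> 'c \<Rightarrow> real ^ 4 \<Rightarrow> 'l"
  assumes "almost_G2_manifold AM \<Omega>"
    and "oriented_atlas AC"
    and "hermitian_line_bundle AC E"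
    and "(f, D) \<in> configuration_space AC AM E"
    and "coassociative AC AM \<Omega> f \<Longrightarrow> calibrated_orientation AC AM \<Omega> f"
  shows "(\<forall>t \<in> configuration_tangent AC AM f. Phi0 AC AM \<Omega> E (f, D) t = 0) \<longleftrightarrow>
    HSLag_cycle AC AM \<Omega> E (f, D)"
proof
  have f: "immersion AC AM f" and D: "D \<in> hermitian_connections AC E"
    using assms(4) by (auto simp: configuration_space_def)
  note h = assms(1,2) f
  note dom_atlas = dom_atlas[OF h] and cod_atlas = cod_atlas[OF h]
  note F = curvature_alternating[OF dom_atlas assms(3) D]
  have iff: "(\<forall>us. length us = 2 \<longrightarrow>
        self_dual_part (pullback_metric AC AM \<Omega> f x) (curvature AC E D x) us = 0) \<longleftrightarrow>
      (\<forall>v vs. length vs = 4 \<longrightarrow> wedge 2 2 (pullback_contract AC AM f v \<Omega> x) (curvature AC E D x) vs = 0)"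
    if "coassociative AC AM \<Omega> f" for x
    by (rule self_dual_part_pullback_iff[OF h that assms(5)[OF that] F])
  {
    assume 0: "\<forall>t \<in> configuration_tangent AC AM f. Phi0 AC AM \<Omega> E (f, D) t = 0"
    have co: "coassociative AC AM \<Omega> f" by (rule zeros_imp_coassociative[OF h assms(3) D 0])
    have "wedge 2 2 (pullback_contract AC AM f v \<Omega> x) (curvature AC E D x) vs = 0"
      if vs: "length vs = 4" for v x vs
    proof (rule alternating4_coord_eq_0[OF dom_atlas chart_at_in[OF dom_atlas] _ _ vs])
      let ?c = "chart_at AC x" and ?d = "chart_at AM (f x)"
      note c = chart_at_in[OF dom_atlas, of x] and d = chart_at_in[OF cod_atlas, of "f x"]
      show "alternating 4 (wedge 2 2 (pullback_contract AC AM f v \<Omega> x) (curvature AC E D x))"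
        by (rule wedge22_alternating[OF pullback_contract_alt[OF h] F])
      have w: "snd ?c x \<in> overlap f ?c ?d" using c d by (auto simp: overlap_def)
      have "wedge 2 2 (contract_coord AM \<Omega> AC f ?c ?d (v x) (snd ?c x))
          (coord_form AC (curvature AC E D) ?c (snd ?c x)) std_basis4 = 0"
        using Phi0_field_nonzero[OF h c(1) d(1) assms(3) D w] 0 by blast
      \<comment> \<open>In the preferred charts at \<open>x\<close> and \<open>f x\<close> components and tangent vectors coincide.\<close>
      moreover have "coord_vec AC ?c x = id" by (simp add: fun_eq_iff coord_vec_chart_at[OF dom_atlas])
      ultimately show "wedge 2 2 (pullback_contract AC AM f v \<Omega> x) (curvature AC E D x)
          (map (coord_vec AC ?c x) std_basis4) = 0"
        by (simp add: wedge_def contract_coord_def coord_form_def pullback_contract_def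
            chart_inv_left[OF dom_atlas c] coord_vec_chart_at[OF cod_atlas])
    qed
    then show "HSLag_cycle AC AM \<Omega> E (f, D)"
      unfolding HSLag_cycle_def using co iff[OF co] by simp
  }
  assume "HSLag_cycle AC AM \<Omega> E (f, D)"
  then have co: "coassociative AC AM \<Omega> f"
    and sd: "\<And>x us. length us = 2 \<Longrightarrow> self_dual_part (pullback_metric AC AM \<Omega> f x) (curvature AC E D x) us = 0"
    by (auto simp: HSLag_cycle_def)
  have "form_integral AC (\<lambda>x vs.
      wedge 2 2 (pullback_contract AC AM f v \<Omega> x) (curvature AC E D x) vs +
      wedge 3 1 (pullback AC AM f \<Omega> x) (\<beta> x) vs) = 0" for v \<beta>
  proof (rule form_integral_zero)
    fix x and vs :: "(real ^ 4) list" assume vs: "length vs = 4"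
    have "wedge 2 2 (pullback_contract AC AM f v \<Omega> x) (curvature AC E D x) vs = 0"
      using iff[OF co] sd vs by blast
    moreover have "wedge 3 1 (pullback AC AM f \<Omega> x) (\<beta> x) vs = 0"
      by (rule wedge_zero_left) (use co in \<open>simp add: coassociative_def\<close>)
    ultimately show "wedge 2 2 (pullback_contract AC AM f v \<Omega> x) (curvature AC E D x) vs +
      wedge 3 1 (pullback AC AM f \<Omega> x) (\<beta> x) vs = 0"
      by (simp only: add_0_right)
  qed
  then show "\<forall>t \<in> configuration_tangent AC AM f. Phi0 AC AM \<Omega> E (f, D) t = 0"
    by (auto simp: Phi0_def)
qed

end
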